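(* Let $S$ be a smooth compact manifold, possibly with smooth boundary, and $M$ a finite dimensional manifold without boundary, with $\dim S<\dim M$. Let $\mu$ be a volume form on $S$ and $g$ a Riemannian metric on $M$. The projection $$\pi_0:\operatorname{Emb}_0(S,M)\to\operatorname{Gr}^S_0(M),\qquad f\mapsto f(S)$$ is a Fréchet principal $\operatorname{Diff}(S)$-bundle.
   Context: All finite dimensional manifolds are smooth, connected and orientable. $\operatorname{Emb}(S,M)$ is the set of all smooth embeddings $S\to M$, an open submanifold of the Fréchet manifold $C^\infty(S,M)$; $\operatorname{Diff}(S)$ is the Fréchet Lie group of diffeomorphisms of $S$, acting on the right by composition. $\operatorname{Gr}^S(M)$ is the set of submanifolds $N\subset M$ (with boundary if $S$ has boundary) diffeomorphic to $S$, endowed with the Fréchet manifold structure for which $f\mapsto f(S)$, $\operatorname{Emb}(S,M)\to\operatorname{Gr}^S(M)$, is a Fréchet principal $\operatorname{Diff}(S)$-bundle. For a submanifold $N$ of $M$, $g_N$ is the metric induced by $g$ on $N$ and $\mu(g_N)$ the corresponding Riemannian volume form (so $\int_N\mu(g_N)$ is the Riemannian volume of $N$). Define $$\operatorname{Emb}_0(S,M):=\left\{f\in\operatorname{Emb}(S,M):\int_{f(S)}\mu(g_{f(S)})=\int_S\mu\right\},\qquad \operatorname{Gr}_0^S(M):=\left\{N\in\operatorname{Gr}^S(M):\int_N\mu(g_N)=\int_S\mu\right\},$$ where the integral over $S$ uses the orientation given by $\mu$. These sets carry the submanifold structures induced from $\operatorname{Emb}(S,M)$ and $\operatorname{Gr}^S(M)$,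 of which they are taken to be codimension one Fréchet submanifolds. A Fréchet principal $G$-bundle, for a Fréchet Lie group $G$, consists of a Fréchet manifold $Q$ with a right $G$-action and a submersion $\pi:Q\to B$ onto a Fréchet manifold $B$ such that each $b\in B$ has a neighborhood $U$ with a diffeomorphism $\pi^{-1}(U)\cong G\times U$ which turns the action into right translation on the factor $G$ and $\pi$ into the projection on $U$. *)

theory Defs
  imports "HOL-Analysis.Analysis" "HOL-Algebra.Group" "HOL-Library.Function_Algebras"
begin

section \<open>Functions into a real vector space\<close>

instantiation "fun" :: (type, real_vector) real_vector
begin

definition scaleR_fun :: "real \<Rightarrow> ('a \<Rightarrow> 'b) \<Rightarrow> 'a \<Rightarrow> 'b"
  where "scaleR_fun r f = (\<lambda>x. r *\<^sub>R f x)"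

instance
  by standard (simp_all add: scaleR_fun_def fun_eq_iff plus_fun_def scaleR_add_right scaleR_add_left)

end


section \<open>Finite dimensional manifolds, possibly with boundary\<close>

text \<open>The model space is a type \<open>'a\<close> of class \<open>real_inner\<close> that is required to be finite dimensional
  (see \<open>smooth_manifold\<close>). Unlike \<open>euclidean_space\<close>, this class also allows dimension zero.\<close>

primrec Ck_on :: "nat \<Rightarrow> 'a::real_normed_vector set \<Rightarrow> ('a \<Rightarrow> 'b::real_normed_vector) \<Rightarrow> bool" where
  "Ck_on 0 U f \<longleftrightarrow> continuous_on U f"
| "Ck_on (Suc k) U f \<longleftrightarrow>
     (\<exists>f'. (\<forall>x\<in>U. (f has_derivative f' x) (at x)) \<and> (\<forall>v. Ck_on k U (\<lambda>x. f' x v)))"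

text \<open>Smoothness on an arbitrary subset, such as a relatively open subset of a half space, means
  that there are local smooth extensions.\<close>

definition smooth_on :: "'a::real_normed_vector set \<Rightarrow> ('a \<Rightarrow> 'b::real_normed_vector) \<Rightarrow> bool" where
  "smooth_on A f \<longleftrightarrow> (\<forall>x\<in>A. \<exists>W F. open W \<and> x \<in> W \<and> (\<forall>k. Ck_on k W F) \<and> (\<forall>y\<in>A \<inter> W. F y = f y))"

type_synonym ('p, 'a) chart = "'p set \<times> ('p \<Rightarrow> 'a)"

type_synonym ('p, 'a) atlas = "('p, 'a) chart set"

definition pts :: "('p, 'a) atlas \<Rightarrow> 'p set" where
  "pts A = (\<Union>c\<in>A. fst c)"

definition cimg :: "('p, 'a) chart \<Rightarrow> 'a set" where
  "cimg c = snd c ` fst c"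

definition cinv :: "('p, 'a) chart \<Rightarrow> 'a \<Rightarrow> 'p" where
  "cinv c = inv_into (fst c) (snd c)"

text \<open>For \<open>e = 0\<close> this is the whole space, which serves for interior charts.\<close>

definition half_space :: "'a::real_inner \<Rightarrow> 'a set" where
  "half_space e = {x. 0 \<le> x \<bullet> e}"

definition is_chart :: "'p::topological_space set \<Rightarrow> ('p, 'a::real_inner) chart \<Rightarrow> bool" where
  "is_chart X c \<longleftrightarrow>
     openin (top_of_set X) (fst c) \<and>
     (\<exists>e. openin (top_of_set (half_space e)) (cimg c)) \<and>
     homeomorphism (fst c) (cimg c) (snd c) (cinv c)"

definition smooth_manifold :: "('p::topological_space, 'a::real_inner) atlas \<Rightarrow> bool" where
  "smooth_manifold A \<longleftrightarrow>
     (\<exists>B::'a set. finite B \<and> span B = UNIV) \<and>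
     Hausdorff_space (top_of_set (pts A)) \<and> second_countable (top_of_set (pts A)) \<and>
     (\<forall>c\<in>A. is_chart (pts A) c) \<and>
     (\<forall>c\<in>A. \<forall>d\<in>A. smooth_on (snd c ` (fst c \<inter> fst d)) (snd d \<circ> cinv c))"

definition boundary_pts :: "('p, 'a::real_inner) atlas \<Rightarrow> 'p set" where
  "boundary_pts A = {p. \<exists>c\<in>A. p \<in> fst c \<and> snd c p \<notin> interior (cimg c)}"

definition smooth_map ::
  "('p::topological_space, 'a::real_inner) atlas \<Rightarrow> ('q::topological_space, 'b::real_inner) atlas
    \<Rightarrow> ('p \<Rightarrow> 'q) \<Rightarrow> bool" where
  "smooth_map A B f \<longleftrightarrow>
     f ` pts A \<subseteq> pts B \<and> continuous_on (pts A) f \<and>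
     (\<forall>c\<in>A. \<forall>d\<in>B. smooth_on (snd c ` (fst c \<inter> f -` fst d)) (snd d \<circ> f \<circ> cinv c))"

definition diffeo ::
  "('p::topological_space, 'a::real_inner) atlas \<Rightarrow> ('q::topological_space, 'b::real_inner) atlas
    \<Rightarrow> ('p \<Rightarrow> 'q) \<Rightarrow> bool" where
  "diffeo A B f \<longleftrightarrow>
     smooth_map A B f \<and> bij_betw f (pts A) (pts B) \<and> smooth_map B A (inv_into (pts A) f)"

definition smooth_fun :: "('p, 'a::real_inner) atlas \<Rightarrow> ('p \<Rightarrow> real) \<Rightarrow> bool" where
  "smooth_fun A \<rho> \<longleftrightarrow> (\<forall>c\<in>A. smooth_on (cimg c) (\<rho> \<circ> cinv c))"


subsection \<open>Tangent vectors\<close>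

text \<open>A tangent vector at \<open>p\<close> is the family of its coordinate vectors in all charts of the atlas around
  \<open>p\<close>, related by the derivatives of the chart transitions; it is \<open>0\<close> at all other charts.\<close>

type_synonym ('p, 'a) tangent = "('p, 'a) chart \<Rightarrow> 'a"

definition coord_vec ::
  "('p, 'a::real_inner) atlas \<Rightarrow> ('p, 'a) chart \<Rightarrow> 'p \<Rightarrow> 'a \<Rightarrow> ('p, 'a) tangent" where
  "coord_vec A c p a =
     (\<lambda>d. if d \<in> A \<and> p \<in> fst d
          then frechet_derivative (snd d \<circ> cinv c) (at (snd c p) within cimg c) a else 0)"

definition tangent_space :: "('p, 'a::real_inner) atlas \<Rightarrow> 'p \<Rightarrow> ('p, 'a) tangent set" where
  "tangent_space A p = {coord_vec A c p a | c a. c \<in> A \<and> p \<in> fst c}"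

text \<open>The tangent space of the boundary if \<open>p\<close> is a boundary point. At an interior point only \<open>e = 0\<close>
  satisfies the premise, and one gets the full tangent space.\<close>

definition boundary_tangent_space :: "('p, 'a::real_inner) atlas \<Rightarrow> 'p \<Rightarrow> ('p, 'a) tangent set" where
  "boundary_tangent_space A p =
     {v \<in> tangent_space A p.
        \<forall>c\<in>A. p \<in> fst c \<longrightarrow> (\<forall>e. cimg c \<subseteq> half_space e \<and> snd c p \<bullet> e = 0 \<longrightarrow> v c \<bullet> e = 0)}"

definition pushforward ::
  "('p, 'a::real_inner) atlas \<Rightarrow> ('q, 'b::real_inner) atlas \<Rightarrow> ('p \<Rightarrow> 'q) \<Rightarrow> 'p
    \<Rightarrow> ('p, 'a) tangent \<Rightarrow> ('q, 'b) tangent" where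
  "pushforward A B f p v =
     (let c = (SOME c. c \<in> A \<and> p \<in> fst c) in
      (\<lambda>d. if d \<in> B \<and> f p \<in> fst d
           then frechet_derivative (snd d \<circ> f \<circ> cinv c) (at (snd c p) within cimg c) (v c) else 0))"

definition immersion ::
  "('p::topological_space, 'a::real_inner) atlas \<Rightarrow> ('q::topological_space, 'b::real_inner) atlas
    \<Rightarrow> ('p \<Rightarrow> 'q) \<Rightarrow> bool" where
  "immersion A B f \<longleftrightarrow>
     smooth_map A B f \<and> (\<forall>p\<in>pts A. inj_on (pushforward A B f p) (tangent_space A p))"

text \<open>The largest atlas on the subset \<open>N\<close> making the inclusion into \<open>M\<close> an immersion. The subset is a
  submanifold of dimension \<open>dim 'a\<close>, possibly with boundary, iff these charts cover it.\<close>

definition sub_atlas ::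
  "('q::topological_space, 'b::real_inner) atlas \<Rightarrow> 'q set \<Rightarrow> ('q, 'a::real_inner) atlas" where
  "sub_atlas M N = {c. is_chart N c \<and> immersion {c} M (\<lambda>x. x)}"


subsection \<open>Volume forms, Riemannian metrics and integration\<close>

definition volume_form ::
  "('p, 'a::real_inner) atlas \<Rightarrow> ('p \<Rightarrow> (nat \<Rightarrow> ('p, 'a) tangent) \<Rightarrow> real) \<Rightarrow> bool" where
  "volume_form A \<omega> \<longleftrightarrow> (let n = dim (UNIV :: 'a set) in
     (\<forall>p\<in>pts A. let T = tangent_space A p in
        (\<forall>v w. (\<forall>i<n. v i = w i) \<longrightarrow> \<omega> p v = \<omega> p w) \<and>
        (\<forall>v i a b. \<forall>x\<in>T. \<forall>y\<in>T. (\<forall>j<n. v j \<in> T) \<and> i < n \<longrightarrow>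
           \<omega> p (v(i := a *\<^sub>R x + b *\<^sub>R y)) = a * \<omega> p (v(i := x)) + b * \<omega> p (v(i := y))) \<and>
        (\<forall>v i j. (\<forall>l<n. v l \<in> T) \<and> i < j \<and> j < n \<and> v i = v j \<longrightarrow> \<omega> p v = 0) \<and>
        (\<exists>v. (\<forall>l<n. v l \<in> T) \<and> \<omega> p v \<noteq> 0)) \<and>
     (\<forall>c\<in>A. \<forall>a. smooth_on (cimg c) (\<lambda>y. \<omega> (cinv c y) (\<lambda>i. coord_vec A c (cinv c y) (a i)))))"

definition orientable :: "('p, 'a::real_inner) atlas \<Rightarrow> bool" where
  "orientable A \<longleftrightarrow> (\<exists>\<omega>. volume_form A \<omega>)"

definition riemannian_metric ::
  "('p, 'a::real_inner) atlas \<Rightarrow> ('p \<Rightarrow> ('p, 'a) tangent \<Rightarrow> ('p, 'a) tangent \<Rightarrow> real) \<Rightarrow> bool" where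
  "riemannian_metric A g \<longleftrightarrow>
     (\<forall>p\<in>pts A. let T = tangent_space A p in
        (\<forall>u\<in>T. \<forall>v\<in>T. \<forall>w\<in>T. \<forall>a b. g p (a *\<^sub>R u + b *\<^sub>R v) w = a * g p u w + b * g p v w) \<and>
        (\<forall>u\<in>T. \<forall>v\<in>T. g p u v = g p v u) \<and>
        (\<forall>v\<in>T. v \<noteq> 0 \<longrightarrow> 0 < g p v v)) \<and>
     (\<forall>c\<in>A. \<forall>a b. smooth_on (cimg c)
        (\<lambda>y. g (cinv c y) (coord_vec A c (cinv c y) a) (coord_vec A c (cinv c y) b)))"

definition induced_metric ::
  "('q, 'b::real_inner) atlas \<Rightarrow> ('q, 'a::real_inner) atlas
    \<Rightarrow> ('q \<Rightarrow> ('q, 'b) tangent \<Rightarrow> ('q, 'b) tangent \<Rightarrow> real)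
    \<Rightarrow> ('q \<Rightarrow> ('q, 'a) tangent \<Rightarrow> ('q, 'a) tangent \<Rightarrow> real)" where
  "induced_metric M N g =
     (\<lambda>p v w. g p (pushforward N M (\<lambda>x. x) p v) (pushforward N M (\<lambda>x. x) p w))"

definition onb :: "nat \<Rightarrow> 'a::real_inner" where
  "onb = (SOME e. let n = dim (UNIV :: 'a set) in
     (\<forall>i<n. \<forall>j<n. e i \<bullet> e j = of_bool (i = j)) \<and> span (e ` {..<n}) = UNIV)"

text \<open>Lebesgue measure on \<open>'a\<close>, defined in the same way as \<open>lborel\<close>, which is not available outside
  the class \<open>euclidean_space\<close>.\<close>

definition leb :: "'a::real_inner measure" where
  "leb = (let n = dim (UNIV :: 'a set) in
     distr (Pi\<^sub>M {..<n} (\<lambda>_. lborel :: real measure)) borel (\<lambda>x. \<Sum>i<n. x i *\<^sub>R onb i))"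

definition partition_of_unity ::
  "('p::topological_space, 'a::real_inner) atlas \<Rightarrow> (('p, 'a) chart \<times> ('p \<Rightarrow> real)) set \<Rightarrow> bool" where
  "partition_of_unity A P \<longleftrightarrow> finite P \<and>
     (\<forall>(c, \<rho>)\<in>P. c \<in> A \<and> smooth_fun A \<rho> \<and> (\<forall>x\<in>pts A. 0 \<le> \<rho> x) \<and>
        closure {x\<in>pts A. \<rho> x \<noteq> 0} \<inter> pts A \<subseteq> fst c) \<and>
     (\<forall>x\<in>pts A. (\<Sum>(c, \<rho>)\<in>P. \<rho> x) = 1)"

text \<open>The integral of the volume form \<open>\<omega>\<close> over a compact manifold with the orientation given by \<open>\<omega>\<close>
  itself, which explains the absolute value; up to sign, the coordinate representation of \<open>\<omega>\<close> does
  not depend on the choice of the orthonormal basis.\<close>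

definition form_integral ::
  "('p::topological_space, 'a::real_inner) atlas \<Rightarrow> ('p \<Rightarrow> (nat \<Rightarrow> ('p, 'a) tangent) \<Rightarrow> real) \<Rightarrow> real" where
  "form_integral A \<omega> =
     (\<Sum>(c, \<rho>)\<in>(SOME P. partition_of_unity A P).
        LINT y:cimg c|leb.
          \<rho> (cinv c y) * \<bar>\<omega> (cinv c y) (\<lambda>i. coord_vec A c (cinv c y) (onb i))\<bar>)"

text \<open>A form \<open>\<mu>(g)\<close>. On an orientable connected manifold there are two of them, one for each
  orientation.\<close>

definition riemannian_volume_form ::
  "('p, 'a::real_inner) atlas \<Rightarrow> ('p \<Rightarrow> ('p, 'a) tangent \<Rightarrow> ('p, 'a) tangent \<Rightarrow> real)
    \<Rightarrow> ('p \<Rightarrow> (nat \<Rightarrow> ('p, 'a) tangent) \<Rightarrow> real) \<Rightarrow> bool" where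
  "riemannian_volume_form A g \<omega> \<longleftrightarrow> volume_form A \<omega> \<and> (let n = dim (UNIV :: 'a set) in
     \<forall>p\<in>pts A. \<forall>e. (\<forall>i<n. e i \<in> tangent_space A p) \<and>
       (\<forall>i<n. \<forall>j<n. g p (e i) (e j) = of_bool (i = j)) \<longrightarrow> \<bar>\<omega> p e\<bar> = 1)"

definition riemannian_volume ::
  "('p::topological_space, 'a::real_inner) atlas
    \<Rightarrow> ('p \<Rightarrow> ('p, 'a) tangent \<Rightarrow> ('p, 'a) tangent \<Rightarrow> real) \<Rightarrow> real" where
  "riemannian_volume A g = form_integral A (SOME \<omega>. riemannian_volume_form A g \<omega>)"


section \<open>Frechet spaces and Frechet manifolds\<close>

definition seminorm_on :: "'v::real_vector set \<Rightarrow> ('v \<Rightarrow> real) \<Rightarrow> bool" where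
  "seminorm_on E p \<longleftrightarrow>
     (\<forall>x\<in>E. \<forall>y\<in>E. p (x + y) \<le> p x + p y) \<and> (\<forall>x\<in>E. \<forall>a. p (a *\<^sub>R x) = \<bar>a\<bar> * p x)"

definition seminorm_topology :: "'v::real_vector set \<Rightarrow> ('v \<Rightarrow> real) set \<Rightarrow> 'v topology" where
  "seminorm_topology E P = topology (\<lambda>U. U \<subseteq> E \<and>
     (\<forall>x\<in>U. \<exists>F \<epsilon>. F \<subseteq> P \<and> finite F \<and> 0 < \<epsilon> \<and> {y\<in>E. \<forall>p\<in>F. p (y - x) < \<epsilon>} \<subseteq> U))"

text \<open>A Frechet space is a linear subspace of the type \<open>'v\<close> together with a topology, both given by
  the abstract topology \<open>T\<close>.\<close>

definition frechet_space :: "'v::real_vector topology \<Rightarrow> bool" where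
  "frechet_space T \<longleftrightarrow> subspace (topspace T) \<and>
     (\<exists>p :: nat \<Rightarrow> 'v \<Rightarrow> real.
        (\<forall>n. seminorm_on (topspace T) (p n)) \<and>
        T = seminorm_topology (topspace T) (range p) \<and>
        (\<forall>x\<in>topspace T. (\<forall>n. p n x = 0) \<longrightarrow> x = 0) \<and>
        (\<forall>X. (\<forall>i. X i \<in> topspace T) \<and>
             (\<forall>n. \<forall>\<epsilon>>0. \<exists>K. \<forall>i\<ge>K. \<forall>j\<ge>K. p n (X i - X j) < \<epsilon>) \<longrightarrow>
             (\<exists>x\<in>topspace T. \<forall>n. (\<lambda>i. p n (X i - x)) \<longlonglongrightarrow> 0)))"

text \<open>The usual notion of a smooth map between open subsets of Frechet spaces: \<open>D k x v\<close> is the iterated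
  directional derivative of \<open>f\<close> at \<open>x\<close> in the directions \<open>v 0, \<dots>, v (k - 1)\<close>, and it is required to
  exist and to be jointly continuous on \<open>U \<times> E \<times> \<dots> \<times> E\<close>. Elements of the latter product are families
  indexed by \<open>{..<k}\<close>.\<close>

definition frechet_smooth ::
  "'v::real_vector topology \<Rightarrow> 'v set \<Rightarrow> 'w::real_vector topology \<Rightarrow> ('v \<Rightarrow> 'w) \<Rightarrow> bool" where
  "frechet_smooth T U T' f \<longleftrightarrow> openin T U \<and> (\<exists>D :: nat \<Rightarrow> 'v \<Rightarrow> (nat \<Rightarrow> 'v) \<Rightarrow> 'w.
     (\<forall>x\<in>U. \<forall>v. D 0 x v = f x) \<and>
     (\<forall>k. continuous_map
            (prod_topology (subtopology T U) (product_topology (\<lambda>_. T) {..<k})) T' (\<lambda>(x, v). D k x v)) \<and>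
     (\<forall>k. \<forall>x\<in>U. \<forall>v\<in>topspace (product_topology (\<lambda>_. T) {..<Suc k}).
        limitin T'
          (\<lambda>t::real. (1 / t) *\<^sub>R (D k (x + t *\<^sub>R v k) (restrict v {..<k}) - D k x (restrict v {..<k})))
          (D (Suc k) x v) (at 0)))"

text \<open>A chart \<open>(W, u, T)\<close> maps \<open>W\<close> bijectively to an open subset of the Frechet space \<open>T\<close>. Different
  charts may have different model spaces inside \<open>'v\<close>.\<close>

type_synonym ('x, 'v) fchart = "'x set \<times> ('x \<Rightarrow> 'v) \<times> 'v topology"

type_synonym ('x, 'v) fatlas = "('x, 'v) fchart set"

definition fchart_on :: "'x set \<Rightarrow> ('x, 'v::real_vector) fchart \<Rightarrow> bool" where
  "fchart_on X = (\<lambda>(W, u, T). W \<subseteq> X \<and> inj_on u W \<and> frechet_space T \<and> openin T (u ` W))"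

definition fcompat :: "('x, 'v::real_vector) fchart \<Rightarrow> ('x, 'v) fchart \<Rightarrow> bool" where
  "fcompat = (\<lambda>(W, u, T) (W', u', T').
     frechet_smooth T (u ` (W \<inter> W')) T' (u' \<circ> inv_into W u) \<and>
     frechet_smooth T' (u' ` (W \<inter> W')) T (u \<circ> inv_into W' u'))"

definition ftop :: "'x set \<Rightarrow> ('x, 'v::real_vector) fatlas \<Rightarrow> 'x topology" where
  "ftop X \<A> = topology (\<lambda>V. V \<subseteq> X \<and> (\<forall>(W, u, T)\<in>\<A>. openin T (u ` (V \<inter> W))))"

definition frechet_manifold :: "'x set \<Rightarrow> ('x, 'v::real_vector) fatlas \<Rightarrow> bool" where
  "frechet_manifold X \<A> \<longleftrightarrow>
     (\<forall>c\<in>\<A>. fchart_on X c) \<and> X = (\<Union>(W, u, T)\<in>\<A>. W) \<and> (\<forall>c\<in>\<A>. \<forall>d\<in>\<A>. fcompat c d) \<and>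
     Hausdorff_space (ftop X \<A>)"

definition max_fatlas :: "'x set \<Rightarrow> ('x, 'v::real_vector) fatlas \<Rightarrow> ('x, 'v) fatlas" where
  "max_fatlas X \<A> = {c. fchart_on X c \<and> (\<forall>d\<in>\<A>. fcompat c d)}"

definition fsmooth_map ::
  "'x set \<Rightarrow> ('x, 'v::real_vector) fatlas \<Rightarrow> 'y set \<Rightarrow> ('y, 'w::real_vector) fatlas \<Rightarrow> ('x \<Rightarrow> 'y) \<Rightarrow> bool" where
  "fsmooth_map X \<A> Y \<B> f \<longleftrightarrow>
     continuous_map (ftop X \<A>) (ftop Y \<B>) f \<and>
     (\<forall>(W, u, T)\<in>\<A>. \<forall>(W', u', T')\<in>\<B>.
        frechet_smooth T (u ` (W \<inter> f -` W')) T' (u' \<circ> f \<circ> inv_into W u))"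

definition fdiffeo ::
  "'x set \<Rightarrow> ('x, 'v::real_vector) fatlas \<Rightarrow> 'y set \<Rightarrow> ('y, 'w::real_vector) fatlas \<Rightarrow> ('x \<Rightarrow> 'y) \<Rightarrow> bool" where
  "fdiffeo X \<A> Y \<B> f \<longleftrightarrow>
     fsmooth_map X \<A> Y \<B> f \<and> bij_betw f X Y \<and> fsmooth_map Y \<B> X \<A> (inv_into X f)"

definition prod_fatlas ::
  "('x, 'v::real_vector) fatlas \<Rightarrow> ('y, 'w::real_vector) fatlas \<Rightarrow> ('x \<times> 'y, 'v \<times> 'w) fatlas" where
  "prod_fatlas \<A> \<B> =
     {(W \<times> W', map_prod u u', prod_topology T T') | W u T W' u' T'. (W, u, T) \<in> \<A> \<and> (W', u', T') \<in> \<B>}"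

definition restrict_fatlas :: "('x, 'v::real_vector) fatlas \<Rightarrow> 'x set \<Rightarrow> ('x, 'v) fatlas" where
  "restrict_fatlas \<A> V = {(W \<inter> V, u, T) | W u T. (W, u, T) \<in> \<A>}"


subsection \<open>Codimension one submanifolds\<close>

text \<open>A closed subspace of codimension one is automatically complemented.\<close>

definition codim_one_subspace :: "'v::real_vector topology \<Rightarrow> 'v set \<Rightarrow> bool" where
  "codim_one_subspace T F \<longleftrightarrow> subspace F \<and> closedin T F \<and>
     (\<exists>v\<in>topspace T - F. topspace T = {x + t *\<^sub>R v | x t. x \<in> F})"

definition slice_chart ::
  "'x set \<Rightarrow> ('x, 'v::real_vector) fatlas \<Rightarrow> 'x set \<Rightarrow> ('x, 'v) fchart \<Rightarrow> 'v set \<Rightarrow> bool" where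
  "slice_chart X \<A> Y c F \<longleftrightarrow> c \<in> max_fatlas X \<A> \<and>
     (case c of (W, u, T) \<Rightarrow> codim_one_subspace T F \<and> u ` (W \<inter> Y) = u ` W \<inter> F)"

definition codim_one_submanifold :: "'x set \<Rightarrow> ('x, 'v::real_vector) fatlas \<Rightarrow> 'x set \<Rightarrow> bool" where
  "codim_one_submanifold X \<A> Y \<longleftrightarrow> Y \<subseteq> X \<and>
     (\<forall>y\<in>Y. \<exists>W u T F. y \<in> W \<and> slice_chart X \<A> Y (W, u, T) F)"

definition submanifold_fatlas ::
  "'x set \<Rightarrow> ('x, 'v::real_vector) fatlas \<Rightarrow> 'x set \<Rightarrow> ('x, 'v) fatlas" where
  "submanifold_fatlas X \<A> Y =
     {(W \<inter> Y, u, subtopology T F) | W u T F. slice_chart X \<A> Y (W, u, T) F}"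


subsection \<open>Frechet principal bundles\<close>

definition linear_between :: "'v::real_vector topology \<Rightarrow> 'w::real_vector topology \<Rightarrow> ('v \<Rightarrow> 'w) \<Rightarrow> bool" where
  "linear_between T T' L \<longleftrightarrow> continuous_map T T' L \<and>
     (\<forall>x\<in>topspace T. \<forall>y\<in>topspace T. \<forall>a b. L (a *\<^sub>R x + b *\<^sub>R y) = a *\<^sub>R L x + b *\<^sub>R L y)"

text \<open>In suitable charts, \<open>\<pi>\<close> is a projection onto a factor of a product: a continuous linear map \<open>L\<close>
  with a continuous linear right inverse \<open>s\<close> identifies its domain with \<open>ker L \<times> topspace T'\<close>.\<close>

definition submersion ::
  "'x set \<Rightarrow> ('x, 'v::real_vector) fatlas \<Rightarrow> 'y set \<Rightarrow> ('y, 'w::real_vector) fatlas \<Rightarrow> ('x \<Rightarrow> 'y) \<Rightarrow> bool" where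
  "submersion X \<A> Y \<B> \<pi> \<longleftrightarrow> fsmooth_map X \<A> Y \<B> \<pi> \<and>
     (\<forall>x\<in>X. \<exists>W u T W' u' T' L s.
        (W, u, T) \<in> max_fatlas X \<A> \<and> (W', u', T') \<in> max_fatlas Y \<B> \<and> x \<in> W \<and> \<pi> ` W \<subseteq> W' \<and>
        linear_between T T' L \<and> linear_between T' T s \<and> (\<forall>z\<in>topspace T'. L (s z) = z) \<and>
        (\<forall>q\<in>W. u' (\<pi> q) = L (u q)))"

definition frechet_lie_group :: "'g monoid \<Rightarrow> ('g, 'v::real_vector) fatlas \<Rightarrow> bool" where
  "frechet_lie_group G \<G> \<longleftrightarrow> group G \<and> frechet_manifold (carrier G) \<G> \<and>
     fsmooth_map (carrier G \<times> carrier G) (prod_fatlas \<G> \<G>) (carrier G) \<G> (\<lambda>(a, b). a \<otimes>\<^bsub>G\<^esub> b) \<and>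
     fsmooth_map (carrier G) \<G> (carrier G) \<G> (\<lambda>a. inv\<^bsub>G\<^esub> a)"

definition smooth_right_action ::
  "'g monoid \<Rightarrow> ('g, 'u::real_vector) fatlas \<Rightarrow> 'q set \<Rightarrow> ('q, 'v::real_vector) fatlas
    \<Rightarrow> ('q \<Rightarrow> 'g \<Rightarrow> 'q) \<Rightarrow> bool" where
  "smooth_right_action G \<G> Q \<Q> act \<longleftrightarrow>
     (\<forall>q\<in>Q. act q \<one>\<^bsub>G\<^esub> = q) \<and>
     (\<forall>q\<in>Q. \<forall>a\<in>carrier G. \<forall>b\<in>carrier G. act (act q a) b = act q (a \<otimes>\<^bsub>G\<^esub> b)) \<and>
     fsmooth_map (Q \<times> carrier G) (prod_fatlas \<Q> \<G>) Q \<Q> (\<lambda>(q, a). act q a)"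

definition principal_bundle ::
  "'g monoid \<Rightarrow> ('g, 'u::real_vector) fatlas \<Rightarrow> 'q set \<Rightarrow> ('q, 'v::real_vector) fatlas
    \<Rightarrow> ('q \<Rightarrow> 'g \<Rightarrow> 'q) \<Rightarrow> 'b set \<Rightarrow> ('b, 'w::real_vector) fatlas \<Rightarrow> ('q \<Rightarrow> 'b) \<Rightarrow> bool" where
  "principal_bundle G \<G> Q \<Q> act B \<B> \<pi> \<longleftrightarrow>
     frechet_lie_group G \<G> \<and> frechet_manifold Q \<Q> \<and> frechet_manifold B \<B> \<and>
     smooth_right_action G \<G> Q \<Q> act \<and>
     submersion Q \<Q> B \<B> \<pi> \<and> \<pi> ` Q = B \<and>
     (\<forall>b\<in>B. \<exists>U \<Psi>. b \<in> U \<and> openin (ftop B \<B>) U \<and>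
        fdiffeo (Q \<inter> \<pi> -` U) (restrict_fatlas \<Q> (Q \<inter> \<pi> -` U))
          (carrier G \<times> U) (prod_fatlas \<G> (restrict_fatlas \<B> U)) \<Psi> \<and>
        (\<forall>q\<in>Q \<inter> \<pi> -` U. snd (\<Psi> q) = \<pi> q \<and>
           (\<forall>a\<in>carrier G. \<Psi> (act q a) = (fst (\<Psi> q) \<otimes>\<^bsub>G\<^esub> a, snd (\<Psi> q)))))"


section \<open>Manifolds of maps\<close>

text \<open>Maps on a manifold with underlying set \<open>pts S\<close> are represented by extensional functions.\<close>

definition Cinf :: "('s::topological_space, 'a::real_inner) atlas
    \<Rightarrow> ('m::topological_space, 'b::real_inner) atlas \<Rightarrow> ('s \<Rightarrow> 'm) set" where
  "Cinf S M = {f \<in> extensional (pts S). smooth_map S M f}"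

definition Emb :: "('s::topological_space, 'a::real_inner) atlas
    \<Rightarrow> ('m::topological_space, 'b::real_inner) atlas \<Rightarrow> ('s \<Rightarrow> 'm) set" where
  "Emb S M = {f \<in> Cinf S M. immersion S M f \<and> (\<exists>h. homeomorphism (pts S) (f ` pts S) f h)}"

definition Diff :: "('s::topological_space, 'a::real_inner) atlas \<Rightarrow> ('s \<Rightarrow> 's) set" where
  "Diff S = {f \<in> Cinf S S. diffeo S S f}"

definition Diff_group :: "('s::topological_space, 'a::real_inner) atlas \<Rightarrow> ('s \<Rightarrow> 's) monoid" where
  "Diff_group S = \<lparr>carrier = Diff S, mult = compose (pts S), one = restrict (\<lambda>x. x) (pts S)\<rparr>"

text \<open>The model space at \<open>f\<close>: smooth sections of the pullback along \<open>f\<close> of the tangent bundle of \<open>N\<close>, tangent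
  to the boundary of \<open>N\<close> wherever \<open>f\<close> takes values in it. The latter condition is void if \<open>N\<close> has no
  boundary; for \<open>f \<in> Diff S\<close> it singles out the fields along \<open>f\<close> that are tangent to the boundary.
  Sections are extended by \<open>0\<close> outside of \<open>pts S\<close>.\<close>

definition sections :: "('s, 'a::real_inner) atlas \<Rightarrow> ('m, 'b::real_inner) atlas \<Rightarrow> ('s \<Rightarrow> 'm)
    \<Rightarrow> ('s \<Rightarrow> ('m, 'b) tangent) set" where
  "sections S N f =
     {X. (\<forall>x\<in>pts S. X x \<in> boundary_tangent_space N (f x)) \<and> (\<forall>x. x \<notin> pts S \<longrightarrow> X x = 0) \<and>
         (\<forall>c\<in>S. \<forall>d\<in>N. smooth_on (snd c ` (fst c \<inter> f -` fst d)) (\<lambda>y. X (cinv c y) d))}"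

primrec iter_deriv :: "'a::real_normed_vector set \<Rightarrow> 'a list \<Rightarrow> ('a \<Rightarrow> 'b::real_normed_vector) \<Rightarrow> 'a \<Rightarrow> 'b" where
  "iter_deriv A [] F = F"
| "iter_deriv A (v # vs) F = iter_deriv A vs (\<lambda>y. frechet_derivative F (at y within A) v)"

text \<open>The \<open>C\<^sup>\<infinity>\<close> topology: uniform convergence of all partial derivatives in charts on compact sets.
  The family of seminorms is uncountable, but for second countable \<open>S\<close> it is equivalent to a countable one.\<close>

definition section_seminorms :: "('s::topological_space, 'a::real_inner) atlas \<Rightarrow> ('m, 'b::real_inner) atlas
    \<Rightarrow> ('s \<Rightarrow> 'm) \<Rightarrow> (('s \<Rightarrow> ('m, 'b) tangent) \<Rightarrow> real) set" where
  "section_seminorms S N f =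
     {\<lambda>X. SUP x\<in>K. norm (iter_deriv (snd c ` (fst c \<inter> f -` fst d)) vs (\<lambda>y. X (cinv c y) d) (snd c x)) |
        K c d vs. c \<in> S \<and> d \<in> N \<and> compact K \<and> K \<noteq> {} \<and> K \<subseteq> fst c \<inter> f -` fst d}"

definition section_space :: "('s::topological_space, 'a::real_inner) atlas \<Rightarrow> ('m, 'b::real_inner) atlas
    \<Rightarrow> ('s \<Rightarrow> 'm) \<Rightarrow> ('s \<Rightarrow> ('m, 'b) tangent) topology" where
  "section_space S N f = seminorm_topology (sections S N f) (section_seminorms S N f)"

text \<open>With a local addition \<open>\<alpha>\<close>, for example the exponential map of a Riemannian metric on \<open>N\<close> (one for
  which the boundary is totally geodesic), \<open>\<beta> x y\<close> is the tangent vector at \<open>x\<close> with \<open>\<alpha> (\<beta> x y) = y\<close>.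
  Working with \<open>\<beta>\<close> instead of \<open>\<alpha>\<close> avoids having to extend \<open>N\<close> beyond its boundary.\<close>

definition inverse_local_addition :: "('m::topological_space, 'b::real_inner) atlas \<Rightarrow> ('m \<times> 'm) set
    \<Rightarrow> ('m \<Rightarrow> 'm \<Rightarrow> ('m, 'b) tangent) \<Rightarrow> bool" where
  "inverse_local_addition N V \<beta> \<longleftrightarrow>
     openin (top_of_set (pts N \<times> pts N)) V \<and> (\<forall>x\<in>pts N. (x, x) \<in> V \<and> \<beta> x x = 0) \<and>
     (\<forall>(x, y)\<in>V. \<beta> x y \<in> tangent_space N x \<and>
        (x \<in> boundary_pts N \<and> y \<in> boundary_pts N \<longrightarrow> \<beta> x y \<in> boundary_tangent_space N x)) \<and>
     (\<forall>x. inj_on (\<beta> x) {y. (x, y) \<in> V}) \<and>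
     (\<forall>c\<in>N. \<forall>d\<in>N.
        smooth_on ((\<lambda>(x, y). (snd c x, snd d y)) ` (V \<inter> fst c \<times> fst d))
          (\<lambda>(a, b). \<beta> (cinv c a) (cinv d b) c) \<and>
        (\<forall>(x, y)\<in>V \<inter> fst c \<times> fst d.
           inj (frechet_derivative (\<lambda>b. \<beta> x (cinv d b) c) (at (snd d y) within cimg d))))"

text \<open>The standard charts \<open>h \<mapsto> (x \<mapsto> \<beta> (f x) (h x))\<close> centred at \<open>f \<in> Q\<close>, for a set \<open>Q\<close> of smooth maps. This is
  used with \<open>Q = Cinf S M\<close> for \<open>M\<close> without boundary, and with \<open>Q = Diff S\<close>.\<close>

definition mapping_fatlas :: "('s::topological_space, 'a::real_inner) atlas
    \<Rightarrow> ('m::topological_space, 'b::real_inner) atlas \<Rightarrow> ('s \<Rightarrow> 'm) set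
    \<Rightarrow> ('s \<Rightarrow> 'm, 's \<Rightarrow> ('m, 'b) tangent) fatlas" where
  "mapping_fatlas S N Q =
     {({h\<in>Q. \<forall>x\<in>pts S. (f x, h x) \<in> V},
       \<lambda>h x. if x \<in> pts S then \<beta> (f x) (h x) else 0,
       section_space S N f) | f V \<beta>. f \<in> Q \<and> inverse_local_addition N V \<beta>}"

definition Emb_fatlas :: "('s::topological_space, 'a::real_inner) atlas
    \<Rightarrow> ('m::topological_space, 'b::real_inner) atlas \<Rightarrow> ('s \<Rightarrow> 'm, 's \<Rightarrow> ('m, 'b) tangent) fatlas" where
  "Emb_fatlas S M = restrict_fatlas (mapping_fatlas S M (Cinf S M)) (Emb S M)"

definition Diff_fatlas :: "('s::topological_space, 'a::real_inner) atlas
    \<Rightarrow> ('s \<Rightarrow> 's, 's \<Rightarrow> ('s, 'a) tangent) fatlas" where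
  "Diff_fatlas S = mapping_fatlas S S (Diff S)"

definition Gr :: "('s::topological_space, 'a::real_inner) atlas
    \<Rightarrow> ('m::topological_space, 'b::real_inner) atlas \<Rightarrow> 'm set set" where
  "Gr S M = {N. N \<subseteq> pts M \<and> pts (sub_atlas M N :: ('m, 'a) atlas) = N \<and>
     (\<exists>h. diffeo S (sub_atlas M N :: ('m, 'a) atlas) h)}"

definition Gr0 :: "('s::topological_space, 'a::real_inner) atlas
    \<Rightarrow> ('m::topological_space, 'b::real_inner) atlas
    \<Rightarrow> ('s \<Rightarrow> (nat \<Rightarrow> ('s, 'a) tangent) \<Rightarrow> real)
    \<Rightarrow> ('m \<Rightarrow> ('m, 'b) tangent \<Rightarrow> ('m, 'b) tangent \<Rightarrow> real) \<Rightarrow> 'm set set" where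
  "Gr0 S M \<mu> g = {N \<in> Gr S M.
     riemannian_volume (sub_atlas M N :: ('m, 'a) atlas) (induced_metric M (sub_atlas M N) g)
       = form_integral S \<mu>}"

definition Emb0 :: "('s::topological_space, 'a::real_inner) atlas
    \<Rightarrow> ('m::topological_space, 'b::real_inner) atlas
    \<Rightarrow> ('s \<Rightarrow> (nat \<Rightarrow> ('s, 'a) tangent) \<Rightarrow> real)
    \<Rightarrow> ('m \<Rightarrow> ('m, 'b) tangent \<Rightarrow> ('m, 'b) tangent \<Rightarrow> real) \<Rightarrow> ('s \<Rightarrow> 'm) set" where
  "Emb0 S M \<mu> g = {f \<in> Emb S M.
     riemannian_volume (sub_atlas M (f ` pts S) :: ('m, 'a) atlas)
         (induced_metric M (sub_atlas M (f ` pts S)) g)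
       = form_integral S \<mu>}"

end

theory Submission
  imports Defs
begin

text \<open>Since \<open>\<pi> f = f(S)\<close> maps \<open>Emb(S, M)\<close> onto \<open>Gr\<^sup>S(M)\<close> and is invariant under \<open>Diff(S)\<close>, the set \<open>Emb\<^sub>0\<close>
  is the \<open>\<pi>\<close>-preimage of \<open>Gr\<^sub>0\<close>. So the claim is that a principal bundle \<open>Q \<rightarrow> B\<close> restricts to \<open>Q\<^sub>0 \<rightarrow> B\<^sub>0\<close>
  whenever \<open>B\<^sub>0\<close> and its preimage \<open>Q\<^sub>0\<close> are submanifolds. The inclusions of \<open>Q\<^sub>0\<close> and \<open>B\<^sub>0\<close> are smooth, and a
  smooth map with values in a submanifold is smooth into it; hence the action, the projection and the
  trivializations over open sets \<open>U\<close> restrict to \<open>Q\<^sub>0\<close> and \<open>U \<inter> B\<^sub>0\<close>.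

  That \<open>Q\<^sub>0 \<rightarrow> B\<^sub>0\<close> is a submersion follows from local triviality alone: if \<open>u\<close> is a chart of \<open>Q\<^sub>0\<close>, \<open>c\<close> a
  product chart of \<open>G \<times> B\<^sub>0\<close>, \<open>\<Psi>\<close> a trivialization and \<open>A\<close> the derivative of \<open>u \<circ> \<Psi>\<^sup>-\<^sup>1 \<circ> c\<^sup>-\<^sup>1\<close> at a point,
  then \<open>A\<close> is a linear isomorphism, and the chart \<open>A \<circ> c \<circ> \<Psi>\<close>, which takes its values in the model space
  of \<open>u\<close>, turns the projection into a linear one.

  Everything rests on the chain rule for smoothness defined by iterated directional derivatives. The mean
  value inequality, applied to each seminorm, yields it to first order and the multilinearity of the higher
  derivatives; the higher orders then follow by expanding into the terms of Faa di Bruno's formula.\<close>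

section \<open>Frechet spaces\<close>

text \<open>Restricting the submersion charts of \<open>Q\<close> would not do: a chart that
  linearizes the projection need not be adapted to \<open>Q0\<close>, and Frechet spaces admit no
  general inverse function theorem that would straighten both at once. A trivialization avoids this,
  since its restriction is again a trivialization and already exhibits the projection as that of a
  product. What remains is a change of model space: a chart must take its values in the fixed type
  of the atlas, while a product chart lives in the product of the model spaces of group and base.
  Hence the isomorphism \<open>A\<close>, which exists because the transition and its inverse are
  both known to be smooth. The difficulty with the chain rule is that \<open>frechet_smooth\<close>
  speaks only of derivatives along straight lines and does not ask for them to be linear in the
  direction, whereas a smooth map bends a line into a curve. Joint continuity of the derivatives
  makes the difference quotients uniform enough to pass from lines to curves, and linearity is
  recovered from it.\<close>

lemma istopology_seminorm:
  fixes P :: "('v::real_vector \<Rightarrow> real) set"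
  shows
  "istopology (\<lambda>U. U \<subseteq> E \<and>
     (\<forall>x\<in>U. \<exists>F \<epsilon>. F \<subseteq> P \<and> finite F \<and> 0 < \<epsilon> \<and> {y\<in>E. \<forall>p\<in>F. p (y - x) < \<epsilon>} \<subseteq> U))"
  (is "istopology ?L")
  unfolding istopology_def
proof (rule conjI; (intro allI impI))
  fix A B assume A: "?L A" and B: "?L B"
  have "\<exists>F \<epsilon>. F \<subseteq> P \<and> finite F \<and> 0 < \<epsilon> \<and> {y\<in>E. \<forall>p\<in>F. p (y - x) < \<epsilon>} \<subseteq> A \<inter> B"
    if x: "x \<in> A \<inter> B" for x
  proof -
    obtain F \<epsilon> where F: "F \<subseteq> P" "finite F" "0 < \<epsilon>" "{y\<in>E. \<forall>p\<in>F. p (y - x) < \<epsilon>} \<subseteq> A"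
      using bspec[OF conjunct2[OF A] IntD1[OF x]] by (elim exE conjE) (rule that)
    obtain G \<delta> where G: "G \<subseteq> P" "finite G" "0 < \<delta>" "{y\<in>E. \<forall>p\<in>G. p (y - x) < \<delta>} \<subseteq> B"
      using bspec[OF conjunct2[OF B] IntD2[OF x]] by (elim exE conjE) (rule that)
    show ?thesis
      using F G by (intro exI[of _ "F \<union> G"] exI[of _ "min \<epsilon> \<delta>"]) auto
  qed
  then show "?L (A \<inter> B)" using A by blast
next
  fix \<K> assume K: "\<forall>K\<in>\<K>. ?L K"
  show "?L (\<Union> \<K>)"
  proof (intro conjI ballI)
    show "\<Union> \<K> \<subseteq> E" using K by blast
    fix x assume "x \<in> \<Union> \<K>"
    then obtain K where "x \<in> K" "K \<in> \<K>" by blast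
    obtain F \<epsilon> where "F \<subseteq> P" "finite F" "0 < \<epsilon>" "{y\<in>E. \<forall>p\<in>F. p (y - x) < \<epsilon>} \<subseteq> K"
      using bspec[OF conjunct2[OF bspec[OF K \<open>K \<in> \<K>\<close>]] \<open>x \<in> K\<close>] by (elim exE conjE) (rule that)
    then show "\<exists>F \<epsilon>. F \<subseteq> P \<and> finite F \<and> 0 < \<epsilon> \<and> {y\<in>E. \<forall>p\<in>F. p (y - x) < \<epsilon>} \<subseteq> \<Union> \<K>"
      using \<open>K \<in> \<K>\<close> by (meson Sup_upper order_trans)
  qed
qed

lemma openin_seminorm_topology:
  "openin (seminorm_topology E P) U \<longleftrightarrow> U \<subseteq> E \<and>
     (\<forall>x\<in>U. \<exists>F \<epsilon>. F \<subseteq> P \<and> finite F \<and> 0 < \<epsilon> \<and> {y\<in>E. \<forall>p\<in>F. p (y - x) < \<epsilon>} \<subseteq> U)"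
  unfolding seminorm_topology_def using istopology_seminorm[of E P]
  by (simp add: topology_inverse')

lemma seminorm_topology_ballE:
  assumes "openin (seminorm_topology E P) U" "x \<in> U"
  obtains F \<epsilon> where "F \<subseteq> P" "finite F" "0 < \<epsilon>" "{y\<in>E. \<forall>p\<in>F. p (y - x) < \<epsilon>} \<subseteq> U"
  using bspec[OF conjunct2[OF assms(1)[unfolded openin_seminorm_topology]] assms(2)]
  by (elim exE conjE) (rule that)

lemma topspace_seminorm_topology [simp]: "topspace (seminorm_topology E P) = E"
proof -
  have "openin (seminorm_topology E P) E"
    unfolding openin_seminorm_topology by (auto intro!: exI[of _ "{}"] exI[of _ "1::real"])
  then show ?thesis
    by (meson openin_seminorm_topology openin_subset openin_topspace subset_antisym)
qed

text \<open>Nonnegativity is not among the axioms of \<open>seminorm_on\<close>; it comes from 0 = p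
  (x - x) \<le> p x + p (- x) = 2 p x.\<close>

lemma seminorm_onD:
  assumes "seminorm_on E p" "subspace E"
  shows "p 0 = 0" "\<And>x. x \<in> E \<Longrightarrow> p (- x) = p x" "\<And>x. x \<in> E \<Longrightarrow> 0 \<le> p x"
    "\<And>x y. x \<in> E \<Longrightarrow> y \<in> E \<Longrightarrow> p (x + y) \<le> p x + p y"
    "\<And>x y. x \<in> E \<Longrightarrow> y \<in> E \<Longrightarrow> p (x - y) = p (y - x)"
    "\<And>x y. x \<in> E \<Longrightarrow> y \<in> E \<Longrightarrow> \<bar>p x - p y\<bar> \<le> p (x - y)"
    "\<And>x a. x \<in> E \<Longrightarrow> p (a *\<^sub>R x) = \<bar>a\<bar> * p x"
proof -
  have hom: "p (a *\<^sub>R x) = \<bar>a\<bar> * p x" if "x \<in> E" for a x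
    using assms that unfolding seminorm_on_def by blast
  have tri: "p (x + y) \<le> p x + p y" if "x \<in> E" "y \<in> E" for x y
    using assms that unfolding seminorm_on_def by blast
  have 0: "0 \<in> E" using assms(2) by (rule subspace_0)
  show p0: "p 0 = 0" using hom[OF 0, of 0] by simp
  show neg: "p (- x) = p x" if "x \<in> E" for x using hom[OF that, of "-1"] by simp
  have mem: "x \<in> E \<Longrightarrow> - x \<in> E" for x using assms(2) by (rule subspace_neg)
  have memd: "x \<in> E \<Longrightarrow> y \<in> E \<Longrightarrow> x - y \<in> E" for x y using assms(2) by (rule subspace_diff)
  show nn: "0 \<le> p x" if "x \<in> E" for x
    using tri[OF that mem[OF that]] neg[OF that] p0 by simp
  show sym: "p (x - y) = p (y - x)" if "x \<in> E" "y \<in> E" for x y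
    using neg[OF memd[OF that]] by simp
  show "\<bar>p x - p y\<bar> \<le> p (x - y)" if "x \<in> E" "y \<in> E" for x y
    using tri[OF memd[OF that(1,2)] that(2)] tri[OF memd[OF that(2,1)] that(1)] sym[OF that]
    by simp
  show "p (x + y) \<le> p x + p y" if "x \<in> E" "y \<in> E" for x y using tri that by blast
  show "p (a *\<^sub>R x) = \<bar>a\<bar> * p x" if "x \<in> E" for x a using hom that by blast
qed

lemma openin_seminorm_ball:
  assumes "seminorm_on E p" "subspace E" "p \<in> P" "x \<in> E"
  shows "openin (seminorm_topology E P) {y\<in>E. p (y - x) < \<epsilon>}"
  unfolding openin_seminorm_topology
proof (intro conjI ballI)
  fix z assume z: "z \<in> {y\<in>E. p (y - x) < \<epsilon>}"
  have "p (y - x) < \<epsilon>" if "y \<in> E" "p (y - z) < \<epsilon> - p (z - x)" for y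
  proof -
    have "p ((y - z) + (z - x)) \<le> p (y - z) + p (z - x)"
      using assms z that by (intro seminorm_onD(4)) (auto intro: subspace_diff)
    then show ?thesis using that by simp
  qed
  then show "\<exists>F \<delta>. F \<subseteq> P \<and> finite F \<and> 0 < \<delta> \<and> {y \<in> E. \<forall>p\<in>F. p (y - z) < \<delta>} \<subseteq> {y \<in> E. p (y - x) < \<epsilon>}"
    using z assms(3) by (intro exI[of _ "{p}"] exI[of _ "\<epsilon> - p (z - x)"]) auto
qed auto

text \<open>Every basic neighbourhood involves finitely many seminorms, and finitely many eventual
  conditions hold eventually together. So convergence along any filter can be tested one seminorm at
  a time.\<close>

lemma limitin_seminorm_topology:
  assumes "\<And>p. p \<in> P \<Longrightarrow> seminorm_on E p" "subspace E"
  shows "limitin (seminorm_topology E P) h l \<F> \<longleftrightarrow> l \<in> E \<and>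
    (\<forall>\<^sub>F i in \<F>. h i \<in> E) \<and> (\<forall>p\<in>P. \<forall>\<epsilon>>0. \<forall>\<^sub>F i in \<F>. p (h i - l) < \<epsilon>)"
    (is "?L \<longleftrightarrow> ?R")
proof
  assume L: ?L
  then have l: "l \<in> E" by (simp add: limitin_def)
  have "\<forall>\<^sub>F i in \<F>. h i \<in> E"
    using limitinD[OF L, of E] l openin_topspace[of "seminorm_topology E P"] by simp
  moreover have "\<forall>\<^sub>F i in \<F>. p (h i - l) < \<epsilon>" if "p \<in> P" "0 < \<epsilon>" for p \<epsilon>
    using limitinD[OF L openin_seminorm_ball[OF assms(1) assms(2) that(1) l, of \<epsilon>]] that l
      seminorm_onD(1)[OF assms(1)[OF that(1)] assms(2)] by (auto elim: eventually_mono)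
  ultimately show ?R using l by blast
next
  assume R: ?R
  show ?L unfolding limitin_def
  proof (intro conjI allI impI)
    fix U assume U: "openin (seminorm_topology E P) U \<and> l \<in> U"
    obtain F \<epsilon> where F: "F \<subseteq> P" "finite F" "0 < \<epsilon>" "{y\<in>E. \<forall>p\<in>F. p (y - l) < \<epsilon>} \<subseteq> U"
      using seminorm_topology_ballE[OF conjunct1[OF U] conjunct2[OF U]] .
    have "\<forall>\<^sub>F i in \<F>. \<forall>p\<in>F. p (h i - l) < \<epsilon>"
      using F R by (intro eventually_ball_finite) auto
    with R have "\<forall>\<^sub>F i in \<F>. h i \<in> E \<and> (\<forall>p\<in>F. p (h i - l) < \<epsilon>)" by (simp add: eventually_conj)
    then show "\<forall>\<^sub>F i in \<F>. h i \<in> U" using F(4) by (auto elim: eventually_mono)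
  qed (use R in auto)
qed

section \<open>Generating families of seminorms\<close>

text \<open>The Hausdorff locally convex part of \<open>frechet_space\<close>, for a family of any
  size; this is the form in which limits and neighbourhoods are tested. Completeness is split off
  into \<open>seminorm_complete\<close>.\<close>

definition generating_seminorms :: "'v::real_vector topology \<Rightarrow> ('v \<Rightarrow> real) set \<Rightarrow> bool" where
  "generating_seminorms T P \<longleftrightarrow> subspace (topspace T) \<and> (\<forall>p\<in>P. seminorm_on (topspace T) p) \<and>
     T = seminorm_topology (topspace T) P \<and> (\<forall>x\<in>topspace T. (\<forall>p\<in>P. p x = 0) \<longrightarrow> x = 0)"

lemma generating_seminormsD:
  assumes "generating_seminorms T P"
  shows "subspace (topspace T)" "\<And>p. p \<in> P \<Longrightarrow> seminorm_on (topspace T) p"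
    "T = seminorm_topology (topspace T) P"
    "\<And>x. x \<in> topspace T \<Longrightarrow> (\<And>p. p \<in> P \<Longrightarrow> p x = 0) \<Longrightarrow> x = 0"
  using assms unfolding generating_seminorms_def by - (elim conjE, assumption | elim conjE, simp)+

lemma limitin_generating:
  assumes "generating_seminorms T P"
  shows "limitin T h l \<F> \<longleftrightarrow> l \<in> topspace T \<and>
    (\<forall>\<^sub>F i in \<F>. h i \<in> topspace T) \<and> (\<forall>p\<in>P. \<forall>\<epsilon>>0. \<forall>\<^sub>F i in \<F>. p (h i - l) < \<epsilon>)"
  by (subst generating_seminormsD(3)[OF assms], rule limitin_seminorm_topology)
    (use generating_seminormsD(1,2)[OF assms] in auto)

lemma openin_generating_ball:
  assumes "generating_seminorms T P" "p \<in> P" "x \<in> topspace T"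
  shows "openin T {y \<in> topspace T. p (y - x) < \<epsilon>}"
  by (subst generating_seminormsD(3)[OF assms(1)], rule openin_seminorm_ball)
    (use assms generating_seminormsD(1,2)[OF assms(1)] in auto)

lemma generating_seminorms_ballE:
  assumes "generating_seminorms T P" "openin T U" "x \<in> U"
  obtains F \<epsilon> where "F \<subseteq> P" "finite F" "0 < \<epsilon>" "{y\<in>topspace T. \<forall>p\<in>F. p (y - x) < \<epsilon>} \<subseteq> U"
proof -
  have "openin (seminorm_topology (topspace T) P) U"
    using assms(2) by (subst generating_seminormsD(3)[OF assms(1), symmetric])
  then show thesis using assms(3) by (rule seminorm_topology_ballE) (rule that)
qed

definition seminorm_complete :: "'v::real_vector set \<Rightarrow> (nat \<Rightarrow> 'v \<Rightarrow> real) \<Rightarrow> bool" where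
  "seminorm_complete E p \<longleftrightarrow> (\<forall>X. (\<forall>i::nat. X i \<in> E) \<and>
     (\<forall>n. \<forall>\<epsilon>>0. \<exists>K. \<forall>i\<ge>K. \<forall>j\<ge>K. p n (X i - X j) < \<epsilon>) \<longrightarrow>
     (\<exists>x\<in>E. \<forall>n. (\<lambda>i. p n (X i - x)) \<longlonglongrightarrow> 0))"

lemma seminorm_completeD:
  assumes "seminorm_complete E p" "\<And>i. X i \<in> E"
    "\<And>n \<epsilon>. 0 < \<epsilon> \<Longrightarrow> \<exists>K. \<forall>i\<ge>K. \<forall>j\<ge>K. p n (X i - X j) < \<epsilon>"
  obtains x where "x \<in> E" "\<And>n. (\<lambda>i. p n (X i - x)) \<longlonglongrightarrow> 0"
proof -
  have "\<exists>x\<in>E. \<forall>n. (\<lambda>i. p n (X i - x)) \<longlonglongrightarrow> 0"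
    using assms(1)[unfolded seminorm_complete_def, THEN spec, THEN mp, OF conjI] assms(2,3) by simp
  then show thesis using that by blast
qed

lemma frechet_space_iff:
  "frechet_space T \<longleftrightarrow>
     (\<exists>p. generating_seminorms T (range p) \<and> seminorm_complete (topspace T) p)"
  unfolding frechet_space_def generating_seminorms_def seminorm_complete_def
  by (simp only: ball_UNIV ball_simps(9) ex_simps conj_assoc)

lemma frechet_space_generating:
  assumes "frechet_space T"
  obtains P where "generating_seminorms T P"
  using assms unfolding frechet_space_iff by (elim exE conjE) (rule that)

lemma frechet_space_subspace: "frechet_space T \<Longrightarrow> subspace (topspace T)"
  by (simp add: frechet_space_def)

lemma frechet_space_mem:
  assumes "frechet_space T"
  shows "0 \<in> topspace T" "\<And>x y. x \<in> topspace T \<Longrightarrow> y \<in> topspace T \<Longrightarrow> x + y \<in> topspace T"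
    "\<And>x y. x \<in> topspace T \<Longrightarrow> y \<in> topspace T \<Longrightarrow> x - y \<in> topspace T"
    "\<And>a x. x \<in> topspace T \<Longrightarrow> a *\<^sub>R x \<in> topspace T"
  using frechet_space_subspace[OF assms]
  by (auto intro: subspace_0 subspace_add subspace_diff subspace_scale)

section \<open>Vector operations on limits, separation, and single-seminorm balls\<close>

lemma limitin_add:
  assumes T: "frechet_space T" and f: "limitin T f l \<F>" and g: "limitin T g m \<F>"
  shows "limitin T (\<lambda>i. f i + g i) (l + m) \<F>"
proof -
  obtain P where "generating_seminorms T P" using frechet_space_generating[OF T] by blast
  note P = generating_seminormsD[OF this] and lim = limitin_generating[OF this]
    and ball = openin_generating_ball[OF this] and ballE = generating_seminorms_ballE[OF this]
  have "\<forall>\<^sub>F i in \<F>. p (f i + g i - (l + m)) < \<epsilon>" if p: "p \<in> P" "0 < \<epsilon>" for p \<epsilon>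
  proof -
    have "\<forall>\<^sub>F i in \<F>. p (f i - l) < \<epsilon>/2" "\<forall>\<^sub>F i in \<F>. p (g i - m) < \<epsilon>/2"
      "\<forall>\<^sub>F i in \<F>. f i \<in> topspace T" "\<forall>\<^sub>F i in \<F>. g i \<in> topspace T"
      using f g p half_gt_zero[OF p(2)] unfolding lim by blast+
    then show ?thesis
    proof eventually_elim
      case (elim i)
      have "p ((f i - l) + (g i - m)) \<le> p (f i - l) + p (g i - m)"
        using f g elim by (intro seminorm_onD(4)[OF P(2)[OF p(1)] P(1)] subspace_diff[OF P(1)])
          (auto simp: lim)
      then show ?case using elim by (simp add: algebra_simps)
    qed
  qed
  moreover have "\<forall>\<^sub>F i in \<F>. f i + g i \<in> topspace T"
  proof -
    have "\<forall>\<^sub>F i in \<F>. f i \<in> topspace T" "\<forall>\<^sub>F i in \<F>. g i \<in> topspace T"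
      using f g unfolding lim by blast+
    then show ?thesis by eventually_elim (rule subspace_add[OF P(1)])
  qed
  ultimately show ?thesis
    using f g unfolding lim by (auto intro: subspace_add[OF P(1)])
qed

text \<open>Here scalar and vector move together: \<open>a i *\<^sub>R f i - c *\<^sub>R l\<close>
  splits into \<open>a i *\<^sub>R (f i - l)\<close> and \<open>(a i - c) *\<^sub>R l\<close>, and
  both have small seminorm because the convergent scalars stay bounded.\<close>

lemma limitin_scaleR:
  assumes T: "frechet_space T" and a: "(a \<longlongrightarrow> c) \<F>" and f: "limitin T f l \<F>"
  shows "limitin T (\<lambda>i. a i *\<^sub>R f i) (c *\<^sub>R l) \<F>"
proof -
  obtain P where "generating_seminorms T P" using frechet_space_generating[OF T] by blast
  note P = generating_seminormsD[OF this] and lim = limitin_generating[OF this]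
    and ball = openin_generating_ball[OF this] and ballE = generating_seminorms_ballE[OF this]
  have l: "l \<in> topspace T" and ev: "\<forall>\<^sub>F i in \<F>. f i \<in> topspace T" using f unfolding lim by auto
  have "\<forall>\<^sub>F i in \<F>. p (a i *\<^sub>R f i - c *\<^sub>R l) < \<epsilon>" if p: "p \<in> P" "0 < \<epsilon>" for p \<epsilon>
  proof -
    note sn = seminorm_onD[OF P(2)[OF p(1)] P(1)]
    have "((\<lambda>i. p (f i - l)) \<longlongrightarrow> 0) \<F>"
    proof (rule tendstoI)
      fix e :: real assume "0 < e"
      then have "\<forall>\<^sub>F i in \<F>. p (f i - l) < e" using f p unfolding lim by auto
      with ev show "\<forall>\<^sub>F i in \<F>. dist (p (f i - l)) 0 < e"
        by eventually_elim (use l P(1) in \<open>auto simp: sn(3) subspace_diff\<close>)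
    qed
    then have "((\<lambda>i. \<bar>a i\<bar> * p (f i - l) + \<bar>a i - c\<bar> * p l) \<longlongrightarrow> \<bar>c\<bar> * 0 + \<bar>c - c\<bar> * p l) \<F>"
      using a by (intro tendsto_intros)
    then have "\<forall>\<^sub>F i in \<F>. \<bar>a i\<bar> * p (f i - l) + \<bar>a i - c\<bar> * p l < \<epsilon>"
      using p(2) by (auto dest: order_tendstoD(2))
    with ev show ?thesis
    proof eventually_elim
      case (elim i)
      have "p (a i *\<^sub>R (f i - l) + (a i - c) *\<^sub>R l) \<le> p (a i *\<^sub>R (f i - l)) + p ((a i - c) *\<^sub>R l)"
        using elim l by (intro sn(4) subspace_scale subspace_diff P(1))
      also have "\<dots> = \<bar>a i\<bar> * p (f i - l) + \<bar>a i - c\<bar> * p l"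
        using elim l P(1) by (simp add: sn(7) subspace_diff)
      finally show ?case using elim by (simp add: algebra_simps)
    qed
  qed
  moreover have "\<forall>\<^sub>F i in \<F>. a i *\<^sub>R f i \<in> topspace T"
    using ev by eventually_elim (auto intro: subspace_scale[OF P(1)])
  ultimately show ?thesis
    using l unfolding lim by (auto intro: subspace_scale[OF P(1)])
qed

lemma limitin_diff:
  assumes T: "frechet_space T" and f: "limitin T f l \<F>" and g: "limitin T g m \<F>"
  shows "limitin T (\<lambda>i. f i - g i) (l - m) \<F>"
  using limitin_add[OF T f limitin_scaleR[OF T tendsto_const[of "-1"] g]] by simp

lemma limitin_sum:
  assumes T: "frechet_space T" and "\<And>j. j \<in> J \<Longrightarrow> limitin T (f j) (l j) \<F>"
  shows "limitin T (\<lambda>i. \<Sum>j\<in>J. f j i) (\<Sum>j\<in>J. l j) \<F>"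
  using assms(2)
  by (induction J rule: infinite_finite_induct)
    (auto intro: limitin_add[OF T] simp: frechet_space_mem(1)[OF T])

lemma continuous_map_frechet_add:
  assumes "frechet_space T" "continuous_map X T f" "continuous_map X T g"
  shows "continuous_map X T (\<lambda>x. f x + g x)"
  using assms by (auto simp: continuous_map_atin intro: limitin_add)

lemma continuous_map_frechet_scaleR:
  assumes "frechet_space T" "continuous_map X euclideanreal a" "continuous_map X T f"
  shows "continuous_map X T (\<lambda>x. a x *\<^sub>R f x)"
  using assms by (auto simp: continuous_map_atin intro!: limitin_scaleR)

text \<open>Distinct points differ by a vector on which some seminorm is nonzero, and balls of half
  that radius separate them. This is the uniqueness of limits by which derivatives are identified
  later.\<close>

lemma frechet_space_Hausdorff:
  assumes "frechet_space T"
  shows "Hausdorff_space T"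
proof -
  obtain P where "generating_seminorms T P" using frechet_space_generating[OF assms] by blast
  note P = generating_seminormsD[OF this] and lim = limitin_generating[OF this]
    and ball = openin_generating_ball[OF this] and ballE = generating_seminorms_ballE[OF this]
  show ?thesis unfolding Hausdorff_space_def
  proof (intro allI impI)
    fix x y assume xy: "x \<in> topspace T \<and> y \<in> topspace T \<and> x \<noteq> y"
    then have d: "y - x \<in> topspace T" "y - x \<noteq> 0" using P(1) by (auto intro: subspace_diff)
    then obtain p where p: "p \<in> P" "p (y - x) \<noteq> 0" using P(4) by blast
    note sn = seminorm_onD[OF P(2)[OF p(1)] P(1)]
    define r where "r = p (y - x) / 2"
    have r: "0 < r" using sn(3)[OF d(1)] p(2) by (simp add: r_def)
    have op: "openin T {z \<in> topspace T. p (z - w) < r}" if "w \<in> topspace T" for w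
      using ball[OF p(1) that] .
    have "disjnt {z \<in> topspace T. p (z - x) < r} {z \<in> topspace T. p (z - y) < r}"
    proof (rule disjnt_iff[THEN iffD2], safe)
      fix z assume z: "z \<in> topspace T" "p (z - x) < r" "p (z - y) < r"
      have "p ((z - x) + (y - z)) \<le> p (z - x) + p (y - z)"
        using z xy by (intro sn(4) subspace_diff P(1)) auto
      then show False using z xy sn(5)[of y z] by (simp add: r_def)
    qed
    then show "\<exists>U V. openin T U \<and> openin T V \<and> x \<in> U \<and> y \<in> V \<and> disjnt U V"
      using op xy r sn(1) by (intro exI[of _ "{z \<in> topspace T. p (z - x) < r}"]
          exI[of _ "{z \<in> topspace T. p (z - y) < r}"]) auto
  qed
qed

text \<open>The mean value inequality handles one seminorm at a time, so a neighbourhood given by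
  finitely many members of the generating family is shrunk to a ball of their sum, rescaled by the
  radius. This sum need not belong to the family, so the openness of its balls is proved
  anew.\<close>

lemma frechet_space_seminorm_ball:
  assumes T: "frechet_space T" and U: "openin T U" "x \<in> U"
  obtains p where "seminorm_on (topspace T) p"
    "\<forall>c\<in>topspace T. \<forall>e. openin T {y \<in> topspace T. p (y - c) < e}"
    "{y \<in> topspace T. p (y - x) < 1} \<subseteq> U"
proof -
  obtain P where "generating_seminorms T P" using frechet_space_generating[OF T] by blast
  note P = generating_seminormsD[OF this] and lim = limitin_generating[OF this]
    and ball = openin_generating_ball[OF this] and ballE = generating_seminorms_ballE[OF this]
  obtain F \<epsilon> where F: "F \<subseteq> P" "finite F" "0 < \<epsilon>" "{y\<in>topspace T. \<forall>p\<in>F. p (y - x) < \<epsilon>} \<subseteq> U"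
    using ballE[OF U] .
  have sn: "seminorm_on (topspace T) q" if "q \<in> F" for q using that F(1) P(2) by blast
  note nn = seminorm_onD(3)[OF sn P(1)]
  define p where "p y = (\<Sum>q\<in>F. q y) / \<epsilon>" for y
  have p: "seminorm_on (topspace T) p"
    unfolding seminorm_on_def
  proof (intro conjI ballI allI)
    fix x y assume "x \<in> topspace T" "y \<in> topspace T"
    then have "(\<Sum>q\<in>F. q (x + y)) \<le> (\<Sum>q\<in>F. q x + q y)"
      using sn by (intro sum_mono) (auto simp: seminorm_on_def)
    then show "p (x + y) \<le> p x + p y"
      using F(3) by (simp add: p_def sum.distrib divide_right_mono flip: add_divide_distrib)
  next
    fix x a assume "x \<in> topspace T"
    then show "p (a *\<^sub>R x) = \<bar>a\<bar> * p x"
      using sn by (simp add: p_def seminorm_on_def sum_distrib_left)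
  qed
  moreover have "openin T {y \<in> topspace T. p (y - c) < e}" if c: "c \<in> topspace T" for c e
  proof (subst openin_subopen, safe)
    fix y assume y: "y \<in> topspace T" "p (y - c) < e"
    \<comment> \<open>\<open>1 + card F\<close> instead of \<open>card F\<close> keeps the
      denominator positive for empty \<open>F\<close> and makes the estimate below strict.\<close>
    define \<delta> where "\<delta> = (e - p (y - c)) * \<epsilon> / (1 + card F)"
    have \<delta>: "0 < \<delta>" using y F(3) by (simp add: \<delta>_def)
    \<comment> \<open>For empty \<open>F\<close> the intersection \<open>?B\<close> is the whole
      type, so it is always cut with \<open>topspace T\<close>.\<close>
    let ?B = "\<Inter>q\<in>F. {z \<in> topspace T. q (z - y) < \<delta>}"
    have "openin T (topspace T \<inter> ?B)"
    proof (cases "F = {}")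
      case False
      have "openin T ?B"
      proof (rule openin_Inter)
        fix S assume "S \<in> (\<lambda>q. {z \<in> topspace T. q (z - y) < \<delta>}) ` F"
        then show "openin T S"
          using ball[OF _ y(1), of _ \<delta>] F(1) by blast
      qed (use False F(2) in auto)
      then show ?thesis by auto
    qed auto
    moreover have "topspace T \<inter> ?B \<subseteq> {y \<in> topspace T. p (y - c) < e}"
    proof
      fix z assume z: "z \<in> topspace T \<inter> ?B"
      have "(\<Sum>q\<in>F. q (z - y)) \<le> card F * \<delta>"
        using z by (intro sum_bounded_above) (auto simp: less_imp_le)
      also have "\<dots> < (1 + card F) * \<delta>" using \<delta> by simp
      also have "\<dots> = (e - p (y - c)) * \<epsilon>" by (simp add: \<delta>_def)
      finally have "p (z - y) < e - p (y - c)"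
        unfolding p_def[of "z - y"] using F(3) by (simp add: pos_divide_less_eq)
      moreover have "p ((z - y) + (y - c)) \<le> p (z - y) + p (y - c)"
        using z y c by (intro seminorm_onD(4)[OF p P(1)] subspace_diff P(1)) auto
      ultimately show "z \<in> {y \<in> topspace T. p (y - c) < e}" using z by simp
    qed
    moreover have "y \<in> topspace T \<inter> ?B"
      using y \<delta> by (auto simp: seminorm_onD(1)[OF sn P(1)])
    ultimately show "\<exists>V. openin T V \<and> y \<in> V \<and> V \<subseteq> {y \<in> topspace T. p (y - c) < e}" by blast
  qed
  moreover have "{y \<in> topspace T. p (y - x) < 1} \<subseteq> U"
  proof
    fix y assume y: "y \<in> {y \<in> topspace T. p (y - x) < 1}"
    have x: "x \<in> topspace T" using U openin_subset by blast
    have "q (y - x) < \<epsilon>" if "q \<in> F" for q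
    proof -
      have "q (y - x) \<le> (\<Sum>q\<in>F. q (y - x))"
        using that F(2) y x nn P(1) by (intro member_le_sum) (auto intro: subspace_diff)
      also have "\<dots> < \<epsilon>" using y F(3) by (simp add: p_def)
      finally show ?thesis .
    qed
    then show "y \<in> U" using F(4) y by blast
  qed
  ultimately show thesis by (intro that) auto
qed

section \<open>Products and closed subspaces of Frechet spaces\<close>

text \<open>Adding the seminorms index by index keeps the family countable. As \<open>r n\<close>
  dominates \<open>p n\<close> and \<open>q n\<close>, the \<open>r\<close>-balls over
  \<open>I \<union> J\<close> lie in products of \<open>p\<close>-balls over \<open>I\<close> and
  \<open>q\<close>-balls over \<open>J\<close>; conversely, two balls of half the radius give a
  product inside an \<open>r\<close>-ball.\<close>

lemma frechet_space_prod:
  assumes "frechet_space T" "frechet_space T'"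
  shows "frechet_space (prod_topology T T')"
proof -
  let ?E = "topspace T" and ?E' = "topspace T'"
  obtain p where "generating_seminorms T (range p)" and pc: "seminorm_complete (topspace T) p"
    using assms(1) unfolding frechet_space_iff by blast
  note p = generating_seminormsD[OF this(1)]
    and pball = openin_generating_ball[OF this(1) rangeI] and pballE = generating_seminorms_ballE[OF this(1)]
  obtain q where "generating_seminorms T' (range q)" and qc: "seminorm_complete (topspace T') q"
    using assms(2) unfolding frechet_space_iff by blast
  note q = generating_seminormsD[OF this(1)]
    and qball = openin_generating_ball[OF this(1) rangeI] and qballE = generating_seminorms_ballE[OF this(1)]
  note pn = seminorm_onD[OF p(2)[OF rangeI] p(1)] and qn = seminorm_onD[OF q(2)[OF rangeI] q(1)]
  define r where "r n z = p n (fst z) + q n (snd z)" for n z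
  have sub: "subspace (?E \<times> ?E')" using p(1) q(1) by (rule subspace_Times)
  have sr: "seminorm_on (?E \<times> ?E') (r n)" for n
    unfolding seminorm_on_def
  proof (intro conjI ballI allI)
    fix x y assume "x \<in> ?E \<times> ?E'" "y \<in> ?E \<times> ?E'"
    then show "r n (x + y) \<le> r n x + r n y"
      using pn(4)[of "fst x" "fst y" n] qn(4)[of "snd x" "snd y" n] by (auto simp: r_def)
  next
    fix x a assume "x \<in> ?E \<times> ?E'"
    then show "r n (a *\<^sub>R x) = \<bar>a\<bar> * r n x"
      using pn(7)[of "fst x" n a] qn(7)[of "snd x" n a] by (auto simp: r_def distrib_left)
  qed
  have rp: "p n (fst z) \<le> r n z" "q n (snd z) \<le> r n z" if "z \<in> ?E \<times> ?E'" for n z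
    using pn(3)[of "fst z" n] qn(3)[of "snd z" n] that by (auto simp: r_def)
  have top: "prod_topology T T' = seminorm_topology (?E \<times> ?E') (range r)"
    unfolding topology_eq
  proof (intro allI iffI)
    fix S assume S: "openin (prod_topology T T') S"
    show "openin (seminorm_topology (?E \<times> ?E') (range r)) S"
      unfolding openin_seminorm_topology
    proof (intro conjI ballI)
      show SE: "S \<subseteq> ?E \<times> ?E'" using S openin_subset by fastforce
      fix z assume z: "z \<in> S"
      then obtain U V where UV: "openin T U" "openin T' V" "fst z \<in> U" "snd z \<in> V" "U \<times> V \<subseteq> S"
        using S unfolding openin_prod_topology_alt by (metis surjective_pairing)
      obtain F \<epsilon> where F: "F \<subseteq> range p" "finite F" "0 < \<epsilon>" "{y\<in>?E. \<forall>p\<in>F. p (y - fst z) < \<epsilon>} \<subseteq> U"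
        using pballE[OF UV(1,3)] .
      obtain G \<delta> where G: "G \<subseteq> range q" "finite G" "0 < \<delta>" "{y\<in>?E'. \<forall>p\<in>G. p (y - snd z) < \<delta>} \<subseteq> V"
        using qballE[OF UV(2,4)] .
      obtain I where I: "finite I" "F = p ` I" using F(1,2) finite_subset_image by metis
      obtain J where J: "finite J" "G = q ` J" using G(1,2) finite_subset_image by metis
      have "{y \<in> ?E \<times> ?E'. \<forall>p\<in>r ` (I \<union> J). p (y - z) < min \<epsilon> \<delta>} \<subseteq> S"
      proof
        fix y assume y: "y \<in> {y \<in> ?E \<times> ?E'. \<forall>p\<in>r ` (I \<union> J). p (y - z) < min \<epsilon> \<delta>}"
        have yz: "y - z \<in> ?E \<times> ?E'" using y z SE by (intro subspace_diff[OF sub]) auto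
        have "fst y \<in> U" using F(4) y rp(1)[OF yz] I(2) by (fastforce intro: le_less_trans)
        moreover have "snd y \<in> V" using G(4) y rp(2)[OF yz] J(2) by (fastforce intro: le_less_trans)
        ultimately show "y \<in> S" using UV(5) by (metis SigmaI prod.collapse subsetD)
      qed
      then show "\<exists>F \<epsilon>. F \<subseteq> range r \<and> finite F \<and> 0 < \<epsilon> \<and> {y \<in> ?E \<times> ?E'. \<forall>p\<in>F. p (y - z) < \<epsilon>} \<subseteq> S"
        using I(1) J(1) F(3) G(3) by (intro exI[of _ "r ` (I \<union> J)"] exI[of _ "min \<epsilon> \<delta>"]) auto
    qed
  next
    fix S assume S: "openin (seminorm_topology (?E \<times> ?E') (range r)) S"
    show "openin (prod_topology T T') S"
      unfolding openin_prod_topology_alt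
    proof (intro allI impI)
      fix x y assume xy: "(x, y) \<in> S"
      have xyE: "x \<in> ?E" "y \<in> ?E'" using S xy unfolding openin_seminorm_topology by auto
      obtain F \<epsilon> where F: "F \<subseteq> range r" "finite F" "0 < \<epsilon>"
        "{w\<in>?E \<times> ?E'. \<forall>p\<in>F. p (w - (x, y)) < \<epsilon>} \<subseteq> S"
        using seminorm_topology_ballE[OF S xy] .
      obtain I where I: "finite I" "F = r ` I" using F(1,2) finite_subset_image by metis
      let ?U = "topspace T \<inter> \<Inter> ((\<lambda>n. {w \<in> ?E. p n (w - x) < \<epsilon>/2}) ` I)"
      let ?V = "topspace T' \<inter> \<Inter> ((\<lambda>n. {w \<in> ?E'. q n (w - y) < \<epsilon>/2}) ` I)"
      have "openin T {w \<in> ?E. p n (w - x) < \<epsilon>/2}" for n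
        using pball[OF xyE(1)] .
      then have U: "openin T ?U" using I(1) by (cases "I = {}") (auto intro!: openin_Int openin_Inter)
      have "openin T' {w \<in> ?E'. q n (w - y) < \<epsilon>/2}" for n
        using qball[OF xyE(2)] .
      then have V: "openin T' ?V" using I(1) by (cases "I = {}") (auto intro!: openin_Int openin_Inter)
      have "?U \<times> ?V \<subseteq> S"
      proof
        fix w assume w: "w \<in> ?U \<times> ?V"
        have "\<forall>p\<in>F. p (w - (x, y)) < \<epsilon>"
        proof
          fix s assume "s \<in> F"
          then obtain n where "n \<in> I" "s = r n" using I(2) by blast
          moreover from this w have "p n (fst w - x) < \<epsilon>/2" "q n (snd w - y) < \<epsilon>/2" by auto
          ultimately show "s (w - (x, y)) < \<epsilon>" by (simp add: r_def)
        qed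
        then show "w \<in> S" using F(4) w by auto
      qed
      moreover have "x \<in> ?U" "y \<in> ?V" using xyE F(3) by (auto simp: pn(1) qn(1))
      ultimately show "\<exists>U V. openin T U \<and> openin T' V \<and> x \<in> U \<and> y \<in> V \<and> U \<times> V \<subseteq> S"
        using U V by blast
    qed
  qed
  have sep: "z = 0" if "z \<in> ?E \<times> ?E'" "\<And>n. r n z = 0" for z
  proof -
    have "p n (fst z) = 0" "q n (snd z) = 0" for n
      using rp[OF that(1), of n] that(2)[of n] pn(3)[of "fst z" n] qn(3)[of "snd z" n] that(1) by auto
    then have "fst z = 0" "snd z = 0" using p(4)[of "fst z"] q(4)[of "snd z"] that(1) by fastforce+
    then show ?thesis by (simp add: prod_eq_iff)
  qed
  have compl: "\<exists>x\<in>?E \<times> ?E'. \<forall>n. (\<lambda>i. r n (X i - x)) \<longlonglongrightarrow> 0"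
    if X: "\<And>i. X i \<in> ?E \<times> ?E'"
      "\<And>n \<epsilon>. 0 < \<epsilon> \<Longrightarrow> \<exists>K. \<forall>i\<ge>K. \<forall>j\<ge>K. r n (X i - X j) < \<epsilon>" for X
  proof -
    have XX: "X i - X j \<in> ?E \<times> ?E'" for i j using X(1) by (intro subspace_diff[OF sub])
    have "\<exists>K. \<forall>i\<ge>K. \<forall>j\<ge>K. p n (fst (X i) - fst (X j)) < \<epsilon>" if "0 < \<epsilon>" for n \<epsilon>
      using X(2)[OF that, of n] rp(1)[OF XX, of n] by (simp, meson le_less_trans)
    moreover have "fst (X i) \<in> ?E" "snd (X i) \<in> ?E'" for i using X(1)[of i] by auto
    ultimately obtain x where x: "x \<in> ?E" "\<And>n. (\<lambda>i. p n (fst (X i) - x)) \<longlonglongrightarrow> 0"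
      using seminorm_completeD[OF pc, of "\<lambda>i. fst (X i)"] by blast
    have "\<exists>K. \<forall>i\<ge>K. \<forall>j\<ge>K. q n (snd (X i) - snd (X j)) < \<epsilon>" if "0 < \<epsilon>" for n \<epsilon>
      using X(2)[OF that, of n] rp(2)[OF XX, of n] by (simp, meson le_less_trans)
    with \<open>\<And>i. snd (X i) \<in> ?E'\<close>
    obtain y where y: "y \<in> ?E'" "\<And>n. (\<lambda>i. q n (snd (X i) - y)) \<longlonglongrightarrow> 0"
      using seminorm_completeD[OF qc, of "\<lambda>i. snd (X i)"] by blast
    have "(\<lambda>i. r n (X i - (x, y))) \<longlonglongrightarrow> 0" for n
      using tendsto_add[OF x(2) y(2)] by (simp add: r_def)
    then show ?thesis using x y by blast
  qed
  show ?thesis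
    unfolding frechet_space_iff generating_seminorms_def seminorm_complete_def topspace_prod_topology
    using sub sr top[symmetric] sep compl
    by (intro conjI exI[of _ r]) (auto simp del: mem_Sigma_iff)
qed

text \<open>The seminorms are simply restricted. Closedness is what preserves completeness: a Cauchy
  sequence in \<open>F\<close> has a limit in the whole space, which then lies in
  \<open>F\<close>.\<close>

lemma frechet_space_subtopology:
  assumes "frechet_space T" "closedin T F" "subspace F"
  shows "frechet_space (subtopology T F)"
proof -
  let ?E = "topspace T"
  obtain p where "generating_seminorms T (range p)" and pc: "seminorm_complete (topspace T) p"
    using assms(1) unfolding frechet_space_iff by blast
  note p = generating_seminormsD[OF this(1)]
    and pball = openin_generating_ball[OF this(1) rangeI] and pballE = generating_seminorms_ballE[OF this(1)]
  have FE: "F \<subseteq> ?E" using assms(2) by (rule closedin_subset)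
  then have ts: "topspace (subtopology T F) = F" by auto
  have "subtopology T F = seminorm_topology F (range p)"
    unfolding topology_eq
  proof (intro allI iffI)
    fix S assume "openin (subtopology T F) S"
    then obtain V where V: "openin T V" "S = V \<inter> F" unfolding openin_subtopology by blast
    show "openin (seminorm_topology F (range p)) S"
      unfolding openin_seminorm_topology
    proof (intro conjI ballI)
      show "S \<subseteq> F" using V by blast
      fix x assume "x \<in> S"
      then obtain G \<epsilon> where "G \<subseteq> range p" "finite G" "0 < \<epsilon>" "{y\<in>?E. \<forall>p\<in>G. p (y - x) < \<epsilon>} \<subseteq> V"
        using pballE[OF V(1), of x] V(2) by blast
      then show "\<exists>G \<epsilon>. G \<subseteq> range p \<and> finite G \<and> 0 < \<epsilon> \<and> {y \<in> F. \<forall>p\<in>G. p (y - x) < \<epsilon>} \<subseteq> S"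
        using V FE by (intro exI[of _ G] exI[of _ \<epsilon>]) auto
    qed
  next
    fix S assume S: "openin (seminorm_topology F (range p)) S"
    show "openin (subtopology T F) S"
    proof (subst openin_subopen, intro ballI)
      fix x assume x: "x \<in> S"
      have xE: "x \<in> F" using S x unfolding openin_seminorm_topology by auto
      obtain G \<epsilon> where G: "G \<subseteq> range p" "finite G" "0 < \<epsilon>" "{y\<in>F. \<forall>p\<in>G. p (y - x) < \<epsilon>} \<subseteq> S"
        using seminorm_topology_ballE[OF S x] .
      obtain I where I: "finite I" "G = p ` I" using G(1,2) finite_subset_image by metis
      let ?U = "topspace T \<inter> \<Inter> ((\<lambda>n. {w \<in> ?E. p n (w - x) < \<epsilon>}) ` I)"
      have "openin T {w \<in> ?E. p n (w - x) < \<epsilon>}" for n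
        using pball[of x] xE FE by blast
      then have U: "openin T ?U" using I(1) by (cases "I = {}") (auto intro!: openin_Int openin_Inter)
      then have "openin (subtopology T F) (?U \<inter> F)" by (auto simp: openin_subtopology)
      moreover have "x \<in> ?U \<inter> F" using xE FE G(3) by (auto simp: seminorm_onD(1)[OF p(2)[OF rangeI] p(1)])
      moreover have "?U \<inter> F \<subseteq> S" using G(4) I(2) by auto
      ultimately show "\<exists>U. openin (subtopology T F) U \<and> x \<in> U \<and> U \<subseteq> S" by blast
    qed
  qed
  moreover have "\<exists>x\<in>F. \<forall>n. (\<lambda>i. p n (X i - x)) \<longlonglongrightarrow> 0"
    if X: "\<And>i. X i \<in> F" "\<And>n \<epsilon>. 0 < \<epsilon> \<Longrightarrow> \<exists>K. \<forall>i\<ge>K. \<forall>j\<ge>K. p n (X i - X j) < \<epsilon>" for X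
  proof -
    obtain x where x: "x \<in> ?E" "\<And>n. (\<lambda>i. p n (X i - x)) \<longlonglongrightarrow> 0"
      using seminorm_completeD[OF pc, of X] X FE by blast
    have "limitin (seminorm_topology ?E (range p)) X x sequentially"
    proof (subst limitin_seminorm_topology)
      show "x \<in> ?E \<and> (\<forall>\<^sub>F i in sequentially. X i \<in> ?E) \<and>
        (\<forall>p\<in>range p. \<forall>\<epsilon>>0. \<forall>\<^sub>F i in sequentially. p (X i - x) < \<epsilon>)"
        using x X(1) FE order_tendstoD(2)[OF x(2)] by (auto intro: always_eventually)
    qed (use p in auto)
    then have "x \<in> F"
      using limitin_closedin[OF _ assms(2), of X x sequentially, folded p(3)] X(1)
      by (simp only: p(3)[symmetric]) simp
    then show ?thesis using x by blast
  qed
  moreover have "seminorm_on F (p n)" for n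
    using p(2)[of "p n"] FE unfolding seminorm_on_def by blast
  moreover have "x = 0" if "x \<in> F" "\<And>n. p n x = 0" for x using p(4)[of x] that FE by fast
  ultimately show ?thesis
    unfolding frechet_space_iff generating_seminorms_def seminorm_complete_def ts using assms(3)
    by (intro conjI exI[of _ p]) auto
qed

section \<open>Calculus in Frechet spaces\<close>

lemma limitin_compose_filterlim:
  assumes "limitin X f l G" "filterlim g G F"
  shows "limitin X (\<lambda>x. f (g x)) l F"
  using assms unfolding limitin_def by (auto intro: eventually_compose_filterlim)

lemma limitin_eventually_mem: "limitin X f l F \<Longrightarrow> \<forall>\<^sub>F x in F. f x \<in> topspace X"
  using limitinD limitin_topspace openin_topspace by fast

lemma limitin_continuous_map_compose:
  assumes "continuous_map X Y f" "limitin X g l F" "f l = m"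
  shows "limitin Y (\<lambda>i. f (g i)) m F"
  using continuous_map_limit[OF assms(1,2)] assms(3) by (simp add: o_def)

lemma continuous_map_fstI: "continuous_map Z (prod_topology X Y) f \<Longrightarrow> continuous_map Z X (\<lambda>z. fst (f z))"
  and continuous_map_sndI: "continuous_map Z (prod_topology X Y) f \<Longrightarrow> continuous_map Z Y (\<lambda>z. snd (f z))"
  by (simp_all add: continuous_map_pairwise o_def)

lemma filterlim_mult_at_0:
  assumes "(c::real) \<noteq> 0"
  shows "filterlim (\<lambda>h. h * c) (at 0) (at 0)"
proof -
  have "((\<lambda>h. h * c) \<longlongrightarrow> 0 * c) (at 0)" by (intro tendsto_intros)
  then show ?thesis using assms
    by (auto simp: filterlim_at eventually_at intro!: exI[of _ "1::real"])
qed

text \<open>The bound \<open>(M + e) * (b - a)\<close> on the increment over an interval is additive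
  over adjacent intervals, and differentiability gives it on all short intervals around a point; the
  slack \<open>e\<close> absorbs the error of the difference quotient. Bisection then extends it to
  the unit interval, without passing to linear functionals.\<close>

lemma mean_value_seminorm:
  assumes T: "frechet_space T" and p: "seminorm_on (topspace T) p"
    and ball: "\<And>c e. c \<in> topspace T \<Longrightarrow> openin T {y \<in> topspace T. p (y - c) < e}"
    and mem: "\<And>r. r \<in> {0..1} \<Longrightarrow> \<gamma> r \<in> topspace T"
    and der: "\<And>r. r \<in> {0..1} \<Longrightarrow> limitin T (\<lambda>h::real. (1 / h) *\<^sub>R (\<gamma> (r + h) - \<gamma> r)) (d r) (at 0)"
    and bd: "\<And>r. r \<in> {0..1} \<Longrightarrow> p (d r) \<le> M"
  shows "p (\<gamma> 1 - \<gamma> 0) \<le> M"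
proof (rule field_le_epsilon)
  fix e :: real assume e: "0 < e"
  note sub = frechet_space_subspace[OF T]
  note sn = seminorm_onD[OF p sub]
  have d: "d r \<in> topspace T" if "r \<in> {0..1}" for r using der[OF that] by (rule limitin_topspace)
  \<comment> \<open>\<open>Bolzano\<close> asks for short intervals around a point that may stick
    out of the unit interval. The guards make \<open>P\<close> vacuous there, where nothing is
    assumed about the curve.\<close>
  define P where "P a b \<longleftrightarrow> (0 \<le> a \<longrightarrow> b \<le> 1 \<longrightarrow> p (\<gamma> b - \<gamma> a) \<le> (M + e) * (b - a))" for a b
  have "P 0 1"
  proof (rule Bolzano)
    show "(0::real) \<le> 1" by simp
  next
    fix a b c assume *: "P a b" "P b c" "a \<le> b" "b \<le> c"
    show "P a c" unfolding P_def
    proof (intro impI)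
      assume ac: "0 \<le> a" "c \<le> 1"
      have "p ((\<gamma> c - \<gamma> b) + (\<gamma> b - \<gamma> a)) \<le> p (\<gamma> c - \<gamma> b) + p (\<gamma> b - \<gamma> a)"
        using * ac mem by (intro sn(4) subspace_diff[OF sub]) auto
      also have "\<dots> \<le> (M + e) * (c - b) + (M + e) * (b - a)"
        using * ac unfolding P_def by (intro add_mono) auto
      finally show "p (\<gamma> c - \<gamma> a) \<le> (M + e) * (c - a)" by (simp add: algebra_simps)
    qed
  next
    fix x :: real assume x: "0 \<le> x" "x \<le> 1"
    then have x': "x \<in> {0..1}" by simp
    have "\<forall>\<^sub>F h in at 0. (1 / h) *\<^sub>R (\<gamma> (x + h) - \<gamma> x) \<in> {y \<in> topspace T. p (y - d x) < e}"
      using e d[OF x'] by (intro limitinD[OF der[OF x'] ball[OF d[OF x']]]) (auto simp: sn(1))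
    then obtain \<delta> where \<delta>: "0 < \<delta>" and
      q: "\<And>h. h \<noteq> 0 \<Longrightarrow> \<bar>h\<bar> < \<delta> \<Longrightarrow> (1 / h) *\<^sub>R (\<gamma> (x + h) - \<gamma> x) \<in> {y \<in> topspace T. p (y - d x) < e}"
      unfolding eventually_at by (auto simp: dist_real_def)
    \<comment> \<open>Both signs of \<open>h\<close> are needed, since the point \<open>x\<close>
      splits the short interval into a part on its left and a part on its right.\<close>
    have est: "p (\<gamma> (x + h) - \<gamma> x) \<le> (M + e) * \<bar>h\<bar>" if "\<bar>h\<bar> < \<delta>" for h
    proof (cases "h = 0")
      case False
      let ?q = "(1 / h) *\<^sub>R (\<gamma> (x + h) - \<gamma> x)"
      have qq: "?q \<in> topspace T" "p (?q - d x) < e" using q[OF False that] by auto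
      have "p ((?q - d x) + d x) \<le> p (?q - d x) + p (d x)"
        using qq d[OF x'] by (intro sn(4) subspace_diff[OF sub])
      then have "p ?q \<le> M + e" using qq bd[OF x'] by simp
      moreover have "p (\<gamma> (x + h) - \<gamma> x) = \<bar>h\<bar> * p ?q"
        using sn(7)[OF qq(1), of h] False by simp
      ultimately show ?thesis by (simp add: mult.commute mult_left_mono)
    qed (simp add: sn(1))
    show "\<exists>d>0. \<forall>a b. a \<le> x \<and> x \<le> b \<and> b - a < d \<longrightarrow> P a b"
    proof (intro exI[of _ \<delta>] conjI allI impI \<delta>)
      fix a b assume ab: "a \<le> x \<and> x \<le> b \<and> b - a < \<delta>"
      show "P a b" unfolding P_def
      proof (intro impI)
        assume ab': "0 \<le> a" "b \<le> 1"
        have m: "\<gamma> a \<in> topspace T" "\<gamma> b \<in> topspace T" "\<gamma> x \<in> topspace T"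
          using ab ab' mem x by auto
        have "p ((\<gamma> b - \<gamma> x) + (\<gamma> x - \<gamma> a)) \<le> p (\<gamma> b - \<gamma> x) + p (\<gamma> x - \<gamma> a)"
          using m by (intro sn(4) subspace_diff[OF sub])
        also have "\<dots> \<le> (M + e) * (b - x) + (M + e) * (x - a)"
          using est[of "b - x"] est[of "a - x"] ab sn(5)[OF m(3,1)] by (intro add_mono) auto
        finally show "p (\<gamma> b - \<gamma> a) \<le> (M + e) * (b - a)" by (simp add: algebra_simps)
      qed
    qed
  qed
  then show "p (\<gamma> 1 - \<gamma> 0) \<le> M + e" by (simp add: P_def)
qed

text \<open>The mean value inequality makes difference quotients of a family of \<open>C\<^sup>1\<close> maps, depending
  continuously on a parameter, converge along arbitrary nets of base points, parameters and directions.\<close>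

lemma difference_quotient_limit:
  fixes T :: "'v::real_vector topology" and P :: "'p topology" and F' :: "'v \<Rightarrow> 'p \<Rightarrow> 'v \<Rightarrow> 'w::real_vector"
  assumes T: "frechet_space T" and T': "frechet_space T'" and U: "openin T U"
    and cont: "continuous_map (prod_topology (subtopology T U) (prod_topology P T)) T'
      (\<lambda>(x, w, v). F' x w v)"
    and mem: "\<And>x w. x \<in> U \<Longrightarrow> w \<in> topspace P \<Longrightarrow> F x w \<in> topspace T'"
    and der: "\<And>x w v. x \<in> U \<Longrightarrow> w \<in> topspace P \<Longrightarrow> v \<in> topspace T \<Longrightarrow>
      limitin T' (\<lambda>t::real. (1 / t) *\<^sub>R (F (x + t *\<^sub>R v) w - F x w)) (F' x w v) (at 0)"
    and y: "y \<in> U" "limitin T y0 y \<F>" and w: "limitin P w0 w \<F>" and v: "limitin T v0 v \<F>"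
    and t: "(t0 \<longlongrightarrow> (0::real)) \<F>" "\<forall>\<^sub>F i in \<F>. t0 i \<noteq> 0"
  shows "limitin T' (\<lambda>i. (1 / t0 i) *\<^sub>R (F (y0 i + t0 i *\<^sub>R v0 i) (w0 i) - F (y0 i) (w0 i)))
    (F' y w v) \<F>"
  unfolding limitin_def
proof (intro conjI allI impI)
  have UT: "U \<subseteq> topspace T" using U by (rule openin_subset)
  have wP: "w \<in> topspace P" and vT: "v \<in> topspace T" using w v by (auto simp: limitin_def)
  have F'mem: "F' x w v \<in> topspace T'" if "x \<in> U" "w \<in> topspace P" "v \<in> topspace T" for x w v
    using continuous_map_image_subset_topspace[OF cont, THEN subsetD, OF imageI, of "(x, w, v)"] that UT
    by auto
  define c where "c = F' y w v"
  show c: "F' y w v \<in> topspace T'" using F'mem y(1) wP vT by blast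
  fix V assume V: "openin T' V \<and> F' y w v \<in> V"
  obtain p where p: "seminorm_on (topspace T') p"
    and ball: "\<forall>c\<in>topspace T'. \<forall>e. openin T' {y \<in> topspace T'. p (y - c) < e}"
    and pV: "{z \<in> topspace T'. p (z - c) < 1} \<subseteq> V"
    using frechet_space_seminorm_ball[OF T' conjunct1[OF V] conjunct2[OF V]] unfolding c_def .
  note sub = frechet_space_subspace[OF T'] and sn = seminorm_onD[OF p frechet_space_subspace[OF T']]
  have c': "c \<in> topspace T'" using c by (simp add: c_def)
  \<comment> \<open>The radius 1/2 leaves room: the mean value inequality gives a weak bound, while
    the target ball is open of radius 1.\<close>
  define N where "N = {z \<in> topspace (prod_topology (subtopology T U) (prod_topology P T)).
    (\<lambda>(x, w, v). F' x w v) z \<in> {z \<in> topspace T'. p (z - c) < 1/2}}"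
  have "openin (prod_topology (subtopology T U) (prod_topology P T)) N"
    unfolding N_def using cont ball[rule_format, OF c'] by (rule openin_continuous_map_preimage)
  then have N: "openin (prod_topology T (prod_topology P T)) N"
    unfolding prod_topology_subtopology
    by (rule openin_trans_full) (use U in \<open>auto simp: openin_prod_Times_iff\<close>)
  let ?X = "prod_topology euclideanreal (prod_topology T (prod_topology P T))"
  \<comment> \<open>The shear that moves the base point along its direction. Its continuity at
    parameter 0 yields a neighbourhood of the data from which whole short segments stay in
    \<open>N\<close>.\<close>
  define S where "S = (\<lambda>(s::real, y'::'v, w'::'p, v'::'v). (y' + s *\<^sub>R v', w', v'))"
  have contS: "continuous_map ?X (prod_topology T (prod_topology P T)) S"
    unfolding S_def case_prod_unfold
    by (intro continuous_map_pairedI continuous_map_frechet_add[OF T] continuous_map_frechet_scaleR[OF T]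
        continuous_map_fstI continuous_map_sndI) (rule continuous_map_id[unfolded id_def])+
  then have "openin ?X {z \<in> topspace ?X. S z \<in> N}" using N by (rule openin_continuous_map_preimage)
  moreover have "(0, y, w, v) \<in> {z \<in> topspace ?X. S z \<in> N}"
    using y(1) wP vT UT c by (auto simp: S_def N_def sn(1) c_def)
  ultimately obtain A B where A: "openin euclideanreal A" "0 \<in> A"
    and B: "openin (prod_topology T (prod_topology P T)) B" "(y, w, v) \<in> B"
    and AB: "A \<times> B \<subseteq> {z \<in> topspace ?X. S z \<in> N}"
    unfolding openin_prod_topology_alt[of euclideanreal] by blast
  obtain \<delta> where \<delta>: "0 < \<delta>" "\<And>s. \<bar>s\<bar> < \<delta> \<Longrightarrow> s \<in> A"
    using A open_dist[of A] by (auto simp: dist_real_def)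
  have "limitin (prod_topology T (prod_topology P T)) (\<lambda>i. (y0 i, w0 i, v0 i)) (y, w, v) \<F>"
    using y w v by (simp add: limitin_pairwise o_def)
  then have "\<forall>\<^sub>F i in \<F>. (y0 i, w0 i, v0 i) \<in> B" using B by (rule limitinD)
  moreover have "\<forall>\<^sub>F i in \<F>. \<bar>t0 i\<bar> < \<delta>"
    using tendstoD[OF t(1) \<delta>(1)] by simp
  ultimately show "\<forall>\<^sub>F i in \<F>. (1 / t0 i) *\<^sub>R (F (y0 i + t0 i *\<^sub>R v0 i) (w0 i) - F (y0 i) (w0 i)) \<in> V"
    using t(2)
  proof eventually_elim
    case (elim i)
    have seg: "(y0 i + (r * t0 i) *\<^sub>R v0 i, w0 i, v0 i) \<in> N" if "r \<in> {0..1}" for r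
    proof -
      have "\<bar>r * t0 i\<bar> \<le> 1 * \<bar>t0 i\<bar>" unfolding abs_mult using that by (intro mult_right_mono) auto
      then have "r * t0 i \<in> A" using elim(2) by (intro \<delta>(2)) simp
      then show ?thesis using AB elim(1) by (auto simp: S_def)
    qed
    have segU: "y0 i + (r * t0 i) *\<^sub>R v0 i \<in> U" "w0 i \<in> topspace P" "v0 i \<in> topspace T"
      and segp: "p (F' (y0 i + (r * t0 i) *\<^sub>R v0 i) (w0 i) (v0 i) - c) < 1/2" if "r \<in> {0..1}" for r
      using seg[OF that] by (auto simp: N_def)
    \<comment> \<open>Subtracting the uniform motion with velocity \<open>t0 i *\<^sub>R c\<close>
      leaves a curve whose derivative \<open>d\<close> is a small error. Its total increment is
      \<open>t0 i\<close> times the deviation of the difference quotient from \<open>c\<close>, so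
      dividing by \<open>t0 i\<close> gives the claim.\<close>
    define \<gamma> where "\<gamma> r = F (y0 i + (r * t0 i) *\<^sub>R v0 i) (w0 i) - (r * t0 i) *\<^sub>R c" for r
    define d where "d r = t0 i *\<^sub>R (F' (y0 i + (r * t0 i) *\<^sub>R v0 i) (w0 i) (v0 i) - c)" for r
    have "p (\<gamma> 1 - \<gamma> 0) \<le> \<bar>t0 i\<bar> / 2"
    proof (rule mean_value_seminorm[OF T' p ball[rule_format], where d = d])
      fix r :: real assume r: "r \<in> {0..1}"
      show "\<gamma> r \<in> topspace T'"
        unfolding \<gamma>_def using segU[OF r] mem c' by (intro frechet_space_mem[OF T']) auto
      let ?x = "y0 i + (r * t0 i) *\<^sub>R v0 i"
      have "limitin T' (\<lambda>h. t0 i *\<^sub>R ((1 / (h * t0 i)) *\<^sub>R (F (?x + (h * t0 i) *\<^sub>R v0 i) (w0 i) - F ?x (w0 i)) - c)) (d r) (at 0)"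
        unfolding d_def
        by (intro limitin_scaleR[OF T'] tendsto_const limitin_diff[OF T']
            limitin_compose_filterlim[OF der[OF segU[OF r]] filterlim_mult_at_0[OF elim(3)]])
          (use c' in simp)
      then show "limitin T' (\<lambda>h. (1 / h) *\<^sub>R (\<gamma> (r + h) - \<gamma> r)) (d r) (at 0)"
      proof (rule limitin_transform_eventually[rotated])
        show "\<forall>\<^sub>F h in at 0. t0 i *\<^sub>R ((1 / (h * t0 i)) *\<^sub>R (F (?x + (h * t0 i) *\<^sub>R v0 i) (w0 i) - F ?x (w0 i)) - c) =
          (1 / h) *\<^sub>R (\<gamma> (r + h) - \<gamma> r)"
          using eventually_neq_at_within[of 0]
        proof eventually_elim
          case (elim h)
          have "?x + (h * t0 i) *\<^sub>R v0 i = y0 i + ((r + h) * t0 i) *\<^sub>R v0 i"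
            by (simp add: algebra_simps)
          then show ?case using \<open>t0 i \<noteq> 0\<close> elim
            by (simp add: \<gamma>_def algebra_simps)
        qed
      qed
      have "p (d r) = \<bar>t0 i\<bar> * p (F' ?x (w0 i) (v0 i) - c)"
        unfolding d_def using F'mem segU[OF r] c' by (intro sn(7) subspace_diff[OF sub]) auto
      also have "\<dots> \<le> \<bar>t0 i\<bar> * (1/2)" using segp[OF r] by (intro mult_left_mono) auto
      finally show "p (d r) \<le> \<bar>t0 i\<bar> / 2" by simp
    qed
    define Q where "Q = (1 / t0 i) *\<^sub>R (F (y0 i + t0 i *\<^sub>R v0 i) (w0 i) - F (y0 i) (w0 i))"
    have Q: "Q \<in> topspace T'"
      unfolding Q_def using segU[of 0] segU[of 1] mem by (intro frechet_space_mem[OF T']) auto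
    have "\<gamma> 1 - \<gamma> 0 = t0 i *\<^sub>R (Q - c)" using elim(3) by (simp add: \<gamma>_def Q_def algebra_simps)
    then have "\<bar>t0 i\<bar> * p (Q - c) \<le> \<bar>t0 i\<bar> / 2"
      using \<open>p (\<gamma> 1 - \<gamma> 0) \<le> \<bar>t0 i\<bar> / 2\<close> sn(7)[of "Q - c" "t0 i"] Q c' by (simp add: subspace_diff[OF sub])
    then have "p (Q - c) < 1" using elim(3) by (simp add: field_simps)
    then show ?case using pV Q by (auto simp: Q_def c_def)
  qed
qed

section \<open>Iterated directional derivatives and their multilinearity\<close>

text \<open>The body of \<open>frechet_smooth\<close> with the derivatives as an argument, so that
  statements can refer to a particular system \<open>D\<close> of them.\<close>

definition higher_derivs :: "'v::real_vector topology \<Rightarrow> 'v set \<Rightarrow> 'w::real_vector topology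
    \<Rightarrow> ('v \<Rightarrow> 'w) \<Rightarrow> (nat \<Rightarrow> 'v \<Rightarrow> (nat \<Rightarrow> 'v) \<Rightarrow> 'w) \<Rightarrow> bool" where
  "higher_derivs T U T' f D \<longleftrightarrow>
     (\<forall>x\<in>U. \<forall>v. D 0 x v = f x) \<and>
     (\<forall>k. continuous_map
            (prod_topology (subtopology T U) (product_topology (\<lambda>_. T) {..<k})) T' (\<lambda>(x, v). D k x v)) \<and>
     (\<forall>k. \<forall>x\<in>U. \<forall>v\<in>topspace (product_topology (\<lambda>_. T) {..<Suc k}).
        limitin T'
          (\<lambda>t::real. (1 / t) *\<^sub>R (D k (x + t *\<^sub>R v k) (restrict v {..<k}) - D k x (restrict v {..<k})))
          (D (Suc k) x v) (at 0))"

lemma frechet_smooth_iff: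
  "frechet_smooth T U T' f \<longleftrightarrow> openin T U \<and> (\<exists>D. higher_derivs T U T' f D)"
  by (simp add: frechet_smooth_def higher_derivs_def)

lemma frechet_smoothI: "openin T U \<Longrightarrow> higher_derivs T U T' f D \<Longrightarrow> frechet_smooth T U T' f"
  by (auto simp: frechet_smooth_iff)

text \<open>Elements are extensional. Hence \<open>v(k := a)\<close> appends a direction numbered
  \<open>k\<close>, and \<open>restrict v {..<k}\<close> takes it away again.\<close>

abbreviation families :: "'v topology \<Rightarrow> nat \<Rightarrow> (nat \<Rightarrow> 'v) topology" where
  "families T k \<equiv> product_topology (\<lambda>_. T) {..<k}"

lemma families_fun_upd:
  assumes "v \<in> topspace (families T k)" "a \<in> topspace T"
  shows "j < k \<Longrightarrow> v(j := a) \<in> topspace (families T k)"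
    and "v(k := a) \<in> topspace (families T (Suc k))"
  using assms by (auto simp: PiE_iff extensional_def)

lemma families_restrict:
  "v \<in> topspace (families T (Suc k)) \<Longrightarrow> restrict v {..<k} \<in> topspace (families T k)"
  by (auto simp: PiE_iff)

lemma restrict_fun_upd_families:
  "v \<in> topspace (families T k) \<Longrightarrow> restrict (v(k := a)) {..<k} = v"
  by (auto simp: PiE_iff extensional_def restrict_def fun_eq_iff)

lemma continuous_map_families:
  assumes "\<And>j. j < k \<Longrightarrow> continuous_map X T (h j)"
  shows "continuous_map X (families T k) (\<lambda>x. \<lambda>j\<in>{..<k}. h j x)"
  unfolding continuous_map_componentwise using assms by (auto simp: restrict_def extensional_def)

lemma continuous_map_families_upd:
  assumes "continuous_map X (families T k) f" "continuous_map X T g"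
  shows "continuous_map X (families T (Suc k)) (\<lambda>x. (f x)(k := g x))"
  unfolding continuous_map_componentwise
proof (intro conjI ballI image_subsetI)
  fix x assume "x \<in> topspace X"
  then show "(f x)(k := g x) \<in> extensional {..<Suc k}"
    using assms(1) unfolding continuous_map_componentwise by (auto simp: extensional_def)
next
  fix i assume "i \<in> {..<Suc k}"
  then show "continuous_map X T (\<lambda>x. ((f x)(k := g x)) i)"
    using assms unfolding continuous_map_componentwise by (cases "i = k") auto
qed

lemma families_limitin_upd:
  assumes "limitin (families T k) f l F" "limitin T g m F"
  shows "j < k \<Longrightarrow> limitin (families T k) (\<lambda>x. (f x)(j := g x)) (l(j := m)) F"
proof -
  assume j: "j < k"
  have "\<forall>\<^sub>F x in F. f x \<in> topspace (families T k)" "\<forall>\<^sub>F x in F. g x \<in> topspace T"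
    by (rule limitin_eventually_mem[OF assms(1)], rule limitin_eventually_mem[OF assms(2)])
  then have "\<forall>\<^sub>F x in F. (f x)(j := g x) \<in> topspace (families T k)"
    by eventually_elim (rule families_fun_upd(1)[OF _ _ j])
  then show ?thesis
    using assms j unfolding limitin_componentwise by (auto simp: extensional_def)
qed

context
  fixes T :: "'v::real_vector topology" and T' :: "'w::real_vector topology" and U f D
  assumes T: "frechet_space T" and T': "frechet_space T'" and U: "openin T U"
    and D: "higher_derivs T U T' f D"
begin

lemma higher_derivs_mem: "x \<in> U \<Longrightarrow> v \<in> topspace (families T k) \<Longrightarrow> D k x v \<in> topspace T'"
proof -
  assume *: "x \<in> U" "v \<in> topspace (families T k)"
  have "continuous_map (prod_topology (subtopology T U) (families T k)) T' (\<lambda>(x, v). D k x v)"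
    using D unfolding higher_derivs_def by blast
  from continuous_map_image_subset_topspace[OF this, THEN subsetD, OF imageI, of "(x, v)"]
  show ?thesis using * openin_subset[OF U] by auto
qed

lemma higher_derivs_limit:
  assumes "x \<in> U" "limitin T y x F" "limitin (families T k) w v F"
  shows "limitin T' (\<lambda>i. D k (y i) (w i)) (D k x v) F"
proof -
  have cont: "continuous_map (prod_topology (subtopology T U) (families T k)) T' (\<lambda>(x, v). D k x v)"
    using D unfolding higher_derivs_def by blast
  have "\<forall>\<^sub>F i in F. y i \<in> U" using limitinD[OF assms(2) U assms(1)] .
  then have "limitin (prod_topology (subtopology T U) (families T k)) (\<lambda>i. (y i, w i)) (x, v) F"
    using assms by (simp add: limitin_pairwise o_def limitin_subtopology)
  from limitin_continuous_map_compose[OF cont this] show ?thesis by simp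
qed

lemma higher_derivs_deriv:
  assumes "x \<in> U" "w \<in> topspace (families T k)" "v \<in> topspace T"
  shows "limitin T' (\<lambda>t::real. (1 / t) *\<^sub>R (D k (x + t *\<^sub>R v) w - D k x w)) (D (Suc k) x (w(k := v))) (at 0)"
proof -
  have "\<forall>v\<in>topspace (families T (Suc k)). limitin T'
      (\<lambda>t::real. (1 / t) *\<^sub>R (D k (x + t *\<^sub>R v k) (restrict v {..<k}) - D k x (restrict v {..<k})))
      (D (Suc k) x v) (at 0)"
    using D assms(1) unfolding higher_derivs_def by blast
  from bspec[OF this families_fun_upd(2)[OF assms(2,3)]] show ?thesis
    by (simp only: fun_upd_same restrict_fun_upd_families[OF assms(2)])
qed

text \<open>The definition provides the limit only at a fixed base point and for fixed directions.
  Here the base point, the earlier directions and the new direction may all move: this is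
  \<open>difference_quotient_limit\<close> with the earlier directions as parameter.\<close>

lemma higher_derivs_quotient_limit:
  assumes "x \<in> U" "limitin T y x F" "limitin (families T k) w0 w F" "limitin T v0 v F"
    "(t \<longlongrightarrow> (0::real)) F" "\<forall>\<^sub>F i in F. t i \<noteq> 0"
  shows "limitin T' (\<lambda>i. (1 / t i) *\<^sub>R (D k (y i + t i *\<^sub>R v0 i) (w0 i) - D k (y i) (w0 i)))
    (D (Suc k) x (w(k := v))) F"
proof (rule difference_quotient_limit[OF T T' U _ _ _ assms, where F = "D k" and F' = "\<lambda>x w v. D (Suc k) x (w(k := v))"])
  have "continuous_map (prod_topology (subtopology T U) (families T (Suc k))) T' (\<lambda>(x, v). D (Suc k) x v)"
    using D unfolding higher_derivs_def by blast
  moreover have "continuous_map (prod_topology (subtopology T U) (prod_topology (families T k) T))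
      (prod_topology (subtopology T U) (families T (Suc k))) (\<lambda>z. (fst z, (fst (snd z))(k := snd (snd z))))"
    by (intro continuous_map_pairedI continuous_map_families_upd continuous_map_fstI continuous_map_sndI)
      (rule continuous_map_id[unfolded id_def])+
  ultimately have "continuous_map (prod_topology (subtopology T U) (prod_topology (families T k) T)) T'
      ((\<lambda>(x, v). D (Suc k) x v) \<circ> (\<lambda>z. (fst z, (fst (snd z))(k := snd (snd z)))))"
    by (rule continuous_map_compose[rotated])
  then show "continuous_map (prod_topology (subtopology T U) (prod_topology (families T k) T)) T'
      (\<lambda>(x, w, v). D (Suc k) x (w(k := v)))" by (simp add: o_def case_prod_unfold)
qed (use higher_derivs_mem higher_derivs_deriv in blast)+

text \<open>Rescaling the direction is a rescaling of the parameter \<open>t\<close>. This needs a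
  nonzero factor; for \<open>c = 0\<close> the quotient vanishes identically.\<close>

lemma higher_derivs_scale_last:
  assumes "x \<in> U" "w \<in> topspace (families T k)" "b \<in> topspace T"
  shows "D (Suc k) x (w(k := c *\<^sub>R b)) = c *\<^sub>R D (Suc k) x (w(k := b))"
proof -
  have xT: "x \<in> topspace T" using assms(1) openin_subset[OF U] by blast
  note hd = higher_derivs_deriv[OF assms(1,2)]
  have cb: "c *\<^sub>R b \<in> topspace T" using assms(3) by (rule frechet_space_mem[OF T])
  have "limitin T' (\<lambda>t::real. (1 / t) *\<^sub>R (D k (x + t *\<^sub>R (c *\<^sub>R b)) w - D k x w)) (c *\<^sub>R D (Suc k) x (w(k := b))) (at 0)"
  proof (cases "c = 0")
    case True
    then show ?thesis by (simp add: frechet_space_mem(1)[OF T'])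
  next
    case False
    have "limitin T' (\<lambda>t. c *\<^sub>R ((1 / (t * c)) *\<^sub>R (D k (x + (t * c) *\<^sub>R b) w - D k x w)))
        (c *\<^sub>R D (Suc k) x (w(k := b))) (at 0)"
      by (intro limitin_scaleR[OF T'] tendsto_const
          limitin_compose_filterlim[OF hd[OF assms(3)] filterlim_mult_at_0[OF False]])
    then show ?thesis using False by simp
  qed
  with hd[OF cb] show ?thesis
    by (rule limitin_Hausdorff_unique[OF _ _ at_neq_bot frechet_space_Hausdorff[OF T']])
qed

text \<open>A step along \<open>a + b\<close> is a step along \<open>a\<close> followed by a step
  along \<open>b\<close> from the moved base point. The limit for the second step has a moving base
  point, so it is here that joint continuity enters.\<close>

lemma higher_derivs_add_last:
  assumes "x \<in> U" "w \<in> topspace (families T k)" "a \<in> topspace T" "b \<in> topspace T"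
  shows "D (Suc k) x (w(k := a + b)) = D (Suc k) x (w(k := a)) + D (Suc k) x (w(k := b))"
proof -
  have xT: "x \<in> topspace T" using assms(1) openin_subset[OF U] by blast
  note hd = higher_derivs_deriv[OF assms(1,2)]
  have ab: "a + b \<in> topspace T" using assms(3,4) by (rule frechet_space_mem[OF T])
  have "limitin T (\<lambda>t::real. x + t *\<^sub>R a) (x + 0 *\<^sub>R a) (at 0)"
    by (intro limitin_add[OF T] limitin_scaleR[OF T] tendsto_ident_at) (use xT assms in auto)
  then have xt: "limitin T (\<lambda>t::real. x + t *\<^sub>R a) x (at 0)" by simp
  have "limitin T' (\<lambda>t::real. (1 / t) *\<^sub>R (D k ((x + t *\<^sub>R a) + t *\<^sub>R b) w - D k (x + t *\<^sub>R a) w))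
      (D (Suc k) x (w(k := b))) (at 0)"
    by (rule higher_derivs_quotient_limit[OF assms(1) xt])
      (use assms tendsto_ident_at[of 0] eventually_neq_at_within[of 0] in auto)
  from limitin_add[OF T' hd[OF assms(3)] this]
  have "limitin T' (\<lambda>t::real. (1 / t) *\<^sub>R (D k (x + t *\<^sub>R (a + b)) w - D k x w))
      (D (Suc k) x (w(k := a)) + D (Suc k) x (w(k := b))) (at 0)"
    by (simp add: algebra_simps)
  with hd[OF ab] show ?thesis
    by (rule limitin_Hausdorff_unique[OF _ _ at_neq_bot frechet_space_Hausdorff[OF T']])
qed

lemma higher_derivs_eventually:
  assumes "x \<in> U" "a \<in> topspace T"
  shows "\<forall>\<^sub>F t::real in at 0. x + t *\<^sub>R a \<in> U"
proof -
  have xT: "x \<in> topspace T" using assms(1) openin_subset[OF U] by blast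
  have "limitin T (\<lambda>t::real. x + t *\<^sub>R a) (x + 0 *\<^sub>R a) (at 0)"
    by (intro limitin_add[OF T] limitin_scaleR[OF T] tendsto_ident_at) (use xT assms in auto)
  then show ?thesis using limitinD[OF _ U] assms(1) by simp
qed

text \<open>The last slot is covered by the two preceding lemmas. For an earlier slot, the identity
  at order \<open>k\<close>, which holds at all base points near \<open>x\<close>, is differentiated
  in the last direction. The combination \<open>a + c *\<^sub>R b\<close> carries additivity and
  homogeneity through one induction.\<close>

lemma higher_derivs_linear:
  assumes "x \<in> U" "v \<in> topspace (families T k)" "j < k" "a \<in> topspace T" "b \<in> topspace T"
  shows "D k x (v(j := a + c *\<^sub>R b)) = D k x (v(j := a)) + c *\<^sub>R D k x (v(j := b))"
  using assms
proof (induction k arbitrary: x v)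
  case (Suc k)
  have cb: "c *\<^sub>R b \<in> topspace T" and acb: "a + c *\<^sub>R b \<in> topspace T"
    using Suc.prems frechet_space_mem[OF T] by blast+
  define w where "w = restrict v {..<k}"
  have w: "w \<in> topspace (families T k)" unfolding w_def using Suc.prems(2) by (rule families_restrict)
  have vk: "v k \<in> topspace T" using Suc.prems(2) by (auto simp: PiE_iff)
  show ?case
  proof (cases "j = k")
    case True
    have vw: "v(k := z) = w(k := z)" for z
      using Suc.prems(2) by (auto simp: w_def PiE_iff extensional_def fun_eq_iff)
    then show ?thesis
      using higher_derivs_add_last[OF Suc.prems(1) w Suc.prems(4) cb]
        higher_derivs_scale_last[OF Suc.prems(1) w Suc.prems(5)] by (simp only: True vw)
  next
    case False
    then have j: "j < k" using Suc.prems(3) by simp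
    have eq: "v(j := z) = (w(j := z))(k := v k)" for z
      using Suc.prems(2) j by (auto simp: w_def PiE_iff extensional_def fun_eq_iff)
    note lim = higher_derivs_deriv[OF Suc.prems(1) families_fun_upd(1)[OF w _ j] vk]
    have "limitin T' (\<lambda>t::real. (1 / t) *\<^sub>R (D k (x + t *\<^sub>R v k) (w(j := a)) - D k x (w(j := a)))
       + c *\<^sub>R ((1 / t) *\<^sub>R (D k (x + t *\<^sub>R v k) (w(j := b)) - D k x (w(j := b)))))
       (D (Suc k) x (v(j := a)) + c *\<^sub>R D (Suc k) x (v(j := b))) (at 0)"
      unfolding eq using Suc.prems lim by (intro limitin_add[OF T'] limitin_scaleR[OF T'] tendsto_const)
    then have "limitin T' (\<lambda>t::real. (1 / t) *\<^sub>R (D k (x + t *\<^sub>R v k) (w(j := a + c *\<^sub>R b)) - D k x (w(j := a + c *\<^sub>R b))))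
       (D (Suc k) x (v(j := a)) + c *\<^sub>R D (Suc k) x (v(j := b))) (at 0)"
    proof (rule limitin_transform_eventually[rotated])
      show "\<forall>\<^sub>F t::real in at 0. (1 / t) *\<^sub>R (D k (x + t *\<^sub>R v k) (w(j := a)) - D k x (w(j := a)))
         + c *\<^sub>R ((1 / t) *\<^sub>R (D k (x + t *\<^sub>R v k) (w(j := b)) - D k x (w(j := b)))) =
         (1 / t) *\<^sub>R (D k (x + t *\<^sub>R v k) (w(j := a + c *\<^sub>R b)) - D k x (w(j := a + c *\<^sub>R b)))"
        using higher_derivs_eventually[OF Suc.prems(1) vk]
      proof eventually_elim
        case (elim t)
        show ?case
          unfolding Suc.IH[OF elim w j Suc.prems(4,5)] Suc.IH[OF Suc.prems(1) w j Suc.prems(4,5)]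
          by (simp add: algebra_simps)
      qed
    qed
    with lim[OF acb, folded eq] show ?thesis
      by (rule limitin_Hausdorff_unique[OF _ _ at_neq_bot frechet_space_Hausdorff[OF T']])
  qed
qed simp

text \<open>The product rule: \<open>D m\<close> is affine in each direction, so the quotient splits into a quotient in the
  base point and a telescoping sum over the directions.\<close>

lemma higher_derivs_curve:
  assumes x: "x \<in> U" and y: "limitin T (\<lambda>t::real. (1 / t) *\<^sub>R (y t - x)) x' (at 0)"
    and w: "w \<in> topspace (families T m)" "\<And>t. wt t \<in> extensional {..<m}"
    and w': "\<And>j. j < m \<Longrightarrow> limitin T (\<lambda>t::real. (1 / t) *\<^sub>R (wt t j - w j)) (w' j) (at 0)"
  shows "limitin T' (\<lambda>t::real. (1 / t) *\<^sub>R (D m (y t) (wt t) - D m x w))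
    (D (Suc m) x (w(m := x')) + (\<Sum>j<m. D m x (w(j := w' j)))) (at 0)"
proof -
  have xT: "x \<in> topspace T" using x openin_subset[OF U] by blast
  \<comment> \<open>A curve whose difference quotient converges is continuous: multiply the quotient
    by \<open>t\<close>.\<close>
  have curve: "limitin T z z0 (at 0)"
    if z0: "z0 \<in> topspace T" and q: "limitin T (\<lambda>t::real. (1 / t) *\<^sub>R (z t - z0)) z' (at 0)" for z z0 z'
  proof -
    have "limitin T (\<lambda>t::real. z0 + t *\<^sub>R ((1 / t) *\<^sub>R (z t - z0))) (z0 + 0 *\<^sub>R z') (at 0)"
      using z0 by (intro limitin_add[OF T] limitin_scaleR[OF T] tendsto_ident_at q) simp
    then have "limitin T (\<lambda>t::real. z0 + t *\<^sub>R ((1 / t) *\<^sub>R (z t - z0))) z0 (at 0)" by simp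
    moreover have "\<forall>\<^sub>F t::real in at 0. z0 + t *\<^sub>R ((1 / t) *\<^sub>R (z t - z0)) = z t"
      using eventually_neq_at_within[of 0] by eventually_elim simp
    ultimately show ?thesis by (rule limitin_transform_eventually[rotated])
  qed
  have wT: "w j \<in> topspace T" if "j < m" for j using w(1) that by (auto simp: PiE_iff)
  have wtj: "limitin T (\<lambda>t. wt t j) (w j) (at 0)" if "j < m" for j
    using curve[OF wT w'] that by blast
  have ev: "\<forall>\<^sub>F t in at 0. \<forall>j\<in>{..<m}. wt t j \<in> topspace T"
    by (intro eventually_ball_finite finite_lessThan ballI limitin_eventually_mem[OF wtj]) simp
  \<comment> \<open>The first \<open>j\<close> directions have already moved and the others still
    have their initial values; this interpolates between \<open>w\<close> at \<open>j = 0\<close>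
    and \<open>wt t\<close> at \<open>j = m\<close>.\<close>
  define h where "h j t = (\<lambda>i. if i < j then wt t i else w i)" for j t
  have hext: "h j t \<in> extensional {..<m}" if "j \<le> m" for j t
    using w that by (auto simp: h_def extensional_def PiE_iff)
  have hmem: "\<forall>\<^sub>F t in at 0. h j t \<in> topspace (families T m)" if "j \<le> m" for j
    using ev by eventually_elim (use that hext[OF that] wT in \<open>auto simp: h_def PiE_iff\<close>)
  have hlim: "limitin (families T m) (h j) w (at 0)" if "j \<le> m" for j
    unfolding limitin_componentwise
  proof (intro conjI ballI)
    fix i assume "i \<in> {..<m}"
    then show "limitin T (\<lambda>t. h j t i) (w i) (at 0)"
      using wtj wT by (cases "i < j") (auto simp: h_def)
  qed (use w hmem[OF that] in \<open>auto simp: PiE_iff\<close>)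
  have h0: "h 0 t = w" for t by (simp add: h_def)
  have hm: "h m t = wt t" for t
    using w by (auto simp: h_def fun_eq_iff extensional_def PiE_iff)
  \<comment> \<open>The point \<open>y t\<close> is reached from \<open>x\<close> by a straight step
    of length \<open>t\<close> in the moving direction given by the difference quotient of
    \<open>y\<close>.\<close>
  have "limitin T' (\<lambda>t::real. (1 / t) *\<^sub>R (D m (x + t *\<^sub>R ((1 / t) *\<^sub>R (y t - x))) (h m t) - D m x (h m t)))
      (D (Suc m) x (w(m := x'))) (at 0)"
    by (rule higher_derivs_quotient_limit[OF x _ hlim y])
      (use xT tendsto_ident_at[of 0] eventually_neq_at_within[of 0] in auto)
  moreover have "\<forall>\<^sub>F t::real in at 0.
     (1 / t) *\<^sub>R (D m (x + t *\<^sub>R ((1 / t) *\<^sub>R (y t - x))) (h m t) - D m x (h m t)) =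
     (1 / t) *\<^sub>R (D m (y t) (wt t) - D m x (wt t))"
    using eventually_neq_at_within[of 0] by eventually_elim (simp add: hm)
  ultimately have lim1: "limitin T' (\<lambda>t::real. (1 / t) *\<^sub>R (D m (y t) (wt t) - D m x (wt t)))
      (D (Suc m) x (w(m := x'))) (at 0)" by (rule limitin_transform_eventually[rotated])
  have "limitin T' (\<lambda>t. \<Sum>j<m. D m x ((h j t)(j := (1 / t) *\<^sub>R (wt t j - w j))))
      (\<Sum>j<m. D m x (w(j := w' j))) (at 0)"
    by (intro limitin_sum[OF T'] higher_derivs_limit[OF x] families_limitin_upd hlim w') (use xT in auto)
  moreover have "\<forall>\<^sub>F t in at 0. (\<Sum>j<m. D m x ((h j t)(j := (1 / t) *\<^sub>R (wt t j - w j)))) =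
     (1 / t) *\<^sub>R (D m x (wt t) - D m x w)"
  proof -
    have "\<forall>\<^sub>F t in at 0. \<forall>j\<in>{..<m}. h j t \<in> topspace (families T m)"
      by (intro eventually_ball_finite) (use hmem in auto)
    with ev eventually_neq_at_within[of 0] show ?thesis
    proof eventually_elim
      case (elim t)
      \<comment> \<open>Passing from \<open>h j\<close> to \<open>h (Suc j)\<close> changes one slot
        only, so linearity gives the increment exactly, with no remainder.\<close>
      have "t *\<^sub>R D m x ((h j t)(j := (1 / t) *\<^sub>R (wt t j - w j))) = D m x (h (Suc j) t) - D m x (h j t)"
        if j: "j < m" for j
      proof -
        have "(1 / t) *\<^sub>R (wt t j - w j) \<in> topspace T"
          using elim j wT by (intro frechet_space_mem[OF T]) auto
        moreover have "w j + t *\<^sub>R ((1 / t) *\<^sub>R (wt t j - w j)) = wt t j" using elim by simp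
        ultimately have "D m x ((h j t)(j := wt t j)) =
            D m x ((h j t)(j := w j)) + t *\<^sub>R D m x ((h j t)(j := (1 / t) *\<^sub>R (wt t j - w j)))"
          using higher_derivs_linear[OF x, of "h j t" m j "w j" "(1 / t) *\<^sub>R (wt t j - w j)" t] elim j wT[OF j]
          by auto
        moreover have "(h j t)(j := wt t j) = h (Suc j) t" "(h j t)(j := w j) = h j t"
          by (auto simp: h_def fun_eq_iff less_Suc_eq)
        ultimately show ?thesis by (simp add: algebra_simps)
      qed
      then have "t *\<^sub>R (\<Sum>j<m. D m x ((h j t)(j := (1 / t) *\<^sub>R (wt t j - w j)))) =
          (\<Sum>j<m. D m x (h (Suc j) t) - D m x (h j t))"
        by (simp add: scaleR_sum_right)
      also have "\<dots> = D m x (wt t) - D m x w" using sum_lessThan_telescope[of "\<lambda>j. D m x (h j t)" m] by (simp only: h0 hm)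
      finally have eq: "t *\<^sub>R (\<Sum>j<m. D m x ((h j t)(j := (1 / t) *\<^sub>R (wt t j - w j)))) = D m x (wt t) - D m x w" .
      show ?case using elim by (simp add: eq[symmetric] del: scaleR_diff_right)
    qed
  qed
  ultimately have lim2: "limitin T' (\<lambda>t. (1 / t) *\<^sub>R (D m x (wt t) - D m x w))
      (\<Sum>j<m. D m x (w(j := w' j))) (at 0)" by (rule limitin_transform_eventually[rotated])
  from limitin_add[OF T' lim1 lim2] show ?thesis by (simp add: algebra_simps)
qed

end

section \<open>The chain rule at all orders\<close>

text \<open>The terms of the iterated chain rule: the list \<open>[I\<^sub>1, \<dots>, I\<^sub>m]\<close> of lists of indices encodes
  \<open>D\<^sup>m f (g x) (D\<^bsup>|I\<^sub>1|\<^esup> g x (v\<^bsub>I\<^sub>1\<^esub>), \<dots>, D\<^bsup>|I\<^sub>m|\<^esup> g x (v\<^bsub>I\<^sub>m\<^esub>))\<close>.\<close>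

primrec chain_terms :: "nat \<Rightarrow> nat list list list" where
  "chain_terms 0 = [[]]"
| "chain_terms (Suc k) =
     concat (map (\<lambda>t. (t @ [[k]]) # map (\<lambda>j. t[j := t ! j @ [k]]) [0..<length t]) (chain_terms k))"

lemma chain_terms_index: "t \<in> set (chain_terms k) \<Longrightarrow> I \<in> set t \<Longrightarrow> i \<in> set I \<Longrightarrow> i < k"
proof (induction k arbitrary: t I i)
  case (Suc k)
  then obtain t' where t': "t' \<in> set (chain_terms k)"
    and t: "t = t' @ [[k]] \<or> (\<exists>j<length t'. t = t'[j := t' ! j @ [k]])" by fastforce
  from t show ?case
  proof (elim disjE exE conjE)
    assume "t = t' @ [[k]]"
    then show ?thesis using Suc.prems Suc.IH[OF t'] by (auto intro: less_SucI)
  next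
    fix j assume j: "j < length t'" "t = t'[j := t' ! j @ [k]]"
    have "I \<in> set t' \<or> I = t' ! j @ [k]"
      using Suc.prems(2) j set_update_subset_insert[of t' j "t' ! j @ [k]"] by auto
    then show ?thesis
      using Suc.prems(3) Suc.IH[OF t'] Suc.IH[OF t' nth_mem[OF j(1)]] by (auto simp: less_Suc_eq)
  qed
qed simp

text \<open>For the empty list this is the value \<open>g x\<close> of the inner map. So the base
  point of a term can be treated like its other arguments: differentiating any of them appends an
  index to its list.\<close>

definition chain_arg :: "(nat \<Rightarrow> 'v \<Rightarrow> (nat \<Rightarrow> 'v) \<Rightarrow> 'w) \<Rightarrow> 'v \<Rightarrow> (nat \<Rightarrow> 'v) \<Rightarrow> nat list \<Rightarrow> 'w" where
  "chain_arg D x v I = D (length I) x (\<lambda>i\<in>{..<length I}. v (I ! i))"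

definition chain_val :: "(nat \<Rightarrow> 'w \<Rightarrow> (nat \<Rightarrow> 'w) \<Rightarrow> 'u) \<Rightarrow> (nat \<Rightarrow> 'v \<Rightarrow> (nat \<Rightarrow> 'v) \<Rightarrow> 'w)
    \<Rightarrow> 'v \<Rightarrow> (nat \<Rightarrow> 'v) \<Rightarrow> nat list list \<Rightarrow> 'u" where
  "chain_val Df Dg x v t =
     Df (length t) (chain_arg Dg x v []) (\<lambda>j\<in>{..<length t}. chain_arg Dg x v (t ! j))"

lemma chain_arg_restrict:
  assumes "\<And>i. i \<in> set I \<Longrightarrow> i < k"
  shows "chain_arg D x (restrict v {..<k}) I = chain_arg D x v I"
  unfolding chain_arg_def using assms by (intro arg_cong[of _ _ "D (length I) x"]) (auto simp: restrict_def fun_eq_iff)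

lemma chain_val_restrict:
  assumes "\<And>I i. I \<in> set t \<Longrightarrow> i \<in> set I \<Longrightarrow> i < k"
  shows "chain_val Df Dg x (restrict v {..<k}) t = chain_val Df Dg x v t"
proof -
  have "(\<lambda>j\<in>{..<length t}. chain_arg Dg x (restrict v {..<k}) (t ! j)) =
    (\<lambda>j\<in>{..<length t}. chain_arg Dg x v (t ! j))"
    using assms[OF nth_mem] by (intro restrict_ext chain_arg_restrict) auto
  moreover have "chain_arg Dg x (restrict v {..<k}) [] = chain_arg Dg x v []"
    by (rule chain_arg_restrict) simp
  ultimately show ?thesis by (simp add: chain_val_def)
qed

lemma scaleR_sum_list: "r *\<^sub>R (\<Sum>x\<leftarrow>L. f x) = (\<Sum>x\<leftarrow>L. r *\<^sub>R f x)" for f :: "'a \<Rightarrow> 'v::real_vector"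
  by (induction L) (auto simp: scaleR_add_right)

lemma limitin_sum_list:
  assumes T: "frechet_space T" and "\<And>j. j \<in> set J \<Longrightarrow> limitin T (\<lambda>i. f i j) (l j) \<F>"
  shows "limitin T (\<lambda>i. \<Sum>j\<leftarrow>J. f i j) (\<Sum>j\<leftarrow>J. l j) \<F>"
  using assms(2) by (induction J) (auto intro: limitin_add[OF T] simp: frechet_space_mem(1)[OF T])

lemma continuous_map_sum_list:
  assumes T: "frechet_space T" and "\<And>j. j \<in> set J \<Longrightarrow> continuous_map X T (\<lambda>x. f x j)"
  shows "continuous_map X T (\<lambda>x. \<Sum>j\<leftarrow>J. f x j)"
  using assms(2) by (induction J) (auto intro: continuous_map_frechet_add[OF T] simp: frechet_space_mem(1)[OF T])

text \<open>The shape matches the limit in \<open>higher_derivs_curve\<close>: the new block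
  \<open>[k]\<close> comes from moving the base point, and each extended block from moving one
  argument.\<close>

lemma sum_list_chain_terms_Suc:
  fixes F :: "nat list list \<Rightarrow> 'w::real_vector"
  shows "(\<Sum>t\<leftarrow>chain_terms (Suc k). F t) =
    (\<Sum>t\<leftarrow>chain_terms k. F (t @ [[k]]) + (\<Sum>j<length t. F (t[j := t ! j @ [k]])))"
proof -
  have "(\<Sum>t\<leftarrow>concat (map (\<lambda>t. (t @ [[k]]) # map (\<lambda>j. t[j := t ! j @ [k]]) [0..<length t]) L). F t) =
    (\<Sum>t\<leftarrow>L. F (t @ [[k]]) + (\<Sum>j<length t. F (t[j := t ! j @ [k]])))" for L
  proof (induction L)
    case (Cons t L)
    have "(\<Sum>j\<leftarrow>[0..<length t]. F (t[j := t ! j @ [k]])) = (\<Sum>j<length t. F (t[j := t ! j @ [k]]))"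
      by (simp add: interv_sum_list_conv_sum_set_nat atLeast0LessThan)
    then show ?case using Cons by (simp add: o_def)
  qed simp
  then show ?thesis by simp
qed

context
  fixes T :: "'v::real_vector topology" and T' :: "'w::real_vector topology" and U g Dg
  assumes T: "frechet_space T" and T': "frechet_space T'" and U: "openin T U"
    and Dg: "higher_derivs T U T' g Dg"
begin

lemma chain_arg_Nil: "x \<in> U \<Longrightarrow> chain_arg Dg x v [] = g x"
  using Dg by (simp add: chain_arg_def higher_derivs_def)

lemma continuous_map_chain_arg:
  assumes "\<And>i. i \<in> set I \<Longrightarrow> i < k"
  shows "continuous_map (prod_topology (subtopology T U) (families T k)) T'
    (\<lambda>(x, v). chain_arg Dg x v I)"
proof -
  have "continuous_map (prod_topology (subtopology T U) (families T (length I))) T' (\<lambda>(x, v). Dg (length I) x v)"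
    using Dg unfolding higher_derivs_def by blast
  moreover have "continuous_map (prod_topology (subtopology T U) (families T k))
      (prod_topology (subtopology T U) (families T (length I))) (\<lambda>z. (fst z, \<lambda>i\<in>{..<length I}. snd z (I ! i)))"
  proof (intro continuous_map_pairedI continuous_map_families continuous_map_fst)
    fix j assume "j < length I"
    then have "I ! j \<in> {..<k}" using assms by simp
    from continuous_map_compose[OF continuous_map_snd continuous_map_product_projection[OF this]]
    show "continuous_map (prod_topology (subtopology T U) (families T k)) T (\<lambda>z. snd z (I ! j))"
      by (simp add: o_def)
  qed
  ultimately have "continuous_map (prod_topology (subtopology T U) (families T k)) T'
      ((\<lambda>(x, v). Dg (length I) x v) \<circ> (\<lambda>z. (fst z, \<lambda>i\<in>{..<length I}. snd z (I ! i))))"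
    by (rule continuous_map_compose[rotated])
  then show ?thesis by (simp add: o_def case_prod_unfold chain_arg_def)
qed

lemma chain_arg_deriv:
  assumes x: "x \<in> U" and v: "v \<in> topspace (families T (Suc k))" and I: "\<And>i. i \<in> set I \<Longrightarrow> i < k"
  shows "limitin T' (\<lambda>t::real. (1 / t) *\<^sub>R (chain_arg Dg (x + t *\<^sub>R v k) v I - chain_arg Dg x v I))
    (chain_arg Dg x v (I @ [k])) (at 0)"
proof -
  have vT: "v i \<in> topspace T" if "i \<le> k" for i using v that by (auto simp: PiE_iff)
  have "I ! i \<le> k" if "i < length I" for i using I[OF nth_mem[OF that]] by simp
  then have w: "(\<lambda>i\<in>{..<length I}. v (I ! i)) \<in> topspace (families T (length I))"
    using vT by (auto simp: PiE_iff)
  have "(\<lambda>i\<in>{..<length I}. v (I ! i))(length I := v k) = (\<lambda>i\<in>{..<length (I @ [k])}. v ((I @ [k]) ! i))"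
    by (auto simp: fun_eq_iff nth_append)
  with higher_derivs_deriv[OF T T' U Dg x w vT[of k]] show ?thesis
    by (simp add: chain_arg_def)
qed

end

text \<open>Induction on the order is hidden in the recursion of \<open>chain_terms\<close>: each
  term is a derivative of \<open>f\<close> evaluated along a curve of base points and arguments, and
  the product rule \<open>higher_derivs_curve\<close> differentiates it into exactly its
  successors.\<close>

lemma higher_derivs_compose:
  fixes T :: "'v::real_vector topology" and T' :: "'w::real_vector topology" and T'' :: "'u::real_vector topology"
  assumes T: "frechet_space T" "frechet_space T'" "frechet_space T''"
    and U: "openin T U" "openin T' V" "g ` U \<subseteq> V"
    and Dg: "higher_derivs T U T' g Dg" and Df: "higher_derivs T' V T'' f Df"
  shows "higher_derivs T U T'' (f \<circ> g) (\<lambda>k x v. \<Sum>t\<leftarrow>chain_terms k. chain_val Df Dg x v t)"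
  unfolding higher_derivs_def
proof (intro conjI allI ballI)
  have gV: "chain_arg Dg x v [] \<in> V" if "x \<in> U" for x v
    using chain_arg_Nil[OF T(1,2) U(1) Dg that] U(3) that by auto
  fix x and v :: "nat \<Rightarrow> 'v" assume "x \<in> U"
  then show "(\<Sum>t\<leftarrow>chain_terms 0. chain_val Df Dg x v t) = (f \<circ> g) x"
    using Df chain_arg_Nil[OF T(1,2) U(1) Dg] U(3) by (auto simp: chain_val_def higher_derivs_def)
next
  fix k
  let ?X = "prod_topology (subtopology T U) (families T k)"
  have gV: "chain_arg Dg x v [] \<in> V" if "x \<in> U" for x v
    using chain_arg_Nil[OF T(1,2) U(1) Dg that] U(3) that by auto
  have "continuous_map ?X T'' (\<lambda>z. \<Sum>t\<leftarrow>chain_terms k. chain_val Df Dg (fst z) (snd z) t)"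
  proof (rule continuous_map_sum_list[OF T(3)])
    fix t assume t: "t \<in> set (chain_terms k)"
    have arg: "continuous_map ?X T' (\<lambda>z. chain_arg Dg (fst z) (snd z) I)" if "I = [] \<or> I \<in> set t" for I
      using continuous_map_chain_arg[OF T(1,2) U(1) Dg, of I k] chain_terms_index[OF t] that
      by (auto simp: case_prod_unfold)
    have "continuous_map (prod_topology (subtopology T' V) (families T' (length t))) T'' (\<lambda>(x, v). Df (length t) x v)"
      using Df unfolding higher_derivs_def by blast
    moreover have "continuous_map ?X (prod_topology (subtopology T' V) (families T' (length t)))
        (\<lambda>z. (chain_arg Dg (fst z) (snd z) [], \<lambda>j\<in>{..<length t}. chain_arg Dg (fst z) (snd z) (t ! j)))"
      using arg gV by (intro continuous_map_pairedI continuous_map_families continuous_map_into_subtopology) auto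
    ultimately have "continuous_map ?X T'' ((\<lambda>(x, v). Df (length t) x v) \<circ>
        (\<lambda>z. (chain_arg Dg (fst z) (snd z) [], \<lambda>j\<in>{..<length t}. chain_arg Dg (fst z) (snd z) (t ! j))))"
      by (rule continuous_map_compose[rotated])
    then show "continuous_map ?X T'' (\<lambda>z. chain_val Df Dg (fst z) (snd z) t)"
      by (simp add: o_def chain_val_def)
  qed
  then show "continuous_map ?X T'' (\<lambda>(x, v). \<Sum>t\<leftarrow>chain_terms k. chain_val Df Dg x v t)"
    by (simp add: case_prod_unfold)
next
  fix k x v assume x: "x \<in> U" and v: "v \<in> topspace (families T (Suc k))"
  have gV: "chain_arg Dg x v [] \<in> V" for v
    using chain_arg_Nil[OF T(1,2) U(1) Dg x] U(3) x by auto
  have "limitin T'' (\<lambda>s::real. \<Sum>t\<leftarrow>chain_terms k. (1 / s) *\<^sub>R (chain_val Df Dg (x + s *\<^sub>R v k) v t - chain_val Df Dg x v t))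
      (\<Sum>t\<leftarrow>chain_terms k. chain_val Df Dg x v (t @ [[k]]) +
        (\<Sum>j<length t. chain_val Df Dg x v (t[j := t ! j @ [k]]))) (at 0)"
  proof (rule limitin_sum_list[OF T(3)])
    fix t assume t: "t \<in> set (chain_terms k)"
    let ?w = "\<lambda>j\<in>{..<length t}. chain_arg Dg x v (t ! j)"
    have idx: "i < k" if "I = [] \<or> I \<in> set t" "i \<in> set I" for I i using chain_terms_index[OF t] that by auto
    have der: "limitin T' (\<lambda>s::real. (1 / s) *\<^sub>R (chain_arg Dg (x + s *\<^sub>R v k) v I - chain_arg Dg x v I))
        (chain_arg Dg x v (I @ [k])) (at 0)" if "I = [] \<or> I \<in> set t" for I
      using chain_arg_deriv[OF T(1,2) U(1) Dg x v] idx[OF that] by blast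
    have mem: "chain_arg Dg x v I \<in> topspace T'" if "I \<in> set t" for I
    proof -
      have "v (I ! i) \<in> topspace T" if "i < length I" for i
        using idx[of I "I ! i"] \<open>I \<in> set t\<close> nth_mem[OF that] v by (auto simp: PiE_iff)
      then show ?thesis unfolding chain_arg_def
        by (intro higher_derivs_mem[OF T(1,2) U(1) Dg x]) (auto simp: PiE_iff)
    qed
    \<comment> \<open>The base curve is the image of the line under \<open>g\<close>, written as the
      argument of the empty list; its velocity is therefore the argument of
      \<open>[] @ [k]\<close>.\<close>
    have "limitin T'' (\<lambda>s::real. (1 / s) *\<^sub>R
        (Df (length t) (chain_arg Dg (x + s *\<^sub>R v k) v []) (\<lambda>j\<in>{..<length t}. chain_arg Dg (x + s *\<^sub>R v k) v (t ! j))
         - Df (length t) (chain_arg Dg x v []) ?w))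
      (Df (Suc (length t)) (chain_arg Dg x v []) (?w(length t := chain_arg Dg x v ([] @ [k]))) +
        (\<Sum>j<length t. Df (length t) (chain_arg Dg x v []) (?w(j := chain_arg Dg x v (t ! j @ [k]))))) (at 0)"
    proof (rule higher_derivs_curve[OF T(2,3) U(2) Df gV der[OF disjI1[OF refl]]])
      show "?w \<in> topspace (families T' (length t))" using mem by (auto simp: PiE_iff)
      show "limitin T' (\<lambda>s::real. (1 / s) *\<^sub>R
        ((\<lambda>j\<in>{..<length t}. chain_arg Dg (x + s *\<^sub>R v k) v (t ! j)) j - ?w j))
        (chain_arg Dg x v (t ! j @ [k])) (at 0)" if "j < length t" for j
        using der[of "t ! j"] that by simp
    qed auto
    moreover have "?w(length t := chain_arg Dg x v ([] @ [k])) =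
        (\<lambda>j\<in>{..<length (t @ [[k]])}. chain_arg Dg x v ((t @ [[k]]) ! j))"
      by (auto simp: fun_eq_iff nth_append)
    moreover have "?w(j := chain_arg Dg x v (t ! j @ [k])) =
        (\<lambda>i\<in>{..<length (t[j := t ! j @ [k]])}. chain_arg Dg x v (t[j := t ! j @ [k]] ! i))" if "j < length t" for j
      using that by (auto simp: fun_eq_iff)
    ultimately show "limitin T'' (\<lambda>s::real. (1 / s) *\<^sub>R (chain_val Df Dg (x + s *\<^sub>R v k) v t - chain_val Df Dg x v t))
      (chain_val Df Dg x v (t @ [[k]]) + (\<Sum>j<length t. chain_val Df Dg x v (t[j := t ! j @ [k]]))) (at 0)"
      by (simp add: chain_val_def)
  qed
  \<comment> \<open>The quotient required by \<open>higher_derivs\<close> sees only the first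
    \<open>k\<close> directions, and no index occurring at order \<open>k\<close> is larger.\<close>
  moreover have restr: "(\<Sum>t\<leftarrow>chain_terms k. chain_val Df Dg y (restrict v {..<k}) t) =
      (\<Sum>t\<leftarrow>chain_terms k. chain_val Df Dg y v t)" for y
    using chain_terms_index by (intro arg_cong[of _ _ sum_list] map_cong chain_val_restrict) auto
  ultimately show "limitin T'' (\<lambda>s::real. (1 / s) *\<^sub>R
      ((\<Sum>t\<leftarrow>chain_terms k. chain_val Df Dg (x + s *\<^sub>R v k) (restrict v {..<k}) t) -
       (\<Sum>t\<leftarrow>chain_terms k. chain_val Df Dg x (restrict v {..<k}) t)))
      (\<Sum>t\<leftarrow>chain_terms (Suc k). chain_val Df Dg x v t) (at 0)"
    unfolding sum_list_chain_terms_Suc restr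
    by (simp add: sum_list_subtractf[symmetric] scaleR_sum_list)
qed

lemma frechet_smooth_compose:
  assumes "frechet_space T" "frechet_space T'" "frechet_space T''"
    "frechet_smooth T U T' g" "frechet_smooth T' V T'' f" "g ` U \<subseteq> V"
  shows "frechet_smooth T U T'' (f \<circ> g)"
  using assms higher_derivs_compose[OF assms(1-3)] unfolding frechet_smooth_iff by metis

section \<open>Restriction, continuity and gluing of smooth maps\<close>

lemma frechet_smooth_openin: "frechet_smooth T U T' f \<Longrightarrow> openin T U"
  by (simp add: frechet_smooth_iff)

lemma frechet_smooth_cong:
  assumes "frechet_smooth T U T' f" "\<And>x. x \<in> U \<Longrightarrow> f x = g x"
  shows "frechet_smooth T U T' g"
  using assms unfolding frechet_smooth_iff higher_derivs_def by auto

lemma frechet_smooth_subset: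
  assumes "frechet_smooth T U T' f" "openin T V" "V \<subseteq> U"
  shows "frechet_smooth T V T' f"
proof -
  obtain D where D: "higher_derivs T U T' f D" using assms(1) unfolding frechet_smooth_iff by blast
  have "subtopology T V = subtopology (subtopology T U) V"
    using assms(3) by (simp add: subtopology_subtopology Int_absorb1)
  then have "continuous_map (prod_topology (subtopology T V) (families T k)) T' (\<lambda>(x, v). D k x v)" for k
    using D unfolding higher_derivs_def
    by (simp only: prod_topology_subtopology(1)[of "subtopology T U" V])
      (blast intro: continuous_map_from_subtopology)
  then have "higher_derivs T V T' f D"
    using D assms(3) unfolding higher_derivs_def by blast
  then show ?thesis using assms(2) by (rule frechet_smoothI[rotated])
qed

lemma frechet_smooth_continuous_map:
  assumes "frechet_smooth T U T' f"
  shows "continuous_map (subtopology T U) T' f"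
proof -
  obtain D where D: "higher_derivs T U T' f D" using assms unfolding frechet_smooth_iff by blast
  \<comment> \<open>The only point of \<open>families T 0\<close>, at which the derivative of order
    0 is evaluated.\<close>
  let ?e = "\<lambda>j\<in>{..<0::nat}. undefined"
  have "continuous_map (prod_topology (subtopology T U) (families T 0)) T' (\<lambda>(x, v). D 0 x v)"
    using D unfolding higher_derivs_def by blast
  moreover have "continuous_map (subtopology T U) (prod_topology (subtopology T U) (families T 0))
      (\<lambda>x. (x, ?e))"
    by (intro continuous_map_pairedI continuous_map_families continuous_map_id[unfolded id_def]) simp
  ultimately have "continuous_map (subtopology T U) T' ((\<lambda>(x, v). D 0 x v) \<circ> (\<lambda>x. (x, ?e)))"
    by (rule continuous_map_compose[rotated])
  then show ?thesis
    by (rule continuous_map_eq) (use D in \<open>auto simp: higher_derivs_def\<close>)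
qed

lemma frechet_smooth_openin_preimage:
  assumes "frechet_smooth T U T' f" "openin T' V"
  shows "openin T {x \<in> U. f x \<in> V}"
proof -
  have U: "openin T U" using assms(1) by (rule frechet_smooth_openin)
  have "openin (subtopology T U) {x \<in> topspace (subtopology T U). f x \<in> V}"
    using frechet_smooth_continuous_map[OF assms(1)] assms(2) by (rule openin_continuous_map_preimage)
  moreover have "{x \<in> topspace (subtopology T U). f x \<in> V} = {x \<in> U. f x \<in> V}"
    using openin_subset[OF U] by auto
  ultimately show ?thesis using openin_trans_full U by metis
qed

text \<open>A choice of the higher derivatives that does not depend on the domain, so that local ones can be glued.\<close>

primrec iterated_deriv :: "'w::real_vector topology \<Rightarrow> ('v::real_vector \<Rightarrow> 'w) \<Rightarrow> nat \<Rightarrow> 'v \<Rightarrow> (nat \<Rightarrow> 'v) \<Rightarrow> 'w" where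
  "iterated_deriv T' f 0 x v = f x"
| "iterated_deriv T' f (Suc k) x v = (THE l. limitin T' (\<lambda>t::real. (1 / t) *\<^sub>R
     (iterated_deriv T' f k (x + t *\<^sub>R v k) (restrict v {..<k}) - iterated_deriv T' f k x (restrict v {..<k}))) l (at 0))"

text \<open>The quotient at the next order involves the previous order only at points near
  \<open>x\<close>, hence inside the open set \<open>U\<close>, where both candidates already agree;
  limits are unique.\<close>

lemma higher_derivs_unique:
  assumes T: "frechet_space T" "frechet_space T'" and U: "openin T U" and D: "higher_derivs T U T' f D"
    and "x \<in> U" "v \<in> topspace (families T k)"
  shows "iterated_deriv T' f k x v = D k x v"
  using assms(5,6)
proof (induction k arbitrary: x v)
  case 0
  then show ?case using D by (simp add: higher_derivs_def)
next
  case (Suc k)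
  let ?v = "restrict v {..<k}"
  have v: "?v \<in> topspace (families T k)" using Suc.prems(2) by (rule families_restrict)
  have vk: "v k \<in> topspace T" using Suc.prems(2) by (auto simp: PiE_iff)
  have "limitin T' (\<lambda>t::real. (1 / t) *\<^sub>R (D k (x + t *\<^sub>R v k) ?v - D k x ?v)) (D (Suc k) x v) (at 0)"
    using D Suc.prems unfolding higher_derivs_def by blast
  moreover have "\<forall>\<^sub>F t::real in at 0. (1 / t) *\<^sub>R (D k (x + t *\<^sub>R v k) ?v - D k x ?v) =
     (1 / t) *\<^sub>R (iterated_deriv T' f k (x + t *\<^sub>R v k) ?v - iterated_deriv T' f k x ?v)"
    using higher_derivs_eventually[OF T U D Suc.prems(1) vk]
    by eventually_elim (simp only: Suc.IH[OF _ v] Suc.prems(1))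
  ultimately have lim: "limitin T' (\<lambda>t::real. (1 / t) *\<^sub>R (iterated_deriv T' f k (x + t *\<^sub>R v k) ?v - iterated_deriv T' f k x ?v))
      (D (Suc k) x v) (at 0)" by (rule limitin_transform_eventually[rotated])
  show ?case unfolding iterated_deriv.simps
    by (rule the_equality, rule lim)
      (rule limitin_Hausdorff_unique[OF _ lim at_neq_bot frechet_space_Hausdorff[OF T(2)]])
qed

text \<open>The derivatives on the neighbourhoods are chosen independently of each other. Replacing
  all of them by \<open>iterated_deriv\<close> gives one system that agrees with each on its own
  domain, so continuity can be pasted and limits can be read off locally.\<close>

lemma frechet_smooth_local:
  assumes T: "frechet_space T" "frechet_space T'"
    and loc: "\<And>x. x \<in> U \<Longrightarrow> \<exists>V. x \<in> V \<and> V \<subseteq> U \<and> frechet_smooth T V T' f"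
  shows "frechet_smooth T U T' f"
proof -
  obtain V where V: "\<And>x. x \<in> U \<Longrightarrow> x \<in> V x \<and> V x \<subseteq> U \<and> frechet_smooth T (V x) T' f"
    using loc by metis
  then obtain D where D: "\<And>x. x \<in> U \<Longrightarrow> higher_derivs T (V x) T' f (D x)"
    unfolding frechet_smooth_iff by metis
  have Vo: "openin T (V x)" if "x \<in> U" for x using V[OF that] frechet_smooth_openin by blast
  have U: "openin T U" using V Vo by (subst openin_subopen) blast
  let ?D = "iterated_deriv T' f"
  note uniq = higher_derivs_unique[OF T Vo D]
  have "higher_derivs T U T' f ?D"
    unfolding higher_derivs_def
  proof (intro conjI allI ballI)
    fix k
    let ?X = "prod_topology (subtopology T U) (families T k)"
    show "continuous_map ?X T' (\<lambda>(x, v). ?D k x v)"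
    proof (rule pasting_lemma[where I = U and T = "\<lambda>x. V x \<times> topspace (families T k)" and f = "\<lambda>x (y, v). ?D k y v"])
      fix x assume x: "x \<in> U"
      have "openin (subtopology T U) (V x)"
        using V[OF x] Vo[OF x] U by (simp add: openin_open_subtopology)
      then show "openin ?X (V x \<times> topspace (families T k))"
        by (simp add: openin_prod_Times_iff del: topspace_product_topology)
      have sub: "subtopology (subtopology T U) (V x) = subtopology T (V x)"
        using V[OF x] by (simp add: subtopology_subtopology Int_absorb1)
      have "continuous_map (prod_topology (subtopology T (V x)) (families T k)) T' (\<lambda>(y, v). D x k y v)"
        using D[OF x] unfolding higher_derivs_def by blast
      then have "continuous_map (prod_topology (subtopology T (V x)) (families T k)) T' (\<lambda>(y, v). ?D k y v)"
        by (rule continuous_map_eq) (use uniq[OF x x] in auto)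
      then show "continuous_map (subtopology ?X (V x \<times> topspace (families T k))) T' (\<lambda>(y, v). ?D k y v)"
        by (simp only: prod_topology_subtopology(1)[of "subtopology T U" "V x", symmetric] sub)
    next
      fix z assume "z \<in> topspace ?X"
      then show "\<exists>j. j \<in> U \<and> z \<in> V j \<times> topspace (families T k) \<and> (case z of (x, v) \<Rightarrow> ?D k x v) = (case z of (y, v) \<Rightarrow> ?D k y v)"
        using V by (intro exI[of _ "fst z"]) auto
    qed auto
  next
    fix k x v assume x: "x \<in> U" and v: "v \<in> topspace (families T (Suc k))"
    let ?v = "restrict v {..<k}"
    have v': "?v \<in> topspace (families T k)" using v by (rule families_restrict)
    have vk: "v k \<in> topspace T" using v by (auto simp: PiE_iff)
    have xV: "x \<in> V x" using V[OF x] by blast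
    have "limitin T' (\<lambda>t::real. (1 / t) *\<^sub>R (D x k (x + t *\<^sub>R v k) ?v - D x k x ?v)) (D x (Suc k) x v) (at 0)"
      using D[OF x] xV v unfolding higher_derivs_def by blast
    moreover have "\<forall>\<^sub>F t::real in at 0. (1 / t) *\<^sub>R (D x k (x + t *\<^sub>R v k) ?v - D x k x ?v) =
       (1 / t) *\<^sub>R (?D k (x + t *\<^sub>R v k) ?v - ?D k x ?v)"
      using higher_derivs_eventually[OF T Vo[OF x] D[OF x] xV vk]
      by eventually_elim (simp only: uniq[OF x x _ v'] xV)
    ultimately show "limitin T' (\<lambda>t::real. (1 / t) *\<^sub>R (?D k (x + t *\<^sub>R v k) ?v - ?D k x ?v)) (?D (Suc k) x v) (at 0)"
      unfolding uniq[OF x x xV v] by (rule limitin_transform_eventually[rotated])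
  qed simp
  with U show ?thesis by (rule frechet_smoothI)
qed

section \<open>Smooth maps into products and closed subspaces\<close>

lemma frechet_smooth_Pair:
  assumes "frechet_smooth T U T1 f" "frechet_smooth T U T2 g"
  shows "frechet_smooth T U (prod_topology T1 T2) (\<lambda>x. (f x, g x))"
proof -
  obtain D E where D: "higher_derivs T U T1 f D" and E: "higher_derivs T U T2 g E"
    using assms unfolding frechet_smooth_iff by blast
  have "higher_derivs T U (prod_topology T1 T2) (\<lambda>x. (f x, g x)) (\<lambda>k x v. (D k x v, E k x v))"
    using D E unfolding higher_derivs_def
    by (auto simp: limitin_pairwise o_def case_prod_unfold continuous_map_paired
        simp del: topspace_product_topology)
  then show ?thesis using assms(1) by (simp add: frechet_smooth_iff) blast
qed

text \<open>All derivatives stay in \<open>F\<close>: difference quotients of values in a linear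
  subspace remain there, and closedness keeps their limits. Then the limits in the big space are
  limits in the subspace.\<close>

lemma frechet_smooth_into_subspace:
  assumes T: "frechet_space T" "frechet_space T'" and f: "frechet_smooth T U T' f"
    and F: "subspace F" "closedin T' F" "f ` U \<subseteq> F"
  shows "frechet_smooth T U (subtopology T' F) f"
proof -
  obtain D where D: "higher_derivs T U T' f D" and U: "openin T U"
    using f unfolding frechet_smooth_iff by blast
  have quot: "\<forall>\<^sub>F t::real in at 0. (1 / t) *\<^sub>R (D k (x + t *\<^sub>R v k) (restrict v {..<k}) - D k x (restrict v {..<k})) \<in> F"
    if IH: "\<And>x v. x \<in> U \<Longrightarrow> v \<in> topspace (families T k) \<Longrightarrow> D k x v \<in> F"
      and xv: "x \<in> U" "v \<in> topspace (families T (Suc k))" for k x v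
  proof -
    have v: "restrict v {..<k} \<in> topspace (families T k)" using xv(2) by (rule families_restrict)
    have vk: "v k \<in> topspace T" using xv(2) by (auto simp: PiE_iff)
    show ?thesis
      using higher_derivs_eventually[OF T U D xv(1) vk]
      by eventually_elim (intro subspace_scale subspace_diff F(1) IH v xv(1))
  qed
  have lim: "limitin T' (\<lambda>t::real. (1 / t) *\<^sub>R (D k (x + t *\<^sub>R v k) (restrict v {..<k}) - D k x (restrict v {..<k})))
      (D (Suc k) x v) (at 0)" if "x \<in> U" "v \<in> topspace (families T (Suc k))" for k x v
    using D that unfolding higher_derivs_def by blast
  have DF: "D k x v \<in> F" if "x \<in> U" "v \<in> topspace (families T k)" for k x v
    using that
  proof (induction k arbitrary: x v)
    case 0
    then show ?case using D F(3) by (auto simp: higher_derivs_def)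
  next
    case (Suc k)
    show ?case
      by (rule limitin_closedin[OF lim[OF Suc.prems] F(2) quot[OF Suc.IH Suc.prems]]) auto
  qed
  have "higher_derivs T U (subtopology T' F) f D"
    unfolding higher_derivs_def
  proof (intro conjI allI ballI)
    fix x and v :: "nat \<Rightarrow> 'a" assume "x \<in> U" then show "D 0 x v = f x" using D by (simp add: higher_derivs_def)
  next
    fix k
    show "continuous_map (prod_topology (subtopology T U) (families T k)) (subtopology T' F) (\<lambda>(x, v). D k x v)"
      using D DF unfolding higher_derivs_def
      by (intro continuous_map_into_subtopology) (auto simp del: topspace_product_topology)
  next
    fix k x v assume "x \<in> U" "v \<in> topspace (families T (Suc k))"
    then show "limitin (subtopology T' F)
        (\<lambda>t::real. (1 / t) *\<^sub>R (D k (x + t *\<^sub>R v k) (restrict v {..<k}) - D k x (restrict v {..<k})))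
        (D (Suc k) x v) (at 0)"
      unfolding limitin_subtopology using lim DF quot[OF DF] by blast
  qed
  with U show ?thesis by (rule frechet_smoothI)
qed

section \<open>Continuous linear maps\<close>

lemma linear_between_add_scale:
  assumes "linear_between T T' L" "x \<in> topspace T" "y \<in> topspace T"
  shows "L (x + c *\<^sub>R y) = L x + c *\<^sub>R L y"
proof -
  have "L (1 *\<^sub>R x + c *\<^sub>R y) = 1 *\<^sub>R L x + c *\<^sub>R L y"
    using assms unfolding linear_between_def by blast
  then show ?thesis by simp
qed

lemma linear_between_mem: "linear_between T T' L \<Longrightarrow> x \<in> topspace T \<Longrightarrow> L x \<in> topspace T'"
  unfolding linear_between_def using continuous_map_image_subset_topspace by blast

lemma frechet_smooth_linear:
  assumes T: "frechet_space T" "frechet_space T'" and L: "linear_between T T' L" and U: "openin T U"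
  shows "frechet_smooth T U T' L"
proof -
  define D where "D k x v = (if k = 0 then L x else if k = 1 then L (v 0) else 0)"
    for k :: nat and x and v :: "nat \<Rightarrow> 'a"
  have contL: "continuous_map T T' L" using L by (simp add: linear_between_def)
  have UT: "x \<in> topspace T" if "x \<in> U" for x using that openin_subset[OF U] by blast
  have "higher_derivs T U T' L D"
    unfolding higher_derivs_def
  proof (intro conjI allI ballI)
    fix k
    let ?X = "prod_topology (subtopology T U) (families T k)"
    consider "k = 0" | "k = 1" | "k > 1" by linarith
    then show "continuous_map ?X T' (\<lambda>(x, v). D k x v)"
    proof cases
      case 1
      have "continuous_map ?X T' (L \<circ> fst)"
        by (rule continuous_map_compose[OF continuous_map_fst continuous_map_from_subtopology[OF contL]])
      then show ?thesis using 1 by (simp add: D_def o_def case_prod_unfold)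
    next
      case 2
      have "continuous_map ?X T' (L \<circ> ((\<lambda>v. v 0) \<circ> snd))"
        using 2 by (intro continuous_map_compose[OF _ contL] continuous_map_compose[OF continuous_map_snd]
            continuous_map_product_projection) simp
      then show ?thesis using 2 by (simp add: D_def o_def case_prod_unfold)
    next
      case 3
      then show ?thesis by (simp add: D_def case_prod_unfold frechet_space_mem(1)[OF T(2)])
    qed
  next
    fix k x v assume x: "x \<in> U" and v: "v \<in> topspace (families T (Suc k))"
    show "limitin T' (\<lambda>t::real. (1 / t) *\<^sub>R (D k (x + t *\<^sub>R v k) (restrict v {..<k}) - D k x (restrict v {..<k})))
        (D (Suc k) x v) (at 0)"
    proof (cases "k = 0")
      case True
      have v0: "v 0 \<in> topspace T" using v by (auto simp: PiE_iff)
      have "\<forall>\<^sub>F t::real in at 0. (1 / t) *\<^sub>R (L (x + t *\<^sub>R v 0) - L x) = L (v 0)"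
        using eventually_neq_at_within[of 0]
        by eventually_elim (simp add: linear_between_add_scale[OF L UT[OF x] v0])
      then show ?thesis using True linear_between_mem[OF L v0]
        by (intro limitin_eventually) (auto simp: D_def)
    next
      case False
      then show ?thesis by (auto simp: D_def frechet_space_mem(1)[OF T(2)])
    qed
  qed (simp add: D_def)
  with U show ?thesis by (rule frechet_smoothI)
qed

lemma linear_between_id: "linear_between T T (\<lambda>x. x)"
  using continuous_map_id[of T] by (simp add: linear_between_def id_def)

lemma linear_between_subspace: "linear_between (subtopology T F) T (\<lambda>x. x)"
  using continuous_map_from_subtopology[OF continuous_map_id, of T F]
  by (simp add: linear_between_def id_def)

lemma linear_between_fst: "linear_between (prod_topology T T') T fst"
  and linear_between_snd: "linear_between (prod_topology T T') T' snd"
  by (simp_all add: linear_between_def continuous_map_fst continuous_map_snd)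

text \<open>A linear section of the second projection, which is the model of the right inverse
  demanded by \<open>submersion\<close>.\<close>

lemma linear_between_zero_Pair:
  assumes "frechet_space T"
  shows "linear_between T' (prod_topology T T') (\<lambda>z. (0, z))"
  using frechet_space_mem(1)[OF assms] continuous_map_id[of T']
  by (simp add: linear_between_def continuous_map_paired id_def)

lemma linear_between_compose:
  assumes "linear_between T T' L" "linear_between T' T'' L'"
  shows "linear_between T T'' (L' \<circ> L)"
  using assms linear_between_mem[OF assms(1)] unfolding linear_between_def
  by (auto intro: continuous_map_compose)

lemma frechet_smooth_from_subspace:
  assumes T: "frechet_space T" "frechet_space T'" and F: "closedin T F" "subspace F"
    and f: "frechet_smooth T U T' f"
  shows "frechet_smooth (subtopology T F) (U \<inter> F) T' f"
proof -
  have TF: "frechet_space (subtopology T F)" using T(1) F by (rule frechet_space_subtopology)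
  have "openin (subtopology T F) (U \<inter> F)"
    using frechet_smooth_openin[OF f] by (auto simp: openin_subtopology)
  from frechet_smooth_compose[OF TF T frechet_smooth_linear[OF TF T(1) linear_between_subspace this] f]
  show ?thesis by (simp add: o_def)
qed

section \<open>Derivatives of smooth bijections\<close>

text \<open>\<open>(\<lambda>_. undefined)(0 := v)\<close> is the family with the single direction
  \<open>v\<close>. The identity for \<open>a + c *\<^sub>R b\<close> gives a full linear
  combination once the value at 0 is known to vanish, which is its case \<open>a = b = 0\<close>,
  \<open>c = -1\<close>.\<close>

lemma higher_derivs_linear_between:
  assumes T: "frechet_space T" "frechet_space T'" and U: "openin T U" and D: "higher_derivs T U T' f D"
    and x: "x \<in> U"
  shows "linear_between T T' (\<lambda>v. D (Suc 0) x ((\<lambda>_. undefined)(0 := v)))"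
proof -
  have e: "(\<lambda>_. undefined) \<in> topspace (families T 0)" by simp
  define A where "A v = D (Suc 0) x ((\<lambda>_. undefined)(0 := v))" for v
  have lin: "A (a + c *\<^sub>R b) = A a + c *\<^sub>R A b" if "a \<in> topspace T" "b \<in> topspace T" for a b c
    using higher_derivs_linear[OF T U D x families_fun_upd(2)[OF e that(1)] _ that, of 0 c]
    by (simp add: A_def)
  have zero: "A 0 = 0"
    using lin[OF frechet_space_mem(1)[OF T(1)] frechet_space_mem(1)[OF T(1)], of "-1"] by simp
  have "A (a *\<^sub>R y + b *\<^sub>R z) = a *\<^sub>R A y + b *\<^sub>R A z" if "y \<in> topspace T" "z \<in> topspace T" for a b y z
    using lin[OF frechet_space_mem(4)[OF T(1) that(1), of a] that(2), of b]
      lin[OF frechet_space_mem(1)[OF T(1)] that(1), of a] zero by simp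
  moreover have "continuous_map T T' A"
  proof -
    have "continuous_map (prod_topology (subtopology T U) (families T (Suc 0))) T' (\<lambda>(x, v). D (Suc 0) x v)"
      using D unfolding higher_derivs_def by blast
    moreover have "continuous_map T (prod_topology (subtopology T U) (families T (Suc 0)))
        (\<lambda>v. (x, (\<lambda>_. undefined)(0 := v)))"
      using x openin_subset[OF U] e
      by (intro continuous_map_pairedI continuous_map_families_upd continuous_map_id[unfolded id_def]) auto
    ultimately have "continuous_map T T' ((\<lambda>(x, v). D (Suc 0) x v) \<circ> (\<lambda>v. (x, (\<lambda>_. undefined)(0 := v))))"
      by (rule continuous_map_compose[rotated])
    then show ?thesis by (simp add: o_def A_def[abs_def])
  qed
  ultimately show ?thesis unfolding linear_between_def A_def by blast
qed

text \<open>The first-order chain rule for \<open>g \<circ> f\<close>: the quotient of this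
  composition along the line through \<open>x\<close> in direction \<open>v\<close> is constantly
  \<open>v\<close>, and it also converges to the composed derivatives.\<close>

lemma higher_derivs_left_inverse:
  assumes T: "frechet_space T" "frechet_space T'" and U: "openin T U" "openin T' V"
    and D: "higher_derivs T U T' f D" "higher_derivs T' V T g E"
    and inv: "f ` U \<subseteq> V" "\<And>x. x \<in> U \<Longrightarrow> g (f x) = x" and x: "x \<in> U" and v: "v \<in> topspace T"
  shows "E (Suc 0) (f x) ((\<lambda>_. undefined)(0 := D (Suc 0) x ((\<lambda>_. undefined)(0 := v)))) = v"
proof -
  let ?e = "\<lambda>_::nat. undefined"
  have ev: "\<forall>\<^sub>F t::real in at 0. x + t *\<^sub>R v \<in> U" using higher_derivs_eventually[OF T U(1) D(1) x v] .
  have D0: "D 0 y w = f y" if "y \<in> U" for y w using D(1) that by (simp add: higher_derivs_def)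
  have E0: "E 0 y w = g y" if "y \<in> V" for y w using D(2) that by (simp add: higher_derivs_def)
  have "limitin T' (\<lambda>t::real. (1 / t) *\<^sub>R (D 0 (x + t *\<^sub>R v) ?e - f x)) (D (Suc 0) x (?e(0 := v))) (at 0)"
    using higher_derivs_deriv[OF T U(1) D(1) x _ v, of ?e 0] by (simp add: D0[OF x])
  \<comment> \<open>\<open>higher_derivs_curve\<close> with \<open>m = 0\<close>: there are no
    directions to move, so the sum is empty and its entries are placeholders.\<close>
  then have y: "limitin T (\<lambda>t::real. (1 / t) *\<^sub>R (E 0 (D 0 (x + t *\<^sub>R v) ?e) ?e - E 0 (f x) ?e))
      (E (Suc 0) (f x) (?e(0 := D (Suc 0) x (?e(0 := v)))) + (\<Sum>j<0. E 0 (f x) (?e(j := f x)))) (at 0)"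
    by (intro higher_derivs_curve[OF T(2,1) U(2) D(2)]) (use x inv in auto)
  have "\<forall>\<^sub>F t::real in at 0. (1 / t) *\<^sub>R (E 0 (D 0 (x + t *\<^sub>R v) ?e) ?e - E 0 (f x) ?e) = v"
    using ev eventually_neq_at_within[of 0]
    by eventually_elim (use inv x in \<open>auto simp: D0 E0 image_subset_iff\<close>)
  then have "limitin T (\<lambda>t::real. (1 / t) *\<^sub>R (E 0 (D 0 (x + t *\<^sub>R v) ?e) ?e - E 0 (f x) ?e)) v (at 0)"
    by (rule limitin_eventually[OF v])
  from limitin_Hausdorff_unique[OF y this at_neq_bot frechet_space_Hausdorff[OF T(1)]]
  show ?thesis by simp
qed

text \<open>The easy converse of an inverse function theorem. It is recorded as the bare existence
  of a linear isomorphism between the model spaces, which is all that a change of model space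
  requires.\<close>

lemma frechet_smooth_inverse_derivative:
  assumes T: "frechet_space T" "frechet_space T'"
    and f: "frechet_smooth T U T' f" and g: "frechet_smooth T' V T g"
    and inv: "f ` U \<subseteq> V" "g ` V \<subseteq> U" "\<And>x. x \<in> U \<Longrightarrow> g (f x) = x" "\<And>y. y \<in> V \<Longrightarrow> f (g y) = y"
    and x: "x \<in> U"
  obtains A B where "linear_between T T' A" "linear_between T' T B"
    "\<And>v. v \<in> topspace T \<Longrightarrow> B (A v) = v" "\<And>w. w \<in> topspace T' \<Longrightarrow> A (B w) = w"
proof -
  obtain D E where D: "higher_derivs T U T' f D" and U: "openin T U"
    and E: "higher_derivs T' V T g E" and V: "openin T' V"
    using f g unfolding frechet_smooth_iff by blast
  have fx: "f x \<in> V" "g (f x) = x" using inv x by auto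
  show thesis
    by (rule that[OF higher_derivs_linear_between[OF T U D x] higher_derivs_linear_between[OF T(2,1) V E fx(1)]])
      (use higher_derivs_left_inverse[OF T U V D E inv(1,3) x]
        higher_derivs_left_inverse[OF T(2,1) V U E D inv(2,4) fx(1), unfolded fx(2)] in auto)
qed

section \<open>Frechet manifolds\<close>

text \<open>A Frechet manifold without the separation condition, which is then checked only where a
  manifold is claimed; open subsets and products below serve merely as carriers of an atlas.\<close>

definition fatlas_on :: "'x set \<Rightarrow> ('x, 'v::real_vector) fatlas \<Rightarrow> bool" where
  "fatlas_on X \<A> \<longleftrightarrow> (\<forall>c\<in>\<A>. fchart_on X c) \<and> X = (\<Union>(W, u, T)\<in>\<A>. W) \<and> (\<forall>c\<in>\<A>. \<forall>d\<in>\<A>. fcompat c d)"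

lemma frechet_manifold_iff: "frechet_manifold X \<A> \<longleftrightarrow> fatlas_on X \<A> \<and> Hausdorff_space (ftop X \<A>)"
  by (auto simp: frechet_manifold_def fatlas_on_def)

lemma fchart_onD:
  assumes "fchart_on X (W, u, T)"
  shows "W \<subseteq> X" "inj_on u W" "frechet_space T" "openin T (u ` W)"
  using assms by (auto simp: fchart_on_def)

lemma fcompat_sym: "fcompat c d \<longleftrightarrow> fcompat d c"
  by (auto simp: fcompat_def Int_commute split: prod.splits)

lemma fcompatD:
  "fcompat (W, u, T) (W', u', T') \<Longrightarrow> frechet_smooth T (u ` (W \<inter> W')) T' (u' \<circ> inv_into W u)"
  by (simp add: fcompat_def)

lemma fatlas_onD:
  assumes "fatlas_on X \<A>"
  shows "c \<in> \<A> \<Longrightarrow> fchart_on X c" "c \<in> \<A> \<Longrightarrow> d \<in> \<A> \<Longrightarrow> fcompat c d"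
    "x \<in> X \<Longrightarrow> \<exists>W u T. (W, u, T) \<in> \<A> \<and> x \<in> W"
proof -
  note * = conjunct1[OF assms[unfolded fatlas_on_def]]
    conjunct2[OF conjunct2[OF assms[unfolded fatlas_on_def]]]
  note X = conjunct1[OF conjunct2[OF assms[unfolded fatlas_on_def]]]
  show "c \<in> \<A> \<Longrightarrow> fchart_on X c" by (rule bspec[OF *(1)])
  show "c \<in> \<A> \<Longrightarrow> d \<in> \<A> \<Longrightarrow> fcompat c d" by (rule bspec[OF bspec[OF *(2)]])
  assume "x \<in> X"
  then have "x \<in> (\<Union>(W, u, T)\<in>\<A>. W)" by (simp only: X[symmetric])
  then show "\<exists>W u T. (W, u, T) \<in> \<A> \<and> x \<in> W" by auto
qed

text \<open>Openness is available for preimages under coordinate representations, but charts are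
  described by images of subsets of the manifold. This translates the former into the latter, with
  \<open>h\<close> as coordinate representation of \<open>f\<close>.\<close>

lemma image_preimage_chart:
  assumes "inj_on u' W'" "M \<subseteq> W'" "\<And>x. x \<in> N \<Longrightarrow> h (u x) = u' (f x)" "\<And>x. x \<in> N \<Longrightarrow> f x \<in> W'"
  shows "{y \<in> u ` N. h y \<in> u' ` M} = u ` (N \<inter> f -` M)"
proof -
  have "h (u x) \<in> u' ` M \<longleftrightarrow> f x \<in> M" if "x \<in> N" for x
    unfolding assms(3)[OF that] by (rule inj_on_image_mem_iff[OF assms(1) assms(4)[OF that] assms(2)])
  then show ?thesis by auto
qed

lemma fcompat_openin:
  assumes "fcompat (W, u, T) (W', u', T')" "inj_on u W" "inj_on u' W'" "N \<subseteq> W'" "openin T' (u' ` N)"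
  shows "openin T (u ` (N \<inter> W))"
proof -
  have "openin T {x \<in> u ` (W \<inter> W'). (u' \<circ> inv_into W u) x \<in> u' ` N}"
    using fcompatD[OF assms(1)] assms(5) by (rule frechet_smooth_openin_preimage)
  also have "{x \<in> u ` (W \<inter> W'). (u' \<circ> inv_into W u) x \<in> u' ` N} = u ` (N \<inter> W)"
  proof -
    have "W \<inter> W' \<inter> (\<lambda>x. x) -` N = N \<inter> W" using assms(4) by blast
    then show ?thesis
      using image_preimage_chart[OF assms(3,4), of "W \<inter> W'" "u' \<circ> inv_into W u" u "\<lambda>x. x"]
      by (simp add: inv_into_f_f[OF assms(2)])
  qed
  finally show ?thesis .
qed

text \<open>The sets in the definition of \<open>ftop\<close> form a topology because injective
  chart maps commute with intersections; for this the charts of the atlas must be known to be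
  charts.\<close>

lemma openin_ftop:
  assumes "fatlas_on X \<A>"
  shows "openin (ftop X \<A>) V \<longleftrightarrow> V \<subseteq> X \<and> (\<forall>(W, u, T)\<in>\<A>. openin T (u ` (V \<inter> W)))"
proof -
  let ?L = "\<lambda>V. V \<subseteq> X \<and> (\<forall>(W, u, T)\<in>\<A>. openin T (u ` (V \<inter> W)))"
  have "istopology ?L"
    unfolding istopology_def
  proof (rule conjI; (intro allI impI))
    fix A B assume A: "?L A" and B: "?L B"
    have "openin T (u ` (A \<inter> B \<inter> W))" if c: "(W, u, T) \<in> \<A>" for W u T
    proof -
      have "inj_on u W" using fatlas_onD(1)[OF assms c] by (rule fchart_onD)
      then have "u ` ((A \<inter> W) \<inter> (B \<inter> W)) = u ` (A \<inter> W) \<inter> u ` (B \<inter> W)"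
        by (rule inj_on_image_Int) auto
      moreover have "(A \<inter> W) \<inter> (B \<inter> W) = A \<inter> B \<inter> W" by blast
      moreover have "openin T (u ` (A \<inter> W))" "openin T (u ` (B \<inter> W))" using A B c by fast+
      ultimately show ?thesis by (metis openin_Int)
    qed
    then show "?L (A \<inter> B)" using A by blast
  next
    fix \<K> assume K: "\<forall>K\<in>\<K>. ?L K"
    have "openin T (u ` (\<Union> \<K> \<inter> W))" if c: "(W, u, T) \<in> \<A>" for W u T
    proof -
      have "u ` (\<Union> \<K> \<inter> W) = \<Union> ((\<lambda>K. u ` (K \<inter> W)) ` \<K>)" by blast
      moreover have "openin T (u ` (K \<inter> W))" if "K \<in> \<K>" for K using K that c by fast
      ultimately show ?thesis by auto
    qed
    then show "?L (\<Union> \<K>)" using K by blast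
  qed
  then show ?thesis unfolding ftop_def by (simp add: topology_inverse')
qed

lemma topspace_ftop:
  assumes "fatlas_on X \<A>"
  shows "topspace (ftop X \<A>) = X"
proof -
  have "openin T (u ` (X \<inter> W))" if "(W, u, T) \<in> \<A>" for W u T
    using fchart_onD(1,4)[OF fatlas_onD(1)[OF assms that]] by (simp add: Int_absorb1)
  then have "openin (ftop X \<A>) X" using assms by (auto simp: openin_ftop)
  then show ?thesis
    using openin_ftop[OF assms] by (metis openin_subset openin_topspace subset_antisym)
qed

section \<open>Maximal atlases and change of charts\<close>

lemma max_fatlasD:
  assumes "c \<in> max_fatlas X \<A>"
  shows "fchart_on X c" "d \<in> \<A> \<Longrightarrow> fcompat c d" "d \<in> \<A> \<Longrightarrow> fcompat d c"
  using assms fcompat_sym[of c d] by (auto simp: max_fatlas_def)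

lemma fatlas_subset_max: "fatlas_on X \<A> \<Longrightarrow> c \<in> \<A> \<Longrightarrow> c \<in> max_fatlas X \<A>"
  using fatlas_onD(1,2)[of X \<A>] by (simp add: max_fatlas_def)

text \<open>The topology is defined by the charts of the given atlas only. Around each point, a
  piece of \<open>V\<close> lying in one of these is carried over by the transition map.\<close>

lemma openin_ftop_max:
  assumes A: "fatlas_on X \<A>" and V: "openin (ftop X \<A>) V" and c: "(W, u, T) \<in> max_fatlas X \<A>"
  shows "openin T (u ` (V \<inter> W))"
proof (subst openin_subopen, intro ballI)
  fix y assume "y \<in> u ` (V \<inter> W)"
  then obtain x where x: "x \<in> V" "x \<in> W" "y = u x" by blast
  then have "x \<in> X" using fchart_onD(1)[OF max_fatlasD(1)[OF c]] by blast
  then obtain W' u' T' where d: "(W', u', T') \<in> \<A>" "x \<in> W'" using fatlas_onD(3)[OF A] by blast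
  have "openin T' (u' ` (V \<inter> W'))" using V d(1) unfolding openin_ftop[OF A] by fast
  then have "openin T (u ` ((V \<inter> W') \<inter> W))"
    using fchart_onD(2)[OF max_fatlasD(1)[OF c]] fchart_onD(2)[OF fatlas_onD(1)[OF A d(1)]]
    by (intro fcompat_openin[OF max_fatlasD(2)[OF c d(1)]]) auto
  then show "\<exists>S. openin T S \<and> y \<in> S \<and> S \<subseteq> u ` (V \<inter> W)"
    using x d(2) by (intro exI[of _ "u ` ((V \<inter> W') \<inter> W)"]) auto
qed

lemma openin_ftopI:
  assumes A: "fatlas_on X \<A>"
    and loc: "\<And>x. x \<in> V \<Longrightarrow> \<exists>W u T N. (W, u, T) \<in> max_fatlas X \<A> \<and> x \<in> N \<and> N \<subseteq> V \<inter> W \<and> openin T (u ` N)"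
  shows "openin (ftop X \<A>) V"
  unfolding openin_ftop[OF A]
proof (intro conjI subsetI ballI, goal_cases)
  case (1 x)
  then obtain W u T where "(W, u, T) \<in> max_fatlas X \<A>" "x \<in> W" using loc by blast
  then show ?case using fchart_onD(1)[OF max_fatlasD(1)] by blast
next
  case (2 d)
  obtain W' u' T' where d: "d = (W', u', T')" by (cases d)
  have "openin T' (u' ` (V \<inter> W'))"
  proof (subst openin_subopen, intro ballI)
    fix y assume "y \<in> u' ` (V \<inter> W')"
    then obtain x where x: "x \<in> V" "x \<in> W'" "y = u' x" by blast
    then obtain W u T N where c: "(W, u, T) \<in> max_fatlas X \<A>" "x \<in> N" "N \<subseteq> V \<inter> W" "openin T (u ` N)"
      using loc by blast
    have "openin T' (u' ` (N \<inter> W'))"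
      using c 2 d fchart_onD(2)[OF max_fatlasD(1)[OF c(1)]] fchart_onD(2)[OF fatlas_onD(1)[OF A 2[unfolded d]]]
      by (intro fcompat_openin[OF max_fatlasD(3)[OF c(1)]]) auto
    then show "\<exists>S. openin T' S \<and> y \<in> S \<and> S \<subseteq> u' ` (V \<inter> W')"
      using x c(2,3) by (intro exI[of _ "u' ` (N \<inter> W')"]) auto
  qed
  then show ?case by (simp add: d)
qed

text \<open>The new coordinate representation is the old one between two transition maps, on the set
  where all three factors are defined. The chain rule enters the theory of manifolds mostly through
  this lemma.\<close>

lemma smooth_transport:
  assumes c: "fchart_on X (W, u, T)" "fchart_on X (W1, u1, T1)" "fcompat (W1, u1, T1) (W, u, T)"
    and c': "fchart_on Y (W', u', T')" "fchart_on Y (W1', u1', T1')" "fcompat (W', u', T') (W1', u1', T1')"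
    and N: "N \<subseteq> W" "f ` N \<subseteq> W'" "frechet_smooth T (u ` N) T' (u' \<circ> f \<circ> inv_into W u)"
  shows "frechet_smooth T1 (u1 ` (N \<inter> W1 \<inter> f -` W1')) T1' (u1' \<circ> f \<circ> inv_into W1 u1)"
proof -
  note cs = fchart_onD[OF c(1)] fchart_onD[OF c(2)] and cs' = fchart_onD[OF c'(1)] fchart_onD[OF c'(2)]
  let ?\<tau> = "u \<circ> inv_into W1 u1" and ?\<rho> = "u' \<circ> f \<circ> inv_into W u" and ?\<sigma> = "u1' \<circ> inv_into W' u'"
  let ?P = "u ` (N \<inter> f -` W1')" and ?R = "u1 ` (N \<inter> W1 \<inter> f -` W1')"
  have inv: "inv_into W u (u x) = x" if "x \<in> N" for x using cs(2) N(1) that by (auto intro: inv_into_f_f)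
  have inv1: "inv_into W1 u1 (u1 x) = x" if "x \<in> W1" for x using cs(6) that by (rule inv_into_f_f)
  have inv': "inv_into W' u' (u' x) = x" if "x \<in> W'" for x using cs'(2) that by (rule inv_into_f_f)
  have "?P = {y \<in> u ` N. ?\<rho> y \<in> u' ` (W' \<inter> W1')}"
    by (subst image_preimage_chart[OF cs'(2) Int_lower1]) (use N(2) inv in auto)
  then have P: "openin T ?P"
    using frechet_smooth_openin_preimage[OF N(3) frechet_smooth_openin[OF fcompatD[OF c'(3)]]] by simp
  have NW: "N \<inter> f -` W1' \<subseteq> W" using N(1) by blast
  have "?R = {y \<in> u1 ` (W1 \<inter> W). ?\<tau> y \<in> ?P}"
    by (subst image_preimage_chart[OF cs(2) NW, where f = "\<lambda>x. x"]) (use N(1) inv1 in auto)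
  then have R: "openin T1 ?R"
    using frechet_smooth_openin_preimage[OF fcompatD[OF c(3)] P] by simp
  have \<sigma>\<rho>: "frechet_smooth T ?P T1' (?\<sigma> \<circ> ?\<rho>)"
    by (rule frechet_smooth_compose[OF cs(3) cs'(3,7) frechet_smooth_subset[OF N(3) P] fcompatD[OF c'(3)]])
      (use N(2) inv in auto)
  have "frechet_smooth T1 ?R T1' ((?\<sigma> \<circ> ?\<rho>) \<circ> ?\<tau>)"
    by (rule frechet_smooth_compose[OF cs(7,3) cs'(7) frechet_smooth_subset[OF fcompatD[OF c(3)] R] \<sigma>\<rho>])
      (use N(1) inv1 in auto)
  then show ?thesis
    by (rule frechet_smooth_cong) (use N(2) inv inv1 inv' in \<open>auto simp: image_subset_iff\<close>)
qed

lemma frechet_smooth_ident: "frechet_space T \<Longrightarrow> openin T U \<Longrightarrow> frechet_smooth T U T (\<lambda>x. x)"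
  by (rule frechet_smooth_linear[OF _ _ linear_between_id])

lemma frechet_smooth_chart_ident:
  assumes "fchart_on X (W, u, T)"
  shows "frechet_smooth T (u ` W) T (u \<circ> (\<lambda>x. x) \<circ> inv_into W u)"
  using frechet_smooth_ident[OF fchart_onD(3,4)[OF assms]]
  by (rule frechet_smooth_cong) (simp add: f_inv_into_f)

text \<open>A transition map is the identity of the manifold read in two charts. Near each point it
  is transported from the identity in a third chart, and smoothness is local.\<close>

lemma fcompat_local:
  assumes c: "fchart_on X (W, u, T)" and c': "fchart_on X (W', u', T')"
    and loc: "\<And>x. x \<in> W \<inter> W' \<Longrightarrow> \<exists>V w S. x \<in> V \<and> fchart_on X (V, w, S) \<and>
      fcompat (W, u, T) (V, w, S) \<and> fcompat (W', u', T') (V, w, S)"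
  shows "fcompat (W, u, T) (W', u', T')"
proof -
  have half: "frechet_smooth T (u ` (W \<inter> W')) T' (u' \<circ> inv_into W u)"
    if c: "fchart_on X (W, u, T)" and c': "fchart_on X (W', u', T')"
    and loc: "\<And>x. x \<in> W \<inter> W' \<Longrightarrow> \<exists>V w S. x \<in> V \<and> fchart_on X (V, w, S) \<and>
      fcompat (W, u, T) (V, w, S) \<and> fcompat (W', u', T') (V, w, S)" for W W' u u' T T'
  proof (rule frechet_smooth_local[OF fchart_onD(3)[OF c] fchart_onD(3)[OF c']])
    fix y assume "y \<in> u ` (W \<inter> W')"
    then obtain x where x: "x \<in> W \<inter> W'" "y = u x" by blast
    obtain V w S where e: "x \<in> V" "fchart_on X (V, w, S)"
      "fcompat (W, u, T) (V, w, S)" "fcompat (V, w, S) (W', u', T')"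
      using loc[OF x(1)] fcompat_sym by blast
    have "frechet_smooth T (u ` (V \<inter> W \<inter> (\<lambda>x. x) -` W')) T' (u' \<circ> (\<lambda>x. x) \<circ> inv_into W u)"
      by (rule smooth_transport[OF e(2) c e(3) e(2) c' e(4) _ _ frechet_smooth_chart_ident[OF e(2)]]) auto
    then show "\<exists>N. y \<in> N \<and> N \<subseteq> u ` (W \<inter> W') \<and> frechet_smooth T N T' (u' \<circ> inv_into W u)"
      using x e(1) by (intro exI[of _ "u ` (V \<inter> W \<inter> (\<lambda>x. x) -` W')"]) (auto simp: o_def)
  qed
  have "frechet_smooth T' (u' ` (W \<inter> W')) T (u \<circ> inv_into W' u')"
    using half[OF c' c] loc by (simp add: Int_commute) blast
  then show ?thesis using half[OF c c' loc] by (simp add: fcompat_def)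
qed

text \<open>Compatibility is not transitive in general, because a third chart need not meet the
  overlap. Here the charts of the atlas cover it.\<close>

lemma max_fatlas_compat:
  assumes A: "fatlas_on X \<A>" and "c \<in> max_fatlas X \<A>" "d \<in> max_fatlas X \<A>"
  shows "fcompat c d"
proof -
  obtain W u T W' u' T' where cd: "c = (W, u, T)" "d = (W', u', T')" by (cases c, cases d)
  note c = assms(2)[unfolded cd] and d = assms(3)[unfolded cd]
  show ?thesis unfolding cd
  proof (rule fcompat_local[OF max_fatlasD(1)[OF c] max_fatlasD(1)[OF d]])
    fix x assume "x \<in> W \<inter> W'"
    then have "x \<in> X" using fchart_onD(1)[OF max_fatlasD(1)[OF c]] by blast
    then obtain V w S where "(V, w, S) \<in> \<A>" "x \<in> V" using fatlas_onD(3)[OF A] by blast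
    then show "\<exists>V w S. x \<in> V \<and> fchart_on X (V, w, S) \<and> fcompat (W, u, T) (V, w, S) \<and> fcompat (W', u', T') (V, w, S)"
      using fatlas_onD(1)[OF A] max_fatlasD(2)[OF c] max_fatlasD(2)[OF d] by blast
  qed
qed

text \<open>A chart is compatible with the whole atlas as soon as it is compatible with some charts
  covering its domain. The submersion chart constructed later is tested in this way against a single
  chart.\<close>

lemma max_fatlasI:
  assumes A: "fatlas_on X \<A>" and c: "fchart_on X (W, u, T)"
    and loc: "\<And>x. x \<in> W \<Longrightarrow> \<exists>V w S. x \<in> V \<and> (V, w, S) \<in> max_fatlas X \<A> \<and> fcompat (W, u, T) (V, w, S)"
  shows "(W, u, T) \<in> max_fatlas X \<A>"
proof -
  have "fcompat (W, u, T) (W', u', T')" if d: "(W', u', T') \<in> \<A>" for W' u' T'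
  proof (rule fcompat_local[OF c fatlas_onD(1)[OF A d]])
    fix x assume "x \<in> W \<inter> W'"
    then obtain V w S where "x \<in> V" "(V, w, S) \<in> max_fatlas X \<A>" "fcompat (W, u, T) (V, w, S)"
      using loc by blast
    then show "\<exists>V w S. x \<in> V \<and> fchart_on X (V, w, S) \<and> fcompat (W, u, T) (V, w, S) \<and> fcompat (W', u', T') (V, w, S)"
      using max_fatlasD[of "(V, w, S)" X \<A>] d by blast
  qed
  then show ?thesis using c by (auto simp: max_fatlas_def)
qed

section \<open>Smooth maps between Frechet manifolds\<close>

text \<open>The definition asks for continuity and for smoothness in all pairs of charts of the two
  atlases. One pair at each point, which may come from the maximal atlases, is enough: smoothness
  there is transported to all other pairs and implies continuity.\<close>

lemma fsmooth_mapI: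
  assumes A: "fatlas_on X \<A>" and B: "fatlas_on Y \<B>"
    and loc: "\<And>x. x \<in> X \<Longrightarrow> \<exists>W u T W' u' T' N. (W, u, T) \<in> max_fatlas X \<A> \<and> (W', u', T') \<in> max_fatlas Y \<B> \<and>
      x \<in> N \<and> N \<subseteq> W \<and> f ` N \<subseteq> W' \<and> frechet_smooth T (u ` N) T' (u' \<circ> f \<circ> inv_into W u)"
  shows "fsmooth_map X \<A> Y \<B> f"
  unfolding fsmooth_map_def
proof (intro conjI)
  show "continuous_map (ftop X \<A>) (ftop Y \<B>) f"
    unfolding continuous_map_def topspace_ftop[OF A] topspace_ftop[OF B]
  proof (intro conjI allI impI Pi_I)
    fix x assume "x \<in> X"
    then show "f x \<in> Y" using loc fchart_onD(1)[OF max_fatlasD(1)] by blast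
  next
    fix V assume V: "openin (ftop Y \<B>) V"
    show "openin (ftop X \<A>) {x \<in> X. f x \<in> V}"
    proof (rule openin_ftopI[OF A])
      fix x assume x: "x \<in> {x \<in> X. f x \<in> V}"
      then obtain W u T W' u' T' N where c: "(W, u, T) \<in> max_fatlas X \<A>" "(W', u', T') \<in> max_fatlas Y \<B>"
        "x \<in> N" "N \<subseteq> W" "f ` N \<subseteq> W'" "frechet_smooth T (u ` N) T' (u' \<circ> f \<circ> inv_into W u)"
        using loc by blast
      note cs = fchart_onD[OF max_fatlasD(1)[OF c(1)]] and ds = fchart_onD[OF max_fatlasD(1)[OF c(2)]]
      have inv: "inv_into W u (u x) = x" if "x \<in> N" for x using cs(2) c(4) that by (auto intro: inv_into_f_f)
      have "openin T {y \<in> u ` N. (u' \<circ> f \<circ> inv_into W u) y \<in> u' ` (V \<inter> W')}"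
        using c(6) openin_ftop_max[OF B V c(2)] by (rule frechet_smooth_openin_preimage)
      also have "{y \<in> u ` N. (u' \<circ> f \<circ> inv_into W u) y \<in> u' ` (V \<inter> W')} = u ` (N \<inter> f -` V)"
        by (subst image_preimage_chart[OF ds(2) Int_lower2]) (use inv c(5) in auto)
      finally show "\<exists>W u T N. (W, u, T) \<in> max_fatlas X \<A> \<and> x \<in> N \<and> N \<subseteq> {x \<in> X. f x \<in> V} \<inter> W \<and> openin T (u ` N)"
        using c cs(1) x by (intro exI[of _ W] exI[of _ u] exI[of _ T] exI[of _ "N \<inter> f -` V"]) auto
    qed
  qed
next
  have "frechet_smooth T1 (u1 ` (W1 \<inter> f -` W1')) T1' (u1' \<circ> f \<circ> inv_into W1 u1)"
    if c1: "(W1, u1, T1) \<in> \<A>" and d1: "(W1', u1', T1') \<in> \<B>" for W1 u1 T1 W1' u1' T1'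
  proof (rule frechet_smooth_local)
    note C1 = fatlas_onD(1)[OF A c1] and D1 = fatlas_onD(1)[OF B d1]
    show "frechet_space T1" "frechet_space T1'" using fchart_onD(3)[OF C1] fchart_onD(3)[OF D1] .
    fix y assume "y \<in> u1 ` (W1 \<inter> f -` W1')"
    then obtain x where x: "x \<in> W1" "f x \<in> W1'" "y = u1 x" by blast
    then have "x \<in> X" using fchart_onD(1)[OF C1] by blast
    then obtain W u T W' u' T' N where c: "(W, u, T) \<in> max_fatlas X \<A>" "(W', u', T') \<in> max_fatlas Y \<B>"
      "x \<in> N" "N \<subseteq> W" "f ` N \<subseteq> W'" "frechet_smooth T (u ` N) T' (u' \<circ> f \<circ> inv_into W u)"
      using loc by blast
    have "frechet_smooth T1 (u1 ` (N \<inter> W1 \<inter> f -` W1')) T1' (u1' \<circ> f \<circ> inv_into W1 u1)"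
      by (rule smooth_transport[OF max_fatlasD(1)[OF c(1)] C1 max_fatlasD(3)[OF c(1) c1]
            max_fatlasD(1)[OF c(2)] D1 max_fatlasD(2)[OF c(2) d1] c(4-6)])
    then show "\<exists>V. y \<in> V \<and> V \<subseteq> u1 ` (W1 \<inter> f -` W1') \<and> frechet_smooth T1 V T1' (u1' \<circ> f \<circ> inv_into W1 u1)"
      using x c(3) by (intro exI[of _ "u1 ` (N \<inter> W1 \<inter> f -` W1')"]) auto
  qed
  then show "\<forall>(W, u, T)\<in>\<A>. \<forall>(W', u', T')\<in>\<B>.
      frechet_smooth T (u ` (W \<inter> f -` W')) T' (u' \<circ> f \<circ> inv_into W u)" by auto
qed

context
  fixes X :: "'x set" and \<A> :: "('x, 'v::real_vector) fatlas" and Y :: "'y set" and \<B> :: "('y, 'w::real_vector) fatlas" and f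
  assumes A: "fatlas_on X \<A>" and B: "fatlas_on Y \<B>" and f: "fsmooth_map X \<A> Y \<B> f"
begin

lemma fsmooth_map_mem: "x \<in> X \<Longrightarrow> f x \<in> Y"
  using f continuous_map_image_subset_topspace[of "ftop X \<A>" "ftop Y \<B>" f]
  unfolding fsmooth_map_def topspace_ftop[OF A] topspace_ftop[OF B] by blast

lemma fsmooth_map_openin:
  assumes "openin (ftop Y \<B>) V"
  shows "openin (ftop X \<A>) (X \<inter> f -` V)"
proof -
  have "openin (ftop X \<A>) {x \<in> topspace (ftop X \<A>). f x \<in> V}"
    using f assms unfolding fsmooth_map_def by (blast intro: openin_continuous_map_preimage)
  then show ?thesis unfolding topspace_ftop[OF A] by (simp add: Int_def vimage_def)
qed

text \<open>The converse of \<open>fsmooth_mapI\<close>. Around each point a pair of charts from the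
  atlases is transported to the given pair, and the local pieces glue.\<close>

lemma fsmooth_map_max:
  assumes c: "(W, u, T) \<in> max_fatlas X \<A>" and d: "(W', u', T') \<in> max_fatlas Y \<B>"
  shows "frechet_smooth T (u ` (W \<inter> f -` W')) T' (u' \<circ> f \<circ> inv_into W u)"
proof (rule frechet_smooth_local)
  note C = max_fatlasD(1)[OF c] and D = max_fatlasD(1)[OF d]
  show "frechet_space T" "frechet_space T'" using fchart_onD(3)[OF C] fchart_onD(3)[OF D] .
  fix y assume "y \<in> u ` (W \<inter> f -` W')"
  then obtain x where x: "x \<in> W" "f x \<in> W'" "y = u x" by blast
  then have "x \<in> X" "f x \<in> Y" using fchart_onD(1)[OF C] fchart_onD(1)[OF D] by blast+
  then obtain V w P V' w' P' where e: "(V, w, P) \<in> \<A>" "(V', w', P') \<in> \<B>" "x \<in> V" "f x \<in> V'"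
    using fatlas_onD(3)[OF A] fatlas_onD(3)[OF B] by metis
  have "frechet_smooth P (w ` (V \<inter> f -` V')) P' (w' \<circ> f \<circ> inv_into V w)"
    using f e(1,2) unfolding fsmooth_map_def by fast
  then have "frechet_smooth T (u ` ((V \<inter> f -` V') \<inter> W \<inter> f -` W')) T' (u' \<circ> f \<circ> inv_into W u)"
    by (rule smooth_transport[OF fatlas_onD(1)[OF A e(1)] C max_fatlasD(2)[OF c e(1)]
          fatlas_onD(1)[OF B e(2)] D max_fatlasD(3)[OF d e(2)], rotated 2]) auto
  then show "\<exists>N. y \<in> N \<and> N \<subseteq> u ` (W \<inter> f -` W') \<and> frechet_smooth T N T' (u' \<circ> f \<circ> inv_into W u)"
    using x e(3,4) by (intro exI[of _ "u ` ((V \<inter> f -` V') \<inter> W \<inter> f -` W')"]) auto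
qed

end

lemma max_fatlas_covers:
  assumes "fatlas_on X \<A>" "x \<in> X"
  obtains W u T where "(W, u, T) \<in> max_fatlas X \<A>" "x \<in> W"
  using fatlas_onD(3)[OF assms] fatlas_subset_max[OF assms(1)] by blast

lemma fsmooth_map_cong:
  assumes A: "fatlas_on X \<A>" and f: "fsmooth_map X \<A> Y \<B> f" and eq: "\<And>x. x \<in> X \<Longrightarrow> f x = g x"
  shows "fsmooth_map X \<A> Y \<B> g"
  unfolding fsmooth_map_def
proof (intro conjI)
  show "continuous_map (ftop X \<A>) (ftop Y \<B>) g"
    using f eq continuous_map_eq[of "ftop X \<A>" "ftop Y \<B>" f g] topspace_ftop[OF A]
    by (simp add: fsmooth_map_def)
  have "frechet_smooth T (u ` (W \<inter> g -` W')) T' (u' \<circ> g \<circ> inv_into W u)"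
    if c: "(W, u, T) \<in> \<A>" and d: "(W', u', T') \<in> \<B>" for W u T W' u' T'
  proof -
    note W = fchart_onD(1,2)[OF fatlas_onD(1)[OF A c]]
    have "frechet_smooth T (u ` (W \<inter> f -` W')) T' (u' \<circ> f \<circ> inv_into W u)"
      using f c d unfolding fsmooth_map_def by fast
    moreover have "W \<inter> f -` W' = W \<inter> g -` W'" using W(1) eq by auto
    ultimately have "frechet_smooth T (u ` (W \<inter> g -` W')) T' (u' \<circ> f \<circ> inv_into W u)" by simp
    then show ?thesis
      by (rule frechet_smooth_cong) (use W eq in \<open>auto simp: subset_iff\<close>)
  qed
  then show "\<forall>(W, u, T)\<in>\<A>. \<forall>(W', u', T')\<in>\<B>.
      frechet_smooth T (u ` (W \<inter> g -` W')) T' (u' \<circ> g \<circ> inv_into W u)" by auto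
qed

lemma fsmooth_map_compose:
  assumes A: "fatlas_on X \<A>" and B: "fatlas_on Y \<B>" and C: "fatlas_on Z \<C>"
    and f: "fsmooth_map X \<A> Y \<B> f" and g: "fsmooth_map Y \<B> Z \<C> g"
  shows "fsmooth_map X \<A> Z \<C> (g \<circ> f)"
proof (rule fsmooth_mapI[OF A C])
  fix x assume x: "x \<in> X"
  then have fx: "f x \<in> Y" by (rule fsmooth_map_mem[OF A B f])
  then have gfx: "g (f x) \<in> Z" by (rule fsmooth_map_mem[OF B C g])
  obtain W u T where c: "(W, u, T) \<in> max_fatlas X \<A>" "x \<in> W" using max_fatlas_covers[OF A x] .
  obtain W' u' T' where d: "(W', u', T') \<in> max_fatlas Y \<B>" "f x \<in> W'" using max_fatlas_covers[OF B fx] .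
  obtain V v P where e: "(V, v, P) \<in> max_fatlas Z \<C>" "g (f x) \<in> V" using max_fatlas_covers[OF C gfx] .
  note cs = fchart_onD[OF max_fatlasD(1)[OF c(1)]] and ds = fchart_onD[OF max_fatlasD(1)[OF d(1)]]
    and es = fchart_onD[OF max_fatlasD(1)[OF e(1)]]
  note fs = fsmooth_map_max[OF A B f c(1) d(1)] and gs = fsmooth_map_max[OF B C g d(1) e(1)]
  define N where "N = W \<inter> f -` W' \<inter> (g \<circ> f) -` V"
  have "u ` N = {y \<in> u ` (W \<inter> f -` W'). (u' \<circ> f \<circ> inv_into W u) y \<in> u' ` (W' \<inter> g -` V)}"
    by (subst image_preimage_chart[OF ds(2) Int_lower1]) (auto simp: N_def inv_into_f_f[OF cs(2)])
  then have N: "openin T (u ` N)"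
    using frechet_smooth_openin_preimage[OF fs frechet_smooth_openin[OF gs]] by simp
  have "frechet_smooth T (u ` N) P ((v \<circ> g \<circ> inv_into W' u') \<circ> (u' \<circ> f \<circ> inv_into W u))"
    by (rule frechet_smooth_compose[OF cs(3) ds(3) es(3) frechet_smooth_subset[OF fs N] gs])
      (use cs(2) in \<open>auto simp: N_def\<close>)
  then have "frechet_smooth T (u ` N) P (v \<circ> (g \<circ> f) \<circ> inv_into W u)"
    by (rule frechet_smooth_cong) (use cs(2) ds(2) in \<open>auto simp: N_def\<close>)
  moreover have "x \<in> N" "N \<subseteq> W" "(g \<circ> f) ` N \<subseteq> V" using c(2) d(2) e(2) by (auto simp: N_def)
  ultimately show "\<exists>W u T V v P N. (W, u, T) \<in> max_fatlas X \<A> \<and> (V, v, P) \<in> max_fatlas Z \<C> \<and>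
      x \<in> N \<and> N \<subseteq> W \<and> (g \<circ> f) ` N \<subseteq> V \<and> frechet_smooth T (u ` N) P (v \<circ> (g \<circ> f) \<circ> inv_into W u)"
    using c(1) e(1) by blast
qed

subsection \<open>Products\<close>

lemma map_prod_image_Times: "map_prod f g ` (A \<times> B) = f ` A \<times> g ` B"
  by force

lemma inv_into_map_prod:
  assumes "inj_on f A" "inj_on g B" "z \<in> A \<times> B"
  shows "inv_into (A \<times> B) (map_prod f g) (map_prod f g z) = z"
  using map_prod_inj_on[OF assms(1,2)] assms(3) by (rule inv_into_f_f)

lemma fchart_on_prod:
  assumes "fchart_on X (W, u, T)" "fchart_on Y (W', u', T')"
  shows "fchart_on (X \<times> Y) (W \<times> W', map_prod u u', prod_topology T T')"
  using fchart_onD[OF assms(1)] fchart_onD[OF assms(2)]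
  by (auto simp: fchart_on_def map_prod_image_Times openin_prod_Times_iff
      intro: map_prod_inj_on frechet_space_prod)

lemma frechet_smooth_map_prod:
  assumes T: "frechet_space T1" "frechet_space T2" "frechet_space T1'" "frechet_space T2'"
    and f: "frechet_smooth T1 U1 T1' f" and g: "frechet_smooth T2 U2 T2' g"
  shows "frechet_smooth (prod_topology T1 T2) (U1 \<times> U2) (prod_topology T1' T2') (map_prod f g)"
proof -
  note P = frechet_space_prod[OF T(1,2)]
  have U: "openin (prod_topology T1 T2) (U1 \<times> U2)"
    using frechet_smooth_openin[OF f] frechet_smooth_openin[OF g] by (simp add: openin_prod_Times_iff)
  have "frechet_smooth (prod_topology T1 T2) (U1 \<times> U2) T1' (f \<circ> fst)"
    by (rule frechet_smooth_compose[OF P T(1,3) frechet_smooth_linear[OF P T(1) linear_between_fst U] f]) auto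
  moreover have "frechet_smooth (prod_topology T1 T2) (U1 \<times> U2) T2' (g \<circ> snd)"
    by (rule frechet_smooth_compose[OF P T(2,4) frechet_smooth_linear[OF P T(2) linear_between_snd U] g]) auto
  ultimately show ?thesis
    by (rule frechet_smooth_cong[OF frechet_smooth_Pair]) auto
qed

lemma fcompat_prod:
  assumes c: "fchart_on X (W1, u1, T1)" "fchart_on X (W2, u2, T2)" "fcompat (W1, u1, T1) (W2, u2, T2)"
    and d: "fchart_on Y (V1, v1, S1)" "fchart_on Y (V2, v2, S2)" "fcompat (V1, v1, S1) (V2, v2, S2)"
  shows "fcompat (W1 \<times> V1, map_prod u1 v1, prod_topology T1 S1) (W2 \<times> V2, map_prod u2 v2, prod_topology T2 S2)"
proof -
  have half: "frechet_smooth (prod_topology T1 S1) (map_prod u1 v1 ` ((W1 \<times> V1) \<inter> (W2 \<times> V2)))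
      (prod_topology T2 S2) (map_prod u2 v2 \<circ> inv_into (W1 \<times> V1) (map_prod u1 v1))"
    if c: "fchart_on X (W1, u1, T1)" "fchart_on X (W2, u2, T2)" "fcompat (W1, u1, T1) (W2, u2, T2)"
    and d: "fchart_on Y (V1, v1, S1)" "fchart_on Y (V2, v2, S2)" "fcompat (V1, v1, S1) (V2, v2, S2)"
    for W1 u1 T1 V1 v1 S1 W2 u2 T2 V2 v2 S2
  proof -
    note c1 = fchart_onD[OF c(1)] and c2 = fchart_onD[OF c(2)] and d1 = fchart_onD[OF d(1)] and d2 = fchart_onD[OF d(2)]
    have "frechet_smooth (prod_topology T1 S1) (u1 ` (W1 \<inter> W2) \<times> v1 ` (V1 \<inter> V2)) (prod_topology T2 S2)
        (map_prod (u2 \<circ> inv_into W1 u1) (v2 \<circ> inv_into V1 v1))"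
      by (rule frechet_smooth_map_prod[OF c1(3) d1(3) c2(3) d2(3) fcompatD[OF c(3)] fcompatD[OF d(3)]])
    then have "frechet_smooth (prod_topology T1 S1) (map_prod u1 v1 ` ((W1 \<times> V1) \<inter> (W2 \<times> V2))) (prod_topology T2 S2)
        (map_prod (u2 \<circ> inv_into W1 u1) (v2 \<circ> inv_into V1 v1))"
      by (simp only: Times_Int_Times map_prod_image_Times)
    then show ?thesis
    proof (rule frechet_smooth_cong)
      fix z assume "z \<in> map_prod u1 v1 ` ((W1 \<times> V1) \<inter> (W2 \<times> V2))"
      then obtain w where z: "z = map_prod u1 v1 w" and "w \<in> (W1 \<times> V1) \<inter> (W2 \<times> V2)" by (rule imageE)
      then have w: "w \<in> W1 \<times> V1" by simp
      show "map_prod (u2 \<circ> inv_into W1 u1) (v2 \<circ> inv_into V1 v1) z =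
          (map_prod u2 v2 \<circ> inv_into (W1 \<times> V1) (map_prod u1 v1)) z"
        using inv_into_map_prod[OF c1(2) d1(2) w] w c1(2) d1(2) z by (cases w) auto
    qed
  qed
  show ?thesis
    unfolding fcompat_def prod.case
    using half[OF c d] half[OF c(2,1) fcompat_sym[THEN iffD1, OF c(3)] d(2,1) fcompat_sym[THEN iffD1, OF d(3)]]
    by (simp add: Int_commute)
qed

lemma prod_fatlasI:
  "(W, u, T) \<in> \<A> \<Longrightarrow> (W', u', T') \<in> \<B> \<Longrightarrow>
    (W \<times> W', map_prod u u', prod_topology T T') \<in> prod_fatlas \<A> \<B>"
  unfolding prod_fatlas_def by blast

lemma prod_fatlasE:
  assumes "c \<in> prod_fatlas \<A> \<B>"
  obtains W u T W' u' T' where "c = (W \<times> W', map_prod u u', prod_topology T T')"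
    "(W, u, T) \<in> \<A>" "(W', u', T') \<in> \<B>"
  using assms unfolding prod_fatlas_def mem_Collect_eq by (elim exE conjE) (rule that)

lemma fatlas_on_prod:
  assumes A: "fatlas_on X \<A>" and B: "fatlas_on Y \<B>"
  shows "fatlas_on (X \<times> Y) (prod_fatlas \<A> \<B>)"
  unfolding fatlas_on_def
proof (intro conjI ballI)
  fix c assume "c \<in> prod_fatlas \<A> \<B>"
  then show "fchart_on (X \<times> Y) c"
    by (rule prod_fatlasE) (simp only: fchart_on_prod fatlas_onD(1)[OF A] fatlas_onD(1)[OF B])
next
  fix c d assume "c \<in> prod_fatlas \<A> \<B>" "d \<in> prod_fatlas \<A> \<B>"
  then obtain W1 u1 T1 V1 v1 S1 W2 u2 T2 V2 v2 S2 where
    c: "c = (W1 \<times> V1, map_prod u1 v1, prod_topology T1 S1)" "(W1, u1, T1) \<in> \<A>" "(V1, v1, S1) \<in> \<B>" and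
    d: "d = (W2 \<times> V2, map_prod u2 v2, prod_topology T2 S2)" "(W2, u2, T2) \<in> \<A>" "(V2, v2, S2) \<in> \<B>"
    by (elim prod_fatlasE) (rule that)
  note A' = fatlas_onD(1,2)[OF A] and B' = fatlas_onD(1,2)[OF B]
  show "fcompat c d" unfolding c(1) d(1)
    by (rule fcompat_prod[OF A'(1)[OF c(2)] A'(1)[OF d(2)] A'(2)[OF c(2) d(2)]
          B'(1)[OF c(3)] B'(1)[OF d(3)] B'(2)[OF c(3) d(3)]])
next
  show "X \<times> Y = (\<Union>(W, u, T)\<in>prod_fatlas \<A> \<B>. W)"
  proof (intro equalityI subsetI)
    fix z assume "z \<in> X \<times> Y"
    then have "fst z \<in> X" "snd z \<in> Y" by auto
    then obtain W u T W' u' T' where "(W, u, T) \<in> \<A>" "fst z \<in> W" "(W', u', T') \<in> \<B>" "snd z \<in> W'"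
      using fatlas_onD(3)[OF A, of "fst z"] fatlas_onD(3)[OF B, of "snd z"] by blast
    then show "z \<in> (\<Union>(W, u, T)\<in>prod_fatlas \<A> \<B>. W)"
      by (intro UN_I[of "(W \<times> W', map_prod u u', prod_topology T T')"])
        (auto simp: mem_Times_iff intro: prod_fatlasI)
  next
    fix z assume "z \<in> (\<Union>(W, u, T)\<in>prod_fatlas \<A> \<B>. W)"
    then obtain e where e: "e \<in> prod_fatlas \<A> \<B>" "z \<in> fst e" by auto
    from e(1) obtain W u T W' u' T' where c: "(W, u, T) \<in> \<A>" "(W', u', T') \<in> \<B>" "z \<in> W \<times> W'"
      by (rule prod_fatlasE) (use e(2) that in auto)
    show "z \<in> X \<times> Y"
      using fchart_onD(1)[OF fatlas_onD(1)[OF A c(1)]] fchart_onD(1)[OF fatlas_onD(1)[OF B c(2)]] c(3) by auto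
  qed
qed

lemma prod_fatlas_chart:
  assumes "fatlas_on X \<A>" "fatlas_on Y \<B>" "(W, u, T) \<in> \<A>" "(W', u', T') \<in> \<B>"
  shows "(W \<times> W', map_prod u u', prod_topology T T') \<in> max_fatlas (X \<times> Y) (prod_fatlas \<A> \<B>)"
  using assms by (intro fatlas_subset_max fatlas_on_prod prod_fatlasI)

lemma fsmooth_map_fst:
  assumes A: "fatlas_on X \<A>" and B: "fatlas_on Y \<B>"
  shows "fsmooth_map (X \<times> Y) (prod_fatlas \<A> \<B>) X \<A> fst"
proof (rule fsmooth_mapI[OF fatlas_on_prod[OF A B] A])
  fix z assume "z \<in> X \<times> Y"
  then have "fst z \<in> X" "snd z \<in> Y" by auto
  then obtain W u T W' u' T' where c: "(W, u, T) \<in> \<A>" "fst z \<in> W" and d: "(W', u', T') \<in> \<B>" "snd z \<in> W'"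
    using fatlas_onD(3)[OF A, of "fst z"] fatlas_onD(3)[OF B, of "snd z"] by blast
  note cs = fchart_onD[OF fatlas_onD(1)[OF A c(1)]] and ds = fchart_onD[OF fatlas_onD(1)[OF B d(1)]]
  let ?u = "map_prod u u'" and ?W = "W \<times> W'"
  have "openin (prod_topology T T') (?u ` ?W)"
    using cs(4) ds(4) by (simp add: map_prod_image_Times openin_prod_Times_iff)
  then have "frechet_smooth (prod_topology T T') (?u ` ?W) T fst"
    by (rule frechet_smooth_linear[OF frechet_space_prod[OF cs(3) ds(3)] cs(3) linear_between_fst])
  then have "frechet_smooth (prod_topology T T') (?u ` ?W) T (u \<circ> fst \<circ> inv_into ?W ?u)"
    by (rule frechet_smooth_cong) (use inv_into_map_prod[OF cs(2) ds(2)] in fastforce)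
  then show "\<exists>V v S V' v' S' N. (V, v, S) \<in> max_fatlas (X \<times> Y) (prod_fatlas \<A> \<B>) \<and> (V', v', S') \<in> max_fatlas X \<A> \<and>
      z \<in> N \<and> N \<subseteq> V \<and> fst ` N \<subseteq> V' \<and> frechet_smooth S (v ` N) S' (v' \<circ> fst \<circ> inv_into V v)"
    using prod_fatlas_chart[OF A B c(1) d(1)] fatlas_subset_max[OF A c(1)] c(2) d(2)
    by (intro exI[of _ ?W] exI[of _ ?u] exI[of _ "prod_topology T T'"] exI[of _ W] exI[of _ u] exI[of _ T] conjI)
      (auto simp: mem_Times_iff)
qed

lemma fsmooth_map_snd:
  assumes A: "fatlas_on X \<A>" and B: "fatlas_on Y \<B>"
  shows "fsmooth_map (X \<times> Y) (prod_fatlas \<A> \<B>) Y \<B> snd"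
proof (rule fsmooth_mapI[OF fatlas_on_prod[OF A B] B])
  fix z assume "z \<in> X \<times> Y"
  then have "fst z \<in> X" "snd z \<in> Y" by auto
  then obtain W u T W' u' T' where c: "(W, u, T) \<in> \<A>" "fst z \<in> W" and d: "(W', u', T') \<in> \<B>" "snd z \<in> W'"
    using fatlas_onD(3)[OF A, of "fst z"] fatlas_onD(3)[OF B, of "snd z"] by blast
  note cs = fchart_onD[OF fatlas_onD(1)[OF A c(1)]] and ds = fchart_onD[OF fatlas_onD(1)[OF B d(1)]]
  let ?u = "map_prod u u'" and ?W = "W \<times> W'"
  have "openin (prod_topology T T') (?u ` ?W)"
    using cs(4) ds(4) by (simp add: map_prod_image_Times openin_prod_Times_iff)
  then have "frechet_smooth (prod_topology T T') (?u ` ?W) T' snd"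
    by (rule frechet_smooth_linear[OF frechet_space_prod[OF cs(3) ds(3)] ds(3) linear_between_snd])
  then have "frechet_smooth (prod_topology T T') (?u ` ?W) T' (u' \<circ> snd \<circ> inv_into ?W ?u)"
    by (rule frechet_smooth_cong) (use inv_into_map_prod[OF cs(2) ds(2)] in fastforce)
  then show "\<exists>V v S V' v' S' N. (V, v, S) \<in> max_fatlas (X \<times> Y) (prod_fatlas \<A> \<B>) \<and> (V', v', S') \<in> max_fatlas Y \<B> \<and>
      z \<in> N \<and> N \<subseteq> V \<and> snd ` N \<subseteq> V' \<and> frechet_smooth S (v ` N) S' (v' \<circ> snd \<circ> inv_into V v)"
    using prod_fatlas_chart[OF A B c(1) d(1)] fatlas_subset_max[OF B d(1)] c(2) d(2)
    by (intro exI[of _ ?W] exI[of _ ?u] exI[of _ "prod_topology T T'"] exI[of _ W'] exI[of _ u'] exI[of _ T'] conjI)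
      (auto simp: mem_Times_iff)
qed

text \<open>With the two projections this is the universal property of products, which allows
  trivializations to be handled componentwise.\<close>

lemma fsmooth_map_Pair:
  assumes A: "fatlas_on X \<A>" and B: "fatlas_on Y \<B>" and C: "fatlas_on Z \<C>"
    and f: "fsmooth_map Z \<C> X \<A> f" and g: "fsmooth_map Z \<C> Y \<B> g"
  shows "fsmooth_map Z \<C> (X \<times> Y) (prod_fatlas \<A> \<B>) (\<lambda>z. (f z, g z))"
proof (rule fsmooth_mapI[OF C fatlas_on_prod[OF A B]])
  fix z assume z: "z \<in> Z"
  obtain V v S where e: "(V, v, S) \<in> max_fatlas Z \<C>" "z \<in> V" using max_fatlas_covers[OF C z] .
  obtain W u T where c: "(W, u, T) \<in> \<A>" "f z \<in> W"
    using fatlas_onD(3)[OF A fsmooth_map_mem[OF C A f z]] by blast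
  obtain W' u' T' where d: "(W', u', T') \<in> \<B>" "g z \<in> W'"
    using fatlas_onD(3)[OF B fsmooth_map_mem[OF C B g z]] by blast
  note es = fchart_onD[OF max_fatlasD(1)[OF e(1)]]
  note fs = fsmooth_map_max[OF C A f e(1) fatlas_subset_max[OF A c(1)]]
    and gs = fsmooth_map_max[OF C B g e(1) fatlas_subset_max[OF B d(1)]]
  define N where "N = (V \<inter> f -` W) \<inter> (V \<inter> g -` W')"
  have "v ` N = v ` (V \<inter> f -` W) \<inter> v ` (V \<inter> g -` W')"
    unfolding N_def using es(2) by (rule inj_on_image_Int) auto
  then have N: "openin S (v ` N)"
    using frechet_smooth_openin[OF fs] frechet_smooth_openin[OF gs] by (metis openin_Int)
  have "frechet_smooth S (v ` N) (prod_topology T T')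
      (\<lambda>y. ((u \<circ> f \<circ> inv_into V v) y, (u' \<circ> g \<circ> inv_into V v) y))"
    by (rule frechet_smooth_Pair[OF frechet_smooth_subset[OF fs N] frechet_smooth_subset[OF gs N]])
      (auto simp: N_def)
  then have "frechet_smooth S (v ` N) (prod_topology T T') (map_prod u u' \<circ> (\<lambda>z. (f z, g z)) \<circ> inv_into V v)"
    by (rule frechet_smooth_cong) simp
  then show "\<exists>V v S V' v' S' N. (V, v, S) \<in> max_fatlas Z \<C> \<and> (V', v', S') \<in> max_fatlas (X \<times> Y) (prod_fatlas \<A> \<B>) \<and>
      z \<in> N \<and> N \<subseteq> V \<and> (\<lambda>z. (f z, g z)) ` N \<subseteq> V' \<and>
      frechet_smooth S (v ` N) S' (v' \<circ> (\<lambda>z. (f z, g z)) \<circ> inv_into V v)"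
    using e prod_fatlas_chart[OF A B c(1) d(1)] c(2) d(2)
    by (intro exI[of _ V] exI[of _ v] exI[of _ S] exI[of _ "W \<times> W'"] exI[of _ "map_prod u u'"]
        exI[of _ "prod_topology T T'"] exI[of _ N] conjI) (auto simp: N_def)
qed


subsection \<open>Open subsets\<close>

text \<open>Only the domain of the first chart shrinks; symmetry of \<open>fcompat\<close> allows a
  second application for the other chart.\<close>

lemma fcompat_restrict:
  assumes c: "inj_on u W" "openin T (u ` N)" "N \<subseteq> W" and d: "inj_on u' W'"
    and cd: "fcompat (W, u, T) (W', u', T')"
  shows "fcompat (N, u, T) (W', u', T')"
proof -
  have dc: "fcompat (W', u', T') (W, u, T)" using cd fcompat_sym by blast
  have "u ` (N \<inter> (W \<inter> W')) = u ` N \<inter> u ` (W \<inter> W')"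
    using c(1) by (rule inj_on_image_Int) (use c(3) in auto)
  moreover have "N \<inter> (W \<inter> W') = N \<inter> W'" using c(3) by blast
  ultimately have "openin T (u ` (N \<inter> W'))"
    using c(2) frechet_smooth_openin[OF fcompatD[OF cd]] by (metis openin_Int)
  from frechet_smooth_subset[OF fcompatD[OF cd] this]
  have "frechet_smooth T (u ` (N \<inter> W')) T' (u' \<circ> inv_into W u)" using c(3) by blast
  then have 1: "frechet_smooth T (u ` (N \<inter> W')) T' (u' \<circ> inv_into N u)"
  proof (rule frechet_smooth_cong)
    fix y assume "y \<in> u ` (N \<inter> W')"
    then obtain x where "x \<in> N" "y = u x" by blast
    then show "(u' \<circ> inv_into W u) y = (u' \<circ> inv_into N u) y"
      using c(1,3) inj_on_subset[OF c(1,3)] by (simp add: subset_iff)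
  qed
  have "openin T' (u' ` (N \<inter> W'))" by (rule fcompat_openin[OF dc d c(1,3,2)])
  from frechet_smooth_subset[OF fcompatD[OF dc] this]
  have "frechet_smooth T' (u' ` (N \<inter> W')) T (u \<circ> inv_into W' u')" using c(3) by blast
  with 1 show ?thesis by (simp add: fcompat_def)
qed

context
  fixes X :: "'x set" and \<A> :: "('x, 'v::real_vector) fatlas" and V
  assumes A: "fatlas_on X \<A>" and V: "openin (ftop X \<A>) V"
begin

lemma fchart_on_restrict:
  assumes "(W, u, T) \<in> \<A>"
  shows "fchart_on V (W \<inter> V, u, T)"
proof -
  note W = fchart_onD[OF fatlas_onD(1)[OF A assms]]
  have "openin T (u ` (W \<inter> V))"
    using openin_ftop_max[OF A V fatlas_subset_max[OF A assms]] by (simp add: Int_commute)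
  then show ?thesis using W by (auto simp: fchart_on_def intro: inj_on_subset)
qed

lemma fatlas_on_restrict: "fatlas_on V (restrict_fatlas \<A> V)"
  unfolding fatlas_on_def
proof (intro conjI ballI)
  fix c assume "c \<in> restrict_fatlas \<A> V"
  then show "fchart_on V c" using fchart_on_restrict unfolding restrict_fatlas_def by blast
next
  fix c d assume "c \<in> restrict_fatlas \<A> V" "d \<in> restrict_fatlas \<A> V"
  then obtain W u T W' u' T' where c: "c = (W \<inter> V, u, T)" "(W, u, T) \<in> \<A>"
    and d: "d = (W' \<inter> V, u', T')" "(W', u', T') \<in> \<A>" unfolding restrict_fatlas_def by blast
  note cs = fchart_onD[OF fatlas_onD(1)[OF A c(2)]] and ds = fchart_onD[OF fatlas_onD(1)[OF A d(2)]]
  note c' = fchart_onD[OF fchart_on_restrict[OF c(2)]] and d' = fchart_onD[OF fchart_on_restrict[OF d(2)]]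
  have "fcompat (W \<inter> V, u, T) (W', u', T')"
    by (rule fcompat_restrict[OF cs(2) c'(4) _ ds(2) fatlas_onD(2)[OF A c(2) d(2)]]) simp
  then have "fcompat (W' \<inter> V, u', T') (W \<inter> V, u, T)"
    by (intro fcompat_restrict[OF ds(2) d'(4) _ c'(2)]) (simp_all add: fcompat_sym)
  then show "fcompat c d" unfolding c d using fcompat_sym by blast
next
  have "V \<subseteq> X" using openin_subset[OF V] topspace_ftop[OF A] by simp
  show "V = (\<Union>(W, u, T)\<in>restrict_fatlas \<A> V. W)"
  proof (intro equalityI subsetI)
    fix x assume x: "x \<in> V"
    then obtain W u T where "(W, u, T) \<in> \<A>" "x \<in> W" using fatlas_onD(3)[OF A] \<open>V \<subseteq> X\<close> by blast
    then show "x \<in> (\<Union>(W, u, T)\<in>restrict_fatlas \<A> V. W)"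
      using x by (intro UN_I[of "(W \<inter> V, u, T)"]) (auto simp: restrict_fatlas_def)
  qed (auto simp: restrict_fatlas_def)
qed

lemma fsmooth_map_open_inclusion: "fsmooth_map V (restrict_fatlas \<A> V) X \<A> (\<lambda>x. x)"
proof (rule fsmooth_mapI[OF fatlas_on_restrict A])
  fix x assume x: "x \<in> V"
  then have "x \<in> X" using openin_subset[OF V] topspace_ftop[OF A] by auto
  then obtain W u T where c: "(W, u, T) \<in> \<A>" "x \<in> W" using fatlas_onD(3)[OF A] by blast
  have "(W \<inter> V, u, T) \<in> max_fatlas V (restrict_fatlas \<A> V)"
    using c by (intro fatlas_subset_max fatlas_on_restrict) (auto simp: restrict_fatlas_def)
  then show "\<exists>W u T W' u' T' N. (W, u, T) \<in> max_fatlas V (restrict_fatlas \<A> V) \<and> (W', u', T') \<in> max_fatlas X \<A> \<and>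
      x \<in> N \<and> N \<subseteq> W \<and> (\<lambda>x. x) ` N \<subseteq> W' \<and> frechet_smooth T (u ` N) T' (u' \<circ> (\<lambda>x. x) \<circ> inv_into W u)"
    using fatlas_subset_max[OF A c(1)] c(2) x frechet_smooth_chart_ident[OF fchart_on_restrict[OF c(1)]]
    by (intro exI[of _ "W \<inter> V"] exI[of _ u] exI[of _ T] exI[of _ W] conjI) auto
qed

text \<open>With the smooth inclusion this characterizes the restricted atlas, so that later
  arguments about open subsets need no charts.\<close>

lemma fsmooth_map_into_open:
  assumes C: "fatlas_on Z \<C>" and f: "fsmooth_map Z \<C> X \<A> f" and fV: "\<And>z. z \<in> Z \<Longrightarrow> f z \<in> V"
  shows "fsmooth_map Z \<C> V (restrict_fatlas \<A> V) f"
proof (rule fsmooth_mapI[OF C fatlas_on_restrict])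
  fix z assume z: "z \<in> Z"
  obtain W u T where c: "(W, u, T) \<in> max_fatlas Z \<C>" "z \<in> W" using max_fatlas_covers[OF C z] .
  obtain W' u' T' where d: "(W', u', T') \<in> \<A>" "f z \<in> W'"
    using fatlas_onD(3)[OF A fsmooth_map_mem[OF C A f z]] by blast
  have "(W' \<inter> V, u', T') \<in> max_fatlas V (restrict_fatlas \<A> V)"
    using d by (intro fatlas_subset_max fatlas_on_restrict) (auto simp: restrict_fatlas_def)
  moreover have "f ` (W \<inter> f -` W') \<subseteq> W' \<inter> V"
    using fV fchart_onD(1)[OF max_fatlasD(1)[OF c(1)]] by auto
  ultimately show "\<exists>W u T W' u' T' N. (W, u, T) \<in> max_fatlas Z \<C> \<and> (W', u', T') \<in> max_fatlas V (restrict_fatlas \<A> V) \<and>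
      z \<in> N \<and> N \<subseteq> W \<and> f ` N \<subseteq> W' \<and> frechet_smooth T (u ` N) T' (u' \<circ> f \<circ> inv_into W u)"
    using c d(2) fsmooth_map_max[OF C A f c(1) fatlas_subset_max[OF A d(1)]]
    by (intro exI[of _ W] exI[of _ u] exI[of _ T] exI[of _ "W' \<inter> V"] exI[of _ u'] exI[of _ T']
        exI[of _ "W \<inter> f -` W'"] conjI) auto
qed

end


subsection \<open>Codimension one submanifolds\<close>

lemma slice_chartD:
  assumes "slice_chart X \<A> Y (W, u, T) F"
  shows "(W, u, T) \<in> max_fatlas X \<A>" "subspace F" "closedin T F" "u ` (W \<inter> Y) = u ` W \<inter> F"
  using assms by (auto simp: slice_chart_def codim_one_subspace_def)

context
  fixes X :: "'x set" and \<A> :: "('x, 'v::real_vector) fatlas" and Y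
  assumes A: "fatlas_on X \<A>" and Y: "codim_one_submanifold X \<A> Y"
begin

lemma codim_one_submanifold_chart:
  assumes "y \<in> Y"
  obtains W u T F where "y \<in> W" "slice_chart X \<A> Y (W, u, T) F"
  using Y assms unfolding codim_one_submanifold_def by blast

lemma fchart_on_slice:
  assumes "slice_chart X \<A> Y (W, u, T) F"
  shows "fchart_on Y (W \<inter> Y, u, subtopology T F)"
proof -
  note s = slice_chartD[OF assms] and W = fchart_onD[OF max_fatlasD(1)[OF slice_chartD(1)[OF assms]]]
  have "openin (subtopology T F) (u ` (W \<inter> Y))"
    unfolding s(4) using W(4) by (auto simp: openin_subtopology)
  then show ?thesis
    using W s frechet_space_subtopology[OF W(3) s(3,2)] by (auto simp: fchart_on_def intro: inj_on_subset)
qed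

lemma slice_image:
  assumes "slice_chart X \<A> Y (W, u, T) F" "N \<subseteq> W"
  shows "u ` (N \<inter> Y) = u ` N \<inter> F"
proof -
  note s = slice_chartD[OF assms(1)] and W = fchart_onD[OF max_fatlasD(1)[OF slice_chartD(1)[OF assms(1)]]]
  have "u ` (N \<inter> (W \<inter> Y)) = u ` N \<inter> u ` (W \<inter> Y)"
    using W(2) by (rule inj_on_image_Int) (use assms(2) in auto)
  moreover have "N \<inter> (W \<inter> Y) = N \<inter> Y" "u ` N \<inter> (u ` W \<inter> F) = u ` N \<inter> F" using assms(2) by auto
  ultimately show ?thesis by (simp add: s(4))
qed

text \<open>A transition map of the ambient manifold is first restricted to \<open>F\<close>, which
  stays smooth by composition with the inclusion, and then takes its values in the closed subspace
  \<open>F'\<close> because both slices describe the same set \<open>Y\<close>.\<close>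

lemma fcompat_slice:
  assumes c: "slice_chart X \<A> Y (W, u, T) F" and d: "slice_chart X \<A> Y (W', u', T') F'"
  shows "fcompat (W \<inter> Y, u, subtopology T F) (W' \<inter> Y, u', subtopology T' F')"
proof -
  have half: "frechet_smooth (subtopology T F) (u ` ((W \<inter> Y) \<inter> (W' \<inter> Y))) (subtopology T' F') (u' \<circ> inv_into (W \<inter> Y) u)"
    if c: "slice_chart X \<A> Y (W, u, T) F" and d: "slice_chart X \<A> Y (W', u', T') F'" for W u T F W' u' T' F'
  proof -
    note cs = slice_chartD[OF c] and ds = slice_chartD[OF d]
    note C = fchart_onD[OF max_fatlasD(1)[OF cs(1)]] and D = fchart_onD[OF max_fatlasD(1)[OF ds(1)]]
    have inv: "inv_into (W \<inter> Y) u (u x) = x" "inv_into W u (u x) = x" if "x \<in> W \<inter> Y" for x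
      using that C(2) inj_on_subset[OF C(2), of "W \<inter> Y"] by auto
    have "frechet_smooth (subtopology T F) (u ` (W \<inter> W') \<inter> F) T' (u' \<circ> inv_into W u)"
      by (rule frechet_smooth_from_subspace[OF C(3) D(3) cs(3,2) fcompatD[OF max_fatlas_compat[OF A cs(1) ds(1)]]])
    also have "u ` (W \<inter> W') \<inter> F = u ` ((W \<inter> W') \<inter> Y)" using slice_image[OF c Int_lower1] by blast
    also have "(W \<inter> W') \<inter> Y = (W \<inter> Y) \<inter> (W' \<inter> Y)" by blast
    finally have "frechet_smooth (subtopology T F) (u ` ((W \<inter> Y) \<inter> (W' \<inter> Y))) T' (u' \<circ> inv_into W u)" .
    then have "frechet_smooth (subtopology T F) (u ` ((W \<inter> Y) \<inter> (W' \<inter> Y))) (subtopology T' F') (u' \<circ> inv_into W u)"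
      by (rule frechet_smooth_into_subspace[OF frechet_space_subtopology[OF C(3) cs(3,2)] D(3) _ ds(2,3)])
        (use inv ds(4) in auto)
    then show ?thesis by (rule frechet_smooth_cong) (use inv in auto)
  qed
  from half[OF c d] half[OF d c] show ?thesis by (simp add: fcompat_def Int_commute)
qed

lemma fatlas_on_submanifold: "fatlas_on Y (submanifold_fatlas X \<A> Y)"
  unfolding fatlas_on_def
proof (intro conjI ballI)
  fix c assume "c \<in> submanifold_fatlas X \<A> Y"
  then show "fchart_on Y c" using fchart_on_slice unfolding submanifold_fatlas_def by blast
next
  fix c d assume "c \<in> submanifold_fatlas X \<A> Y" "d \<in> submanifold_fatlas X \<A> Y"
  then show "fcompat c d" using fcompat_slice unfolding submanifold_fatlas_def by blast
next
  show "Y = (\<Union>(W, u, T)\<in>submanifold_fatlas X \<A> Y. W)"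
  proof (intro equalityI subsetI)
    fix y assume y: "y \<in> Y"
    then obtain W u T F where "y \<in> W" "slice_chart X \<A> Y (W, u, T) F" by (rule codim_one_submanifold_chart)
    then show "y \<in> (\<Union>(W, u, T)\<in>submanifold_fatlas X \<A> Y. W)"
      using y by (intro UN_I[of "(W \<inter> Y, u, subtopology T F)"]) (auto simp: submanifold_fatlas_def)
  qed (auto simp: submanifold_fatlas_def)
qed

lemma slice_chart_max:
  assumes "slice_chart X \<A> Y (W, u, T) F"
  shows "(W \<inter> Y, u, subtopology T F) \<in> max_fatlas Y (submanifold_fatlas X \<A> Y)"
  using assms by (intro fatlas_subset_max fatlas_on_submanifold) (auto simp: submanifold_fatlas_def)

lemma fsmooth_map_submanifold_inclusion: "fsmooth_map Y (submanifold_fatlas X \<A> Y) X \<A> (\<lambda>x. x)"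
proof (rule fsmooth_mapI[OF fatlas_on_submanifold A])
  fix y assume y: "y \<in> Y"
  then obtain W u T F where c: "y \<in> W" "slice_chart X \<A> Y (W, u, T) F" by (rule codim_one_submanifold_chart)
  note cs = slice_chartD[OF c(2)] and C = fchart_onD[OF fchart_on_slice[OF c(2)]]
  have "frechet_smooth (subtopology T F) (u ` (W \<inter> Y)) T (\<lambda>x. x)"
    by (rule frechet_smooth_linear[OF C(3) fchart_onD(3)[OF max_fatlasD(1)[OF cs(1)]] linear_between_subspace C(4)])
  then have "frechet_smooth (subtopology T F) (u ` (W \<inter> Y)) T (u \<circ> (\<lambda>x. x) \<circ> inv_into (W \<inter> Y) u)"
    by (rule frechet_smooth_cong) (simp add: f_inv_into_f)
  then show "\<exists>W u T W' u' T' N. (W, u, T) \<in> max_fatlas Y (submanifold_fatlas X \<A> Y) \<and> (W', u', T') \<in> max_fatlas X \<A> \<and>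
      y \<in> N \<and> N \<subseteq> W \<and> (\<lambda>x. x) ` N \<subseteq> W' \<and> frechet_smooth T (u ` N) T' (u' \<circ> (\<lambda>x. x) \<circ> inv_into W u)"
    using slice_chart_max[OF c(2)] cs(1) c(1) y
    by (intro exI[of _ "W \<inter> Y"] exI[of _ u] exI[of _ "subtopology T F"] exI[of _ W] exI[of _ T] conjI) auto
qed

text \<open>The inclusion is continuous and injective, so the Hausdorff property is pulled back from
  the ambient manifold.\<close>

lemma frechet_manifold_submanifold:
  assumes "Hausdorff_space (ftop X \<A>)"
  shows "frechet_manifold Y (submanifold_fatlas X \<A> Y)"
proof -
  have "continuous_map (ftop Y (submanifold_fatlas X \<A> Y)) (ftop X \<A>) (\<lambda>x. x)"
    using fsmooth_map_submanifold_inclusion by (simp add: fsmooth_map_def)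
  then have "Hausdorff_space (ftop Y (submanifold_fatlas X \<A> Y))"
    by (intro Hausdorff_space_injective_preimage[OF assms]) (auto simp: inj_on_def)
  then show ?thesis by (simp add: frechet_manifold_iff fatlas_on_submanifold)
qed

text \<open>In a slice chart the coordinate representation takes its values in the closed subspace
  \<open>F\<close>, so its derivatives do as well. Together with the smooth inclusion this is the
  universal property by which every map on \<open>Q0\<close> or \<open>B0\<close> is obtained from
  one on \<open>Q\<close> or \<open>B\<close>.\<close>

lemma fsmooth_map_into_submanifold:
  assumes C: "fatlas_on Z \<C>" and f: "fsmooth_map Z \<C> X \<A> f" and fY: "\<And>z. z \<in> Z \<Longrightarrow> f z \<in> Y"
  shows "fsmooth_map Z \<C> Y (submanifold_fatlas X \<A> Y) f"
proof (rule fsmooth_mapI[OF C fatlas_on_submanifold])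
  fix z assume z: "z \<in> Z"
  obtain W u T where c: "(W, u, T) \<in> max_fatlas Z \<C>" "z \<in> W" using max_fatlas_covers[OF C z] .
  obtain W' u' T' F where d: "f z \<in> W'" "slice_chart X \<A> Y (W', u', T') F"
    using codim_one_submanifold_chart[OF fY[OF z]] .
  note ds = slice_chartD[OF d(2)]
  note cW = fchart_onD[OF max_fatlasD(1)[OF c(1)]]
  have fN: "f ` (W \<inter> f -` W') \<subseteq> W' \<inter> Y" using fY cW(1) by auto
  have "u' y \<in> F" if "y \<in> W' \<inter> Y" for y using ds(4) that by blast
  then have uf: "u' (f y) \<in> F" if "y \<in> W \<inter> f -` W'" for y using fN that by blast
  have "frechet_smooth T (u ` (W \<inter> f -` W')) (subtopology T' F) (u' \<circ> f \<circ> inv_into W u)"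
    by (rule frechet_smooth_into_subspace[OF cW(3) fchart_onD(3)[OF max_fatlasD(1)[OF ds(1)]]
          fsmooth_map_max[OF C A f c(1) ds(1)] ds(2,3)])
      (use uf inv_into_f_f[OF cW(2)] in auto)
  then show "\<exists>W u T W' u' T' N. (W, u, T) \<in> max_fatlas Z \<C> \<and> (W', u', T') \<in> max_fatlas Y (submanifold_fatlas X \<A> Y) \<and>
      z \<in> N \<and> N \<subseteq> W \<and> f ` N \<subseteq> W' \<and> frechet_smooth T (u ` N) T' (u' \<circ> f \<circ> inv_into W u)"
    using c d(1) slice_chart_max[OF d(2)] fN
    by (intro exI[of _ W] exI[of _ u] exI[of _ T] exI[of _ "W' \<inter> Y"] exI[of _ u'] exI[of _ "subtopology T' F"]
        exI[of _ "W \<inter> f -` W'"] conjI) auto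
qed

end

section \<open>Principal bundles\<close>

text \<open>After \<open>\<Psi>\<close>, the product chart \<open>up\<close> already turns the
  projection into \<open>snd\<close>, but its values lie in a product of two model spaces and not in
  the model space \<open>Tq\<close> of a chart of \<open>Q\<close>. A linear isomorphism between the
  two spaces repairs this and leaves the projection linear.\<close>

lemma local_trivialization_submersion:
  assumes G: "fatlas_on K \<K>" and Q: "fatlas_on Q \<Q>" and B: "fatlas_on B \<B>"
    and \<pi>: "fsmooth_map Q \<Q> B \<B> \<pi>" and U: "openin (ftop B \<B>) U" and P_def: "P = Q \<inter> \<pi> -` U" and x: "x \<in> P"
    and \<Psi>: "fdiffeo P (restrict_fatlas \<Q> P) (K \<times> U) (prod_fatlas \<K> (restrict_fatlas \<B> U)) \<Psi>"
    and snd\<Psi>: "\<And>q. q \<in> P \<Longrightarrow> snd (\<Psi> q) = \<pi> q"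
  shows "\<exists>W u T W' u' T' L s. (W, u, T) \<in> max_fatlas Q \<Q> \<and> (W', u', T') \<in> max_fatlas B \<B> \<and> x \<in> W \<and> \<pi> ` W \<subseteq> W' \<and>
        linear_between T T' L \<and> linear_between T' T s \<and> (\<forall>z\<in>topspace T'. L (s z) = z) \<and>
        (\<forall>q\<in>W. u' (\<pi> q) = L (u q))"
proof -
  have P: "openin (ftop Q \<Q>) P" unfolding P_def by (rule fsmooth_map_openin[OF Q B \<pi> U])
  note PA = fatlas_on_restrict[OF Q P] and UA = fatlas_on_restrict[OF B U]
  note KU = fatlas_on_prod[OF G UA]
  define \<Phi> where "\<Phi> = inv_into P \<Psi>"
  have \<Psi>s: "fsmooth_map P (restrict_fatlas \<Q> P) (K \<times> U) (prod_fatlas \<K> (restrict_fatlas \<B> U)) \<Psi>"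
    and bij: "bij_betw \<Psi> P (K \<times> U)"
    and \<Phi>s: "fsmooth_map (K \<times> U) (prod_fatlas \<K> (restrict_fatlas \<B> U)) P (restrict_fatlas \<Q> P) \<Phi>"
    using \<Psi> unfolding fdiffeo_def \<Phi>_def by blast+
  have \<Psi>mem: "\<Psi> q \<in> K \<times> U" if "q \<in> P" for q using bij that by (auto simp: bij_betw_def)
  have \<Phi>\<Psi>: "\<Phi> (\<Psi> q) = q" if "q \<in> P" for q
    using bij that unfolding \<Phi>_def by (rule bij_betw_inv_into_left)
  have \<Psi>\<Phi>: "\<Psi> (\<Phi> w) = w" and \<Phi>mem: "\<Phi> w \<in> P" if "w \<in> K \<times> U" for w
    using bij_betw_inv_into_right[OF bij that] bij_betw_inv_into[OF bij] that
    unfolding \<Phi>_def by (auto simp: bij_betw_def)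
  have xQ: "x \<in> Q" and \<pi>x: "\<pi> x \<in> B" using x fsmooth_map_mem[OF Q B \<pi>] by (auto simp: P_def)
  have "fst (\<Psi> x) \<in> K" using \<Psi>mem[OF x] by auto
  then obtain Wg ug Tg where cg: "(Wg, ug, Tg) \<in> \<K>" "fst (\<Psi> x) \<in> Wg" using fatlas_onD(3)[OF G] by blast
  obtain Wb ub Tb where cb: "(Wb, ub, Tb) \<in> \<B>" "\<pi> x \<in> Wb" using fatlas_onD(3)[OF B \<pi>x] by blast
  obtain Wq uq Tq where cq: "(Wq, uq, Tq) \<in> \<Q>" "x \<in> Wq" using fatlas_onD(3)[OF Q xQ] by blast
  have cbU: "(Wb \<inter> U, ub, Tb) \<in> restrict_fatlas \<B> U" and cqP: "(Wq \<inter> P, uq, Tq) \<in> restrict_fatlas \<Q> P"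
    using cb(1) cq(1) unfolding restrict_fatlas_def by blast+
  note g = fchart_onD[OF fatlas_onD(1)[OF G cg(1)]] and b = fchart_onD[OF fatlas_onD(1)[OF UA cbU]]
    and q = fchart_onD[OF fatlas_onD(1)[OF Q cq(1)]]
  define Wp up Tp where "Wp = Wg \<times> (Wb \<inter> U)" and "up = map_prod ug ub" and "Tp = prod_topology Tg Tb"
  have cp: "(Wp, up, Tp) \<in> max_fatlas (K \<times> U) (prod_fatlas \<K> (restrict_fatlas \<B> U))"
    unfolding Wp_def up_def Tp_def by (rule prod_fatlas_chart[OF G UA cg(1) cbU])
  note p = fchart_onD[OF max_fatlasD(1)[OF cp]]
  \<comment> \<open>The overlap of the two charts, seen as \<open>W\<close> in \<open>Q\<close> and
    as \<open>N\<close> in \<open>K \<times> U\<close>; \<open>\<Psi>\<close> and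
    \<open>\<Phi>\<close> are inverse to each other between them.\<close>
  define W where "W = (Wq \<inter> P) \<inter> \<Psi> -` Wp"
  define N where "N = Wp \<inter> \<Phi> -` (Wq \<inter> P)"
  define \<theta> where "\<theta> = uq \<circ> \<Phi> \<circ> inv_into Wp up"
  define \<theta>' where "\<theta>' = up \<circ> \<Psi> \<circ> inv_into (Wq \<inter> P) uq"
  have \<theta>: "frechet_smooth Tp (up ` N) Tq \<theta>"
    unfolding \<theta>_def N_def by (rule fsmooth_map_max[OF KU PA \<Phi>s cp fatlas_subset_max[OF PA cqP]])
  have \<theta>': "frechet_smooth Tq (uq ` W) Tp \<theta>'"
    unfolding \<theta>'_def W_def by (rule fsmooth_map_max[OF PA KU \<Psi>s fatlas_subset_max[OF PA cqP] cp])
  have WN: "\<Psi> w \<in> N" if "w \<in> W" for w using that \<Phi>\<Psi> by (auto simp: W_def N_def)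
  have NW: "\<Phi> w \<in> W" if "w \<in> N" for w using that \<Psi>\<Phi> p(1) by (auto simp: W_def N_def)
  have \<Psi>\<Phi>N: "\<Psi> (\<Phi> w) = w" if "w \<in> N" for w using that \<Psi>\<Phi> p(1) by (auto simp: N_def)
  have \<Phi>\<Psi>W: "\<Phi> (\<Psi> w) = w" if "w \<in> W" for w using that \<Phi>\<Psi> by (auto simp: W_def)
  have \<theta>_up: "\<theta> (up w) = uq (\<Phi> w)" if "w \<in> N" for w
    using that inv_into_f_f[OF p(2)] by (simp add: \<theta>_def N_def)
  have \<theta>'_uq: "\<theta>' (uq w) = up (\<Psi> w)" if "w \<in> W" for w
    using that inv_into_f_f[OF inj_on_subset[OF q(2) Int_lower1], of w P] by (simp add: \<theta>'_def W_def)
  have xW: "x \<in> W"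
    using x cq(2) cg(2) cb(2) \<Psi>mem[OF x] snd\<Psi>[OF x] by (auto simp: W_def Wp_def mem_Times_iff)
  obtain A A' where A: "linear_between Tp Tq A" "linear_between Tq Tp A'"
    and AA: "\<And>v. v \<in> topspace Tp \<Longrightarrow> A' (A v) = v" "\<And>w. w \<in> topspace Tq \<Longrightarrow> A (A' w) = w"
  proof (rule frechet_smooth_inverse_derivative[OF p(3) q(3) \<theta> \<theta>'])
    show "\<theta> ` up ` N \<subseteq> uq ` W" using \<theta>_up NW by auto
    show "\<theta>' ` uq ` W \<subseteq> up ` N" using \<theta>'_uq WN by auto
    show "\<theta>' (\<theta> y) = y" if "y \<in> up ` N" for y using that \<theta>_up \<theta>'_uq NW \<Psi>\<Phi>N by auto
    show "\<theta> (\<theta>' y) = y" if "y \<in> uq ` W" for y using that \<theta>_up[OF WN] \<theta>'_uq \<Phi>\<Psi>W by auto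
    show "up (\<Psi> x) \<in> up ` N" using WN[OF xW] by blast
  qed (rule that)
  \<comment> \<open>\<open>A\<close> stems from the derivative at the single point
    \<open>up (\<Psi> x)\<close>, but from here on only its being a linear isomorphism matters: it
    transports the whole chart to \<open>Tq\<close>.\<close>
  define v where "v = A \<circ> up \<circ> \<Psi>"
  have upN: "openin Tp (up ` N)" using \<theta> by (rule frechet_smooth_openin)
  have upT: "up w \<in> topspace Tp" if "w \<in> N" for w using openin_subset[OF upN] that by blast
  have A'v: "A' (v w) = up (\<Psi> w)" if "w \<in> W" for w using AA(1)[OF upT[OF WN[OF that]]] by (simp add: v_def)
  \<comment> \<open>The image under \<open>A\<close> is the preimage under its continuous inverse
    \<open>A'\<close>, and therefore open.\<close>
  have vW: "v ` W = {y \<in> topspace Tq. A' y \<in> up ` N}"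
  proof (intro equalityI subsetI)
    fix y assume "y \<in> v ` W"
    then obtain w where w: "w \<in> W" "y = v w" by blast
    then show "y \<in> {y \<in> topspace Tq. A' y \<in> up ` N}"
      using linear_between_mem[OF A(1) upT[OF WN[OF w(1)]]] A'v[OF w(1)] WN[OF w(1)] by (auto simp: v_def)
  next
    fix y assume "y \<in> {y \<in> topspace Tq. A' y \<in> up ` N}"
    then obtain n where n: "y \<in> topspace Tq" "n \<in> N" "A' y = up n" by blast
    then have "y = v (\<Phi> n)" using AA(2)[OF n(1)] \<Psi>\<Phi>N[OF n(2)] by (simp add: v_def)
    then show "y \<in> v ` W" using NW[OF n(2)] by blast
  qed
  have "continuous_map Tq Tp A'" using A(2) by (simp add: linear_between_def)
  then have vWo: "openin Tq (v ` W)" unfolding vW using upN by (rule openin_continuous_map_preimage)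
  have inj: "inj_on v W"
  proof (rule inj_onI)
    fix w z assume wz: "w \<in> W" "z \<in> W" "v w = v z"
    then have "up (\<Psi> w) = up (\<Psi> z)" using A'v by metis
    moreover have "\<Psi> w \<in> Wp" "\<Psi> z \<in> Wp" using wz by (auto simp: W_def)
    ultimately have "\<Psi> w = \<Psi> z" using p(2) by (auto dest: inj_onD)
    then show "w = z" using \<Phi>\<Psi>W wz by metis
  qed
  have WQ: "W \<subseteq> Wq" by (auto simp: W_def)
  have chart: "fchart_on Q (W, v, Tq)"
    using WQ q(1,3) inj vWo by (auto simp: fchart_on_def)
  \<comment> \<open>Both transitions factor through known ones: \<open>\<theta> \<circ> A'\<close>
    leads from \<open>v\<close> to \<open>uq\<close>, and \<open>A \<circ> \<theta>'\<close> leads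
    back.\<close>
  have "fcompat (W, v, Tq) (Wq, uq, Tq)"
  proof -
    have "frechet_smooth Tq (v ` W) Tq (\<theta> \<circ> A')"
      by (rule frechet_smooth_compose[OF q(3) p(3) q(3) frechet_smooth_linear[OF q(3) p(3) A(2) vWo] \<theta>])
        (use A'v WN in auto)
    then have 1: "frechet_smooth Tq (v ` W) Tq (uq \<circ> inv_into W v)"
    proof (rule frechet_smooth_cong)
      fix y assume "y \<in> v ` W"
      then obtain w where w: "w \<in> W" "y = v w" by blast
      then show "(\<theta> \<circ> A') y = (uq \<circ> inv_into W v) y"
        using A'v[OF w(1)] \<theta>_up[OF WN[OF w(1)]] \<Phi>\<Psi>W[OF w(1)] inv_into_f_f[OF inj w(1)] by simp
    qed
    have "frechet_smooth Tp (up ` N) Tq A" by (rule frechet_smooth_linear[OF p(3) q(3) A(1) upN])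
    then have "frechet_smooth Tq (uq ` W) Tq (A \<circ> \<theta>')"
      by (rule frechet_smooth_compose[OF q(3) p(3) q(3) \<theta>']) (use \<theta>'_uq WN in auto)
    then have 2: "frechet_smooth Tq (uq ` W) Tq (v \<circ> inv_into Wq uq)"
    proof (rule frechet_smooth_cong)
      fix y assume "y \<in> uq ` W"
      then obtain w where w: "w \<in> W" "y = uq w" by blast
      then show "(A \<circ> \<theta>') y = (v \<circ> inv_into Wq uq) y"
        using \<theta>'_uq[OF w(1)] inv_into_f_f[OF q(2) subsetD[OF WQ w(1)]] by (simp add: v_def)
    qed
    show ?thesis using 1 2 WQ by (simp add: fcompat_def Int_absorb2)
  qed
  then have max: "(W, v, Tq) \<in> max_fatlas Q \<Q>"
    using fatlas_subset_max[OF Q cq(1)] WQ by (intro max_fatlasI[OF Q chart]) blast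
  \<comment> \<open>In the chart \<open>v\<close> the projection is: undo \<open>A\<close>, then
    drop the group coordinate. Its section fills the group coordinate with 0 and applies
    \<open>A\<close>.\<close>
  have L: "linear_between Tq Tb (snd \<circ> A')"
    by (rule linear_between_compose[OF A(2)[unfolded Tp_def] linear_between_snd])
  have s: "linear_between Tb Tq (A \<circ> (\<lambda>z. (0, z)))"
    by (rule linear_between_compose[OF linear_between_zero_Pair[OF g(3)] A(1)[unfolded Tp_def]])
  have Ls: "(snd \<circ> A') ((A \<circ> (\<lambda>z. (0, z))) z) = z" if "z \<in> topspace Tb" for z
    using AA(1)[of "(0, z)"] that frechet_space_mem(1)[OF g(3)] by (simp add: Tp_def)
  have \<pi>W: "\<pi> ` W \<subseteq> Wb"
  proof (rule image_subsetI)
    fix w assume "w \<in> W"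
    then show "\<pi> w \<in> Wb" using snd\<Psi>[of w] by (simp add: W_def Wp_def mem_Times_iff)
  qed
  have "ub (\<pi> w) = (snd \<circ> A') (v w)" if "w \<in> W" for w
    using A'v[OF that] snd\<Psi>[of w] that by (simp add: up_def W_def)
  then show ?thesis
    using max fatlas_subset_max[OF B cb(1)] xW \<pi>W L s Ls
    by (intro exI[of _ W] exI[of _ v] exI[of _ Tq] exI[of _ Wb] exI[of _ ub] exI[of _ Tb]
        exI[of _ "snd \<circ> A'"] exI[of _ "A \<circ> (\<lambda>z. (0, z))"] conjI) auto
qed

text \<open>No charts appear here; smoothness is moved between the manifolds by inclusions and by
  the universal properties of open subsets, submanifolds and products. As
  \<open>K \<times> (U \<inter> B0)\<close> carries a product atlas and not that of a submanifold of
  \<open>K \<times> U\<close>, maps into it are split into components and only the second one is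
  pushed into \<open>B0\<close>.\<close>

lemma fdiffeo_restrict_trivialization:
  assumes G: "fatlas_on K \<K>" and Q: "fatlas_on Q \<Q>" and B: "fatlas_on B \<B>"
    and Q0: "codim_one_submanifold Q \<Q> Q0" and B0: "codim_one_submanifold B \<B> B0"
    and Q0_eq: "Q0 = Q \<inter> \<pi> -` B0" and \<pi>: "fsmooth_map Q \<Q> B \<B> \<pi>" and U: "openin (ftop B \<B>) U"
    and \<Psi>: "fdiffeo (Q \<inter> \<pi> -` U) (restrict_fatlas \<Q> (Q \<inter> \<pi> -` U)) (K \<times> U) (prod_fatlas \<K> (restrict_fatlas \<B> U)) \<Psi>"
    and snd\<Psi>: "\<And>q. q \<in> Q \<inter> \<pi> -` U \<Longrightarrow> snd (\<Psi> q) = \<pi> q"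
  defines "\<Q>0 \<equiv> submanifold_fatlas Q \<Q> Q0" and "\<B>0 \<equiv> submanifold_fatlas B \<B> B0"
  shows "openin (ftop B0 \<B>0) (U \<inter> B0)"
    and "fsmooth_map Q0 \<Q>0 B0 \<B>0 \<pi>"
    and "fdiffeo (Q0 \<inter> \<pi> -` (U \<inter> B0)) (restrict_fatlas \<Q>0 (Q0 \<inter> \<pi> -` (U \<inter> B0)))
      (K \<times> (U \<inter> B0)) (prod_fatlas \<K> (restrict_fatlas \<B>0 (U \<inter> B0))) \<Psi>"
proof -
  define P where "P = Q \<inter> \<pi> -` U"
  define P0 where "P0 = Q0 \<inter> \<pi> -` (U \<inter> B0)"
  let ?UR = "restrict_fatlas \<B> U" and ?URz = "restrict_fatlas \<B>0 (U \<inter> B0)"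
    and ?PR = "restrict_fatlas \<Q> P" and ?PRz = "restrict_fatlas \<Q>0 P0"
  have Q0A: "fatlas_on Q0 \<Q>0" and B0A: "fatlas_on B0 \<B>0"
    unfolding \<Q>0_def \<B>0_def by (rule fatlas_on_submanifold[OF Q Q0], rule fatlas_on_submanifold[OF B B0])
  have iQ: "fsmooth_map Q0 \<Q>0 Q \<Q> (\<lambda>x. x)" and iB: "fsmooth_map B0 \<B>0 B \<B> (\<lambda>x. x)"
    unfolding \<Q>0_def \<B>0_def
    by (rule fsmooth_map_submanifold_inclusion[OF Q Q0], rule fsmooth_map_submanifold_inclusion[OF B B0])
  have B0sub: "B0 \<subseteq> B" using B0 by (simp add: codim_one_submanifold_def)
  have P: "openin (ftop Q \<Q>) P" unfolding P_def by (rule fsmooth_map_openin[OF Q B \<pi> U])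
  have "openin (ftop B0 \<B>0) (B0 \<inter> (\<lambda>x. x) -` U)" by (rule fsmooth_map_openin[OF B0A B iB U])
  then show U0: "openin (ftop B0 \<B>0) (U \<inter> B0)" by (simp add: Int_commute)
  have "fsmooth_map Q0 \<Q>0 B \<B> (\<pi> \<circ> (\<lambda>x. x))" by (rule fsmooth_map_compose[OF Q0A Q B iQ \<pi>])
  then show \<pi>0: "fsmooth_map Q0 \<Q>0 B0 \<B>0 \<pi>"
    unfolding \<B>0_def by (intro fsmooth_map_into_submanifold[OF B B0 Q0A]) (auto simp: o_def Q0_eq)
  have P0: "openin (ftop Q0 \<Q>0) P0" unfolding P0_def by (rule fsmooth_map_openin[OF Q0A B0A \<pi>0 U0])
  note PA = fatlas_on_restrict[OF Q P] and UA = fatlas_on_restrict[OF B U]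
    and P0A = fatlas_on_restrict[OF Q0A P0] and U0A = fatlas_on_restrict[OF B0A U0]
  note KU = fatlas_on_prod[OF G UA] and KU0 = fatlas_on_prod[OF G U0A]
  have P0P: "P0 = P \<inter> \<pi> -` B0" by (auto simp: P0_def P_def Q0_eq)
  define \<Phi> where "\<Phi> = inv_into P \<Psi>"
  have \<Psi>s: "fsmooth_map P ?PR (K \<times> U) (prod_fatlas \<K> ?UR) \<Psi>" and bij: "bij_betw \<Psi> P (K \<times> U)"
    and \<Phi>s: "fsmooth_map (K \<times> U) (prod_fatlas \<K> ?UR) P ?PR \<Phi>"
    using \<Psi> unfolding fdiffeo_def \<Phi>_def P_def by blast+
  have \<Psi>mem: "\<Psi> q \<in> K \<times> U" if "q \<in> P" for q using bij that by (auto simp: bij_betw_def)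
  have \<Psi>\<Phi>: "\<Psi> (\<Phi> w) = w" and \<Phi>mem: "\<Phi> w \<in> P" if "w \<in> K \<times> U" for w
    using bij_betw_inv_into_right[OF bij that] bij_betw_inv_into[OF bij] that
    unfolding \<Phi>_def by (auto simp: bij_betw_def)
  \<comment> \<open>Compatibility with the projections passes to the inverse; hence
    \<open>\<Phi>\<close> takes pairs over \<open>B0\<close> into \<open>Q0\<close>.\<close>
  have \<pi>\<Phi>: "\<pi> (\<Phi> w) = snd w" if "w \<in> K \<times> U" for w
    using snd\<Psi>[of "\<Phi> w"] \<Phi>mem[OF that] \<Psi>\<Phi>[OF that] by (simp add: P_def)
  have \<Phi>0: "\<Phi> w \<in> P0" if "w \<in> K \<times> (U \<inter> B0)" for w
    using that \<Phi>mem[of w] \<pi>\<Phi>[of w] by (auto simp: P0P)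
  have bij0: "bij_betw \<Psi> P0 (K \<times> (U \<inter> B0))"
  proof (rule bij_betw_imageI)
    show "inj_on \<Psi> P0" using bij by (auto simp: bij_betw_def P0P intro: inj_on_subset)
    show "\<Psi> ` P0 = K \<times> (U \<inter> B0)"
    proof (intro equalityI subsetI)
      fix w assume "w \<in> \<Psi> ` P0"
      then obtain q where q: "q \<in> P" "\<pi> q \<in> B0" "w = \<Psi> q" by (auto simp: P0P)
      then show "w \<in> K \<times> (U \<inter> B0)"
        using \<Psi>mem[OF q(1)] snd\<Psi>[of q] by (auto simp: P_def mem_Times_iff)
    next
      fix w assume w: "w \<in> K \<times> (U \<inter> B0)"
      then have "\<Psi> (\<Phi> w) = w" using \<Psi>\<Phi>[of w] by auto
      then show "w \<in> \<Psi> ` P0" using \<Phi>0[OF w] by (metis imageI)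
    qed
  qed
  \<comment> \<open>The identities are inclusions between different manifolds: of \<open>P0\<close>
    into \<open>Q0\<close>, and of \<open>Q0\<close> into \<open>Q\<close>.\<close>
  have "fsmooth_map P0 ?PRz Q \<Q> ((\<lambda>x. x) \<circ> (\<lambda>x. x))"
    by (rule fsmooth_map_compose[OF P0A Q0A Q fsmooth_map_open_inclusion[OF Q0A P0] iQ])
  then have "fsmooth_map P0 ?PRz P ?PR (\<lambda>x. x)"
    by (intro fsmooth_map_into_open[OF Q P P0A]) (auto simp: o_def P0P)
  then have \<Psi>P0: "fsmooth_map P0 ?PRz (K \<times> U) (prod_fatlas \<K> ?UR) (\<Psi> \<circ> (\<lambda>x. x))"
    by (rule fsmooth_map_compose[OF P0A PA KU _ \<Psi>s])
  have 1: "fsmooth_map P0 ?PRz K \<K> (fst \<circ> (\<Psi> \<circ> (\<lambda>x. x)))"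
    by (rule fsmooth_map_compose[OF P0A KU G \<Psi>P0 fsmooth_map_fst[OF G UA]])
  have "fsmooth_map P0 ?PRz B \<B> ((\<lambda>x. x) \<circ> (snd \<circ> (\<Psi> \<circ> (\<lambda>x. x))))"
    by (rule fsmooth_map_compose[OF P0A UA B fsmooth_map_compose[OF P0A KU UA \<Psi>P0 fsmooth_map_snd[OF G UA]]
          fsmooth_map_open_inclusion[OF B U]])
  then have "fsmooth_map P0 ?PRz B0 \<B>0 ((\<lambda>x. x) \<circ> (snd \<circ> (\<Psi> \<circ> (\<lambda>x. x))))"
    unfolding \<B>0_def by (rule fsmooth_map_into_submanifold[OF B B0 P0A]) (use snd\<Psi> in \<open>auto simp: P0P P_def\<close>)
  then have 2: "fsmooth_map P0 ?PRz (U \<inter> B0) ?URz ((\<lambda>x. x) \<circ> (snd \<circ> (\<Psi> \<circ> (\<lambda>x. x))))"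
    by (rule fsmooth_map_into_open[OF B0A U0 P0A]) (use snd\<Psi> in \<open>auto simp: P0P P_def\<close>)
  from fsmooth_map_Pair[OF G U0A P0A 1 2]
  have \<Psi>0s: "fsmooth_map P0 ?PRz (K \<times> (U \<inter> B0)) (prod_fatlas \<K> ?URz) \<Psi>"
    by (simp add: o_def)
  have "fsmooth_map (K \<times> (U \<inter> B0)) (prod_fatlas \<K> ?URz) B \<B> ((\<lambda>x. x) \<circ> ((\<lambda>x. x) \<circ> snd))"
    by (rule fsmooth_map_compose[OF KU0 B0A B fsmooth_map_compose[OF KU0 U0A B0A fsmooth_map_snd[OF G U0A]
          fsmooth_map_open_inclusion[OF B0A U0]] iB])
  then have "fsmooth_map (K \<times> (U \<inter> B0)) (prod_fatlas \<K> ?URz) U ?UR ((\<lambda>x. x) \<circ> ((\<lambda>x. x) \<circ> snd))"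
    by (rule fsmooth_map_into_open[OF B U KU0]) auto
  from fsmooth_map_Pair[OF G UA KU0 fsmooth_map_fst[OF G U0A] this]
  have "fsmooth_map (K \<times> (U \<inter> B0)) (prod_fatlas \<K> ?URz) (K \<times> U) (prod_fatlas \<K> ?UR) (\<lambda>x. x)"
    by (simp add: o_def)
  then have "fsmooth_map (K \<times> (U \<inter> B0)) (prod_fatlas \<K> ?URz) Q \<Q> ((\<lambda>x. x) \<circ> (\<Phi> \<circ> (\<lambda>x. x)))"
    by (rule fsmooth_map_compose[OF KU0 PA Q fsmooth_map_compose[OF KU0 KU PA _ \<Phi>s]
          fsmooth_map_open_inclusion[OF Q P]])
  then have "fsmooth_map (K \<times> (U \<inter> B0)) (prod_fatlas \<K> ?URz) Q0 \<Q>0 ((\<lambda>x. x) \<circ> (\<Phi> \<circ> (\<lambda>x. x)))"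
    unfolding \<Q>0_def by (rule fsmooth_map_into_submanifold[OF Q Q0 KU0]) (use \<Phi>0 in \<open>auto simp: P0_def\<close>)
  then have \<Phi>0s: "fsmooth_map (K \<times> (U \<inter> B0)) (prod_fatlas \<K> ?URz) P0 ?PRz ((\<lambda>x. x) \<circ> (\<Phi> \<circ> (\<lambda>x. x)))"
    by (rule fsmooth_map_into_open[OF Q0A P0 KU0]) (use \<Phi>0 in auto)
  \<comment> \<open>\<open>inv_into P0 \<Psi>\<close> and \<open>\<Phi>\<close>, the inverse on the
    larger set \<open>P\<close>, are known to agree only on
    \<open>K \<times> (U \<inter> B0)\<close>.\<close>
  have "fsmooth_map (K \<times> (U \<inter> B0)) (prod_fatlas \<K> ?URz) P0 ?PRz (inv_into P0 \<Psi>)"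
  proof (rule fsmooth_map_cong[OF KU0 \<Phi>0s])
    fix w assume w: "w \<in> K \<times> (U \<inter> B0)"
    have "inv_into P0 \<Psi> (\<Psi> (\<Phi> w)) = \<Phi> w"
      by (rule bij_betw_inv_into_left[OF bij0 \<Phi>0[OF w]])
    then show "((\<lambda>x. x) \<circ> (\<Phi> \<circ> (\<lambda>x. x))) w = inv_into P0 \<Psi> w" using \<Psi>\<Phi>[of w] w by auto
  qed
  then show "fdiffeo (Q0 \<inter> \<pi> -` (U \<inter> B0)) (restrict_fatlas \<Q>0 (Q0 \<inter> \<pi> -` (U \<inter> B0)))
      (K \<times> (U \<inter> B0)) (prod_fatlas \<K> (restrict_fatlas \<B>0 (U \<inter> B0))) \<Psi>"
    using \<Psi>0s bij0 unfolding fdiffeo_def P0_def by blast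
qed

section \<open>Restriction of the bundle\<close>

definition local_trivialization ::
  "'g monoid \<Rightarrow> ('g, 'u::real_vector) fatlas \<Rightarrow> 'q set \<Rightarrow> ('q, 'v::real_vector) fatlas
    \<Rightarrow> ('q \<Rightarrow> 'g \<Rightarrow> 'q) \<Rightarrow> 'b set \<Rightarrow> ('b, 'w::real_vector) fatlas \<Rightarrow> ('q \<Rightarrow> 'b) \<Rightarrow> 'b set \<Rightarrow> ('q \<Rightarrow> 'g \<times> 'b) \<Rightarrow> bool" where
  "local_trivialization G \<G> Q \<Q> act B \<B> \<pi> U \<Psi> \<longleftrightarrow> openin (ftop B \<B>) U \<and>
     fdiffeo (Q \<inter> \<pi> -` U) (restrict_fatlas \<Q> (Q \<inter> \<pi> -` U))
       (carrier G \<times> U) (prod_fatlas \<G> (restrict_fatlas \<B> U)) \<Psi> \<and>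
     (\<forall>q\<in>Q \<inter> \<pi> -` U. snd (\<Psi> q) = \<pi> q \<and>
       (\<forall>a\<in>carrier G. \<Psi> (act q a) = (fst (\<Psi> q) \<otimes>\<^bsub>G\<^esub> a, snd (\<Psi> q))))"

lemma local_trivializationD:
  assumes "local_trivialization G \<G> Q \<Q> act B \<B> \<pi> U \<Psi>"
  shows "openin (ftop B \<B>) U"
    "fdiffeo (Q \<inter> \<pi> -` U) (restrict_fatlas \<Q> (Q \<inter> \<pi> -` U))
       (carrier G \<times> U) (prod_fatlas \<G> (restrict_fatlas \<B> U)) \<Psi>"
    "\<And>q. q \<in> Q \<inter> \<pi> -` U \<Longrightarrow> snd (\<Psi> q) = \<pi> q"
    "\<And>q a. q \<in> Q \<inter> \<pi> -` U \<Longrightarrow> a \<in> carrier G \<Longrightarrow> \<Psi> (act q a) = (fst (\<Psi> q) \<otimes>\<^bsub>G\<^esub> a, snd (\<Psi> q))"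
  using assms unfolding local_trivialization_def by simp_all

lemma principal_bundle_iff:
  "principal_bundle G \<G> Q \<Q> act B \<B> \<pi> \<longleftrightarrow>
     frechet_lie_group G \<G> \<and> frechet_manifold Q \<Q> \<and> frechet_manifold B \<B> \<and>
     smooth_right_action G \<G> Q \<Q> act \<and> submersion Q \<Q> B \<B> \<pi> \<and> \<pi> ` Q = B \<and>
     (\<forall>b\<in>B. \<exists>U \<Psi>. b \<in> U \<and> local_trivialization G \<G> Q \<Q> act B \<B> \<pi> U \<Psi>)"
  by (simp only: principal_bundle_def local_trivialization_def)

text \<open>Trivializations are restricted first, and the submersion property is then drawn from the
  restricted ones. Invariance of the projection under the action is stated separately because
  equivariance of \<open>\<Psi>\<close> determines \<open>\<pi> (act q a)\<close> only if
  \<open>act q a\<close> is known to lie over \<open>U\<close>.\<close>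

theorem principal_bundle_codim_one_restriction:
  assumes pb: "principal_bundle G \<G> Q \<Q> act B \<B> \<pi>"
    and Q0: "codim_one_submanifold Q \<Q> Q0" and B0: "codim_one_submanifold B \<B> B0"
    and Q0_eq: "Q0 = Q \<inter> \<pi> -` B0"
    and act: "\<And>q a. q \<in> Q \<Longrightarrow> a \<in> carrier G \<Longrightarrow> \<pi> (act q a) = \<pi> q"
  shows "principal_bundle G \<G> Q0 (submanifold_fatlas Q \<Q> Q0) act B0 (submanifold_fatlas B \<B> B0) \<pi>"
proof -
  let ?Qz = "submanifold_fatlas Q \<Q> Q0" and ?Bz = "submanifold_fatlas B \<B> B0"
  have lie: "frechet_lie_group G \<G>" and Qm: "frechet_manifold Q \<Q>" and Bm: "frechet_manifold B \<B>"
    and sact: "smooth_right_action G \<G> Q \<Q> act" and subm: "submersion Q \<Q> B \<B> \<pi>" and \<pi>Q: "\<pi> ` Q = B"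
    and triv: "\<forall>b\<in>B. \<exists>U \<Psi>. b \<in> U \<and> local_trivialization G \<G> Q \<Q> act B \<B> \<pi> U \<Psi>"
    using pb unfolding principal_bundle_iff by - (elim conjE, assumption)+
  have G: "fatlas_on (carrier G) \<G>" and Q: "fatlas_on Q \<Q>" and B: "fatlas_on B \<B>"
    using lie Qm Bm by (auto simp: frechet_lie_group_def frechet_manifold_iff)
  have \<pi>: "fsmooth_map Q \<Q> B \<B> \<pi>" using subm by (simp add: submersion_def)
  have Q0sub: "Q0 \<subseteq> Q" by (simp add: Q0_eq)
  have B0sub: "B0 \<subseteq> B" using B0 by (simp add: codim_one_submanifold_def)
  note Q0A = fatlas_on_submanifold[OF Q Q0] and B0A = fatlas_on_submanifold[OF B B0]
  have triv0: "\<exists>U \<Psi>. b \<in> U \<and> local_trivialization G \<G> Q0 ?Qz act B0 ?Bz \<pi> U \<Psi>" if b: "b \<in> B0" for b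
  proof -
    obtain U \<Psi> where U: "b \<in> U" and \<Psi>: "local_trivialization G \<G> Q \<Q> act B \<B> \<pi> U \<Psi>"
      using triv b B0sub by blast
    note D = local_trivializationD[OF \<Psi>]
    note r = fdiffeo_restrict_trivialization[OF G Q B Q0 B0 Q0_eq \<pi> D(1-3)]
    have "local_trivialization G \<G> Q0 ?Qz act B0 ?Bz \<pi> (U \<inter> B0) \<Psi>"
      unfolding local_trivialization_def
    proof (intro conjI ballI r(1,3))
      fix q assume "q \<in> Q0 \<inter> \<pi> -` (U \<inter> B0)"
      then have q: "q \<in> Q \<inter> \<pi> -` U" using Q0sub by blast
      show "snd (\<Psi> q) = \<pi> q" using D(3)[OF q] .
      show "\<Psi> (act q a) = (fst (\<Psi> q) \<otimes>\<^bsub>G\<^esub> a, snd (\<Psi> q))" if "a \<in> carrier G" for a using D(4)[OF q that] .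
    qed
    then show ?thesis using U b by blast
  qed
  have iQ: "fsmooth_map Q0 ?Qz Q \<Q> (\<lambda>x. x)" by (rule fsmooth_map_submanifold_inclusion[OF Q Q0])
  have "fsmooth_map Q0 ?Qz B \<B> (\<pi> \<circ> (\<lambda>x. x))" by (rule fsmooth_map_compose[OF Q0A Q B iQ \<pi>])
  then have \<pi>0: "fsmooth_map Q0 ?Qz B0 ?Bz \<pi>"
    by (intro fsmooth_map_into_submanifold[OF B B0 Q0A]) (auto simp: o_def Q0_eq)
  have "submersion Q0 ?Qz B0 ?Bz \<pi>"
    unfolding submersion_def
  proof (intro conjI ballI \<pi>0)
    fix x assume x: "x \<in> Q0"
    then have "\<pi> x \<in> B0" by (simp add: Q0_eq)
    then obtain U \<Psi> where U: "\<pi> x \<in> U" and \<Psi>: "local_trivialization G \<G> Q0 ?Qz act B0 ?Bz \<pi> U \<Psi>"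
      using triv0 by blast
    note D = local_trivializationD[OF \<Psi>]
    show "\<exists>W u T W' u' T' L s. (W, u, T) \<in> max_fatlas Q0 ?Qz \<and> (W', u', T') \<in> max_fatlas B0 ?Bz \<and>
        x \<in> W \<and> \<pi> ` W \<subseteq> W' \<and> linear_between T T' L \<and> linear_between T' T s \<and>
        (\<forall>z\<in>topspace T'. L (s z) = z) \<and> (\<forall>q\<in>W. u' (\<pi> q) = L (u q))"
      by (rule local_trivialization_submersion[OF G Q0A B0A \<pi>0 D(1) refl _ D(2,3)]) (use x U in auto)
  qed
  moreover have "smooth_right_action G \<G> Q0 ?Qz act"
    unfolding smooth_right_action_def
  proof (intro conjI)
    note KA = fatlas_on_prod[OF Q G] and K0A = fatlas_on_prod[OF Q0A G]
    have as: "fsmooth_map (Q \<times> carrier G) (prod_fatlas \<Q> \<G>) Q \<Q> (\<lambda>(q, a). act q a)"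
      using sact by (simp add: smooth_right_action_def)
    have "fsmooth_map (Q0 \<times> carrier G) (prod_fatlas ?Qz \<G>) (Q \<times> carrier G) (prod_fatlas \<Q> \<G>)
        (\<lambda>z. (((\<lambda>x. x) \<circ> fst) z, snd z))"
      by (rule fsmooth_map_Pair[OF Q G K0A fsmooth_map_compose[OF K0A Q0A Q fsmooth_map_fst[OF Q0A G] iQ]
            fsmooth_map_snd[OF Q0A G]])
    from fsmooth_map_compose[OF K0A KA Q this as]
    have "fsmooth_map (Q0 \<times> carrier G) (prod_fatlas ?Qz \<G>) Q \<Q> (\<lambda>(q, a). act q a)"
      by (simp add: o_def case_prod_unfold)
    moreover have "(\<lambda>(q, a). act q a) z \<in> Q0" if z: "z \<in> Q0 \<times> carrier G" for z
    proof -
      have "z \<in> Q \<times> carrier G" using z Q0sub by auto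
      from fsmooth_map_mem[OF KA Q as this] show ?thesis
        using z act[of "fst z" "snd z"] by (auto simp: Q0_eq)
    qed
    ultimately show "fsmooth_map (Q0 \<times> carrier G) (prod_fatlas ?Qz \<G>) Q0 ?Qz (\<lambda>(q, a). act q a)"
      by (rule fsmooth_map_into_submanifold[OF Q Q0 K0A])
  qed (use sact Q0sub in \<open>unfold smooth_right_action_def, blast+\<close>)
  moreover have "\<pi> ` Q0 = B0" using \<pi>Q B0sub by (auto simp: Q0_eq)
  moreover have "frechet_manifold Q0 ?Qz" "frechet_manifold B0 ?Bz"
    using Qm Bm frechet_manifold_submanifold[OF Q Q0] frechet_manifold_submanifold[OF B B0]
    by (auto simp: frechet_manifold_iff)
  ultimately show ?thesis
    unfolding principal_bundle_iff using lie triv0 by (intro conjI ballI)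
qed

text \<open>The Frechet structure of \<open>Gr S M\<close> is given by any atlas
  \<open>Gr_fatlas\<close> that makes the projection from \<open>Emb S M\<close> a principal bundle.
  Of the geometry it remains to see that the volume condition on \<open>f\<close> involves only its
  image, and that reparametrization does not change the image.\<close>

theorem proposition3p4:
  fixes S :: "('s::topological_space, 'a::real_inner) atlas"
    and M :: "('m::topological_space, 'b::real_inner) atlas"
    and \<mu> :: "'s \<Rightarrow> (nat \<Rightarrow> ('s, 'a) tangent) \<Rightarrow> real"
    and g :: "'m \<Rightarrow> ('m, 'b) tangent \<Rightarrow> ('m, 'b) tangent \<Rightarrow> real"
    and Gr_fatlas :: "('m set, 'w::real_vector) fatlas"
  assumes "smooth_manifold S" "pts S \<noteq> {}" "connected (pts S)" "orientable S" "compact (pts S)"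
    and "smooth_manifold M" "pts M \<noteq> {}" "connected (pts M)" "orientable M" "boundary_pts M = {}"
    and "dim (UNIV :: 'a set) < dim (UNIV :: 'b set)"
    and "volume_form S \<mu>"
    and "riemannian_metric M g"
    and "principal_bundle (Diff_group S) (Diff_fatlas S) (Emb S M) (Emb_fatlas S M) (compose (pts S))
           (Gr S M) Gr_fatlas (\<lambda>f. f ` pts S)"
    and "codim_one_submanifold (Emb S M) (Emb_fatlas S M) (Emb0 S M \<mu> g)"
    and "codim_one_submanifold (Gr S M) Gr_fatlas (Gr0 S M \<mu> g)"
  shows "principal_bundle (Diff_group S) (Diff_fatlas S)
           (Emb0 S M \<mu> g) (submanifold_fatlas (Emb S M) (Emb_fatlas S M) (Emb0 S M \<mu> g)) (compose (pts S))
           (Gr0 S M \<mu> g) (submanifold_fatlas (Gr S M) Gr_fatlas (Gr0 S M \<mu> g)) (\<lambda>f. f ` pts S)"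
proof (rule principal_bundle_codim_one_restriction[OF assms(14-16)])
  \<comment> \<open>Surjectivity of the bundle projection supplies the membership of the image in
    \<open>Gr S M\<close>, the part of \<open>Gr0\<close> that the definition of \<open>Emb0\<close>
    does not mention.\<close>
  have "(\<lambda>f. f ` pts S) ` Emb S M = Gr S M"
    using assms(14) by (simp add: principal_bundle_def)
  then have "f ` pts S \<in> Gr S M" if "f \<in> Emb S M" for f using that by blast
  then show "Emb0 S M \<mu> g = Emb S M \<inter> (\<lambda>f. f ` pts S) -` Gr0 S M \<mu> g"
    by (auto simp: Emb0_def Gr0_def)
next
  fix f a assume "a \<in> carrier (Diff_group S)"
  then have "a ` pts S = pts S"
    by (auto simp: Diff_group_def Diff_def diffeo_def bij_betw_def)
  \<comment> \<open>\<open>compose\<close> agrees with the ordinary composition on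
    \<open>pts S\<close> only, which is enough for the image.\<close>
  moreover have "compose (pts S) f a ` pts S = f ` a ` pts S"
    unfolding image_image by (rule image_cong) (simp_all add: compose_def)
  ultimately show "compose (pts S) f a ` pts S = f ` pts S" by simp
qed

end
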